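(* Let $G/H$ be a homogeneous Finsler space and let $F$ be either a $G$-invariant square metric $F=\dfrac{(\alpha+\beta)^2}{\alpha}$ or a $G$-invariant Randers change of square metric $F=\dfrac{(\alpha+\beta)^2}{\alpha}+\beta$ on $G/H$. If $(G/H,F)$ has vanishing $S$-curvature and negative Ricci curvature, then $F$ is Riemannian.
   Context: Setting: $G$ is a connected Lie group with Lie algebra $\mathfrak g$, acting transitively by isometries of $F$ on the connected smooth manifold $M=G/H$ of dimension $n$; $H$ is the isotropy subgroup of the origin $o=eH$, which is compact, with Lie algebra $\mathfrak h$; $\mathfrak g=\mathfrak h+\mathfrak k$ is a reductive decomposition (a direct sum with $\mathrm{Ad}(h)(\mathfrak k)\subset\mathfrak k$ for all $h\in H$). Metrics: $\alpha$ is a $G$-invariant Riemannian metric and $\beta$ a $G$-invariant $1$-form on $G/H$. In both cases $F=\alpha\,\phi(\beta/\alpha)$, with $\phi(s)=1+2s+s^2$ for the square metric and $\phi(s)=1+3s+s^2$ for its Randers change; $F$ is assumed to be a Finsler metric, i.e. with $b=\|\beta\|_\alpha$ one has $\phi(s)>0$ and $\phi(s)-s\phi'(s)+(b^2-s^2)\phi''(s)>0$ for all $|s|\le b$ (for the square metric: $b<1$). Curvatures: for a Finsler metric $F$, put $g_{ij}=\frac12(F^2)_{y^iy^j}$ and $G^i=\frac14 g^{im}\{(F^2)_{x^ky^m}y^k-(F^2)_{x^m}\}$. The Riemann curvature is $R^i_k(y)=2\frac{\partial G^i}{\partial x^k}-\frac{\partial^2G^i}{\partial x^j\partial y^k}y^j+2G^j\frac{\partial^2G^i}{\partial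 y^j\partial y^k}-\frac{\partial G^i}{\partial y^j}\frac{\partial G^j}{\partial y^k}$, and $Ric(y)=R^i_i(y)$ (trace); negative Ricci curvature means $Ric(y)<0$ for all non-zero tangent vectors $y$. With the Busemann–Hausdorff volume form $\sigma(x)\,dx^1\cdots dx^n$, where $\sigma(x)=\mathrm{Vol}(\mathbb B^n)/\mathrm{Vol}\{(y^i)\in\mathbb R^n: F(x,y^i\partial_{x^i})<1\}$ ($\mathbb B^n$ the Euclidean unit ball), the $S$-curvature is $S(x,y)=\frac{\partial G^i}{\partial y^i}-y^i\frac{\partial}{\partial x^i}\ln\sigma(x)$; vanishing $S$-curvature means $S\equiv0$ on $TM\setminus\{0\}$. $F$ is Riemannian if $F^2$ is a quadratic form on each tangent space. *)

theory Defs
  imports "HOL-Analysis.Analysis" "HOL-Algebra.Group_Action"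
begin

section \<open>Smooth maps between Euclidean spaces\<close>

text \<open>Only meant for open sets \<open>S\<close>.\<close>

primrec Ck_on :: "nat \<Rightarrow> 'a::real_normed_vector set \<Rightarrow> ('a \<Rightarrow> 'b::real_normed_vector) \<Rightarrow> bool" where
  "Ck_on 0 S f \<longleftrightarrow> continuous_on S f"
| "Ck_on (Suc k) S f \<longleftrightarrow>
     (\<forall>x\<in>S. f differentiable (at x)) \<and> (\<forall>v. Ck_on k S (\<lambda>x. frechet_derivative f (at x) v))"

definition smooth_on :: "'a::real_normed_vector set \<Rightarrow> ('a \<Rightarrow> 'b::real_normed_vector) \<Rightarrow> bool" where
  "smooth_on S f \<longleftrightarrow> (\<forall>k. Ck_on k S f)"

section \<open>Smooth manifolds\<close>

text \<open>A chart is a domain together with a coordinate map; the values of the coordinate map outside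
  the domain are irrelevant. The atlas is not required to be maximal.\<close>

type_synonym ('m, 'e) chart = "'m set \<times> ('m \<Rightarrow> 'e)"

record ('m, 'e) mfd =
  mtop :: "'m topology"
  atlas :: "('m, 'e) chart set"

abbreviation points :: "('m, 'e) mfd \<Rightarrow> 'm set" where
  "points M \<equiv> topspace (mtop M)"

definition chart_image :: "('m, 'e) chart \<Rightarrow> 'e set" where
  "chart_image c = snd c ` fst c"

definition chart_inv :: "('m, 'e) chart \<Rightarrow> 'e \<Rightarrow> 'm" where
  "chart_inv c = inv_into (fst c) (snd c)"

definition charts_at :: "('m, 'e) mfd \<Rightarrow> 'm \<Rightarrow> ('m, 'e) chart set" where
  "charts_at M p = {c \<in> atlas M. p \<in> fst c}"

definition smooth_manifold :: "('m, 'e::euclidean_space) mfd \<Rightarrow> bool" where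
  "smooth_manifold M \<longleftrightarrow>
     Hausdorff_space (mtop M) \<and> second_countable (mtop M) \<and>
     \<Union> (fst ` atlas M) = points M \<and>
     (\<forall>c\<in>atlas M. openin (mtop M) (fst c) \<and> open (chart_image c) \<and>
        homeomorphic_map (subtopology (mtop M) (fst c)) (top_of_set (chart_image c)) (snd c)) \<and>
     (\<forall>c\<in>atlas M. \<forall>d\<in>atlas M.
        smooth_on (snd c ` (fst c \<inter> fst d)) (snd d \<circ> chart_inv c))"

definition prod_mfd :: "('m, 'e) mfd \<Rightarrow> ('k, 'f) mfd \<Rightarrow> ('m \<times> 'k, 'e \<times> 'f) mfd" where
  "prod_mfd M N =
     \<lparr> mtop = prod_topology (mtop M) (mtop N),
       atlas = {(fst c \<times> fst d, map_prod (snd c) (snd d)) | c d. c \<in> atlas M \<and> d \<in> atlas N} \<rparr>"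

definition smooth_map ::
  "('m, 'e::euclidean_space) mfd \<Rightarrow> ('k, 'f::euclidean_space) mfd \<Rightarrow> ('m \<Rightarrow> 'k) \<Rightarrow> bool" where
  "smooth_map M N f \<longleftrightarrow>
     continuous_map (mtop M) (mtop N) f \<and>
     (\<forall>c\<in>atlas M. \<forall>d\<in>atlas N.
        smooth_on (snd c ` {p \<in> fst c. f p \<in> fst d}) (snd d \<circ> f \<circ> chart_inv c))"

section \<open>Tangent vectors\<close>

text \<open>A tangent vector at \<open>p\<close> assigns to every chart around \<open>p\<close> its coordinate vector in that chart,
  subject to the usual transformation law. It is zero at charts not containing \<open>p\<close>, so that
  equality of tangent vectors is equality of functions and the vector space operations are the
  pointwise ones.\<close>

type_synonym ('m, 'e) tangent = "('m, 'e) chart \<Rightarrow> 'e"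

definition tangent_space :: "('m, 'e::euclidean_space) mfd \<Rightarrow> 'm \<Rightarrow> ('m, 'e) tangent set" where
  "tangent_space M p =
     {v. (\<forall>c. c \<notin> charts_at M p \<longrightarrow> v c = 0) \<and>
         (\<forall>c\<in>charts_at M p. \<forall>d\<in>charts_at M p.
            v d = frechet_derivative (snd d \<circ> chart_inv c) (at (snd c p)) (v c))}"

text \<open>The tangent vector at \<open>p\<close> with coordinate vector \<open>u\<close> in the chart \<open>c\<close> around \<open>p\<close>, i.e.
  \<open>\<Sum>i. u\<^sub>i \<partial>/\<partial>x\<^sub>i\<close>. For fixed \<open>c\<close> this is a linear isomorphism onto the tangent space,
  so (bi)linearity and smoothness of tensors are stated below through it.\<close>

definition tvec :: "('m, 'e::euclidean_space) mfd \<Rightarrow> 'm \<Rightarrow> ('m, 'e) chart \<Rightarrow> 'e \<Rightarrow> ('m, 'e) tangent" where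
  "tvec M p c u =
     (\<lambda>d. if d \<in> charts_at M p
          then frechet_derivative (snd d \<circ> chart_inv c) (at (snd c p)) u else 0)"

text \<open>By the chain rule, the value does not depend on the chart chosen at \<open>p\<close>.\<close>

definition differential ::
  "('m, 'e::euclidean_space) mfd \<Rightarrow> ('k, 'f::euclidean_space) mfd \<Rightarrow> ('m \<Rightarrow> 'k) \<Rightarrow> 'm \<Rightarrow>
     ('m, 'e) tangent \<Rightarrow> ('k, 'f) tangent" where
  "differential M N f p v =
     (let c = (SOME c. c \<in> charts_at M p)
      in (\<lambda>d. if d \<in> charts_at N (f p)
              then frechet_derivative (snd d \<circ> f \<circ> chart_inv c) (at (snd c p)) (v c) else 0))"

section \<open>Lie groups and reductive homogeneous spaces\<close>

definition lie_group :: "('g, 'x) monoid_scheme \<Rightarrow> ('g, 'e::euclidean_space) mfd \<Rightarrow> bool" where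
  "lie_group G GM \<longleftrightarrow>
     group G \<and> smooth_manifold GM \<and> points GM = carrier G \<and>
     smooth_map (prod_mfd GM GM) GM (\<lambda>(x, y). x \<otimes>\<^bsub>G\<^esub> y) \<and>
     smooth_map GM GM (\<lambda>x. inv\<^bsub>G\<^esub> x)"

text \<open>The Lie algebra of a closed subgroup \<open>H\<close>, as a set of tangent vectors at the identity:
  the initial velocities of the one-parameter subgroups of the Lie group that stay in \<open>H\<close>.\<close>

definition subgroup_lie_algebra ::
  "('g, 'x) monoid_scheme \<Rightarrow> ('g, 'e::euclidean_space) mfd \<Rightarrow> 'g set \<Rightarrow> ('g, 'e) tangent set" where
  "subgroup_lie_algebra G GM H =
     {v \<in> tangent_space GM \<one>\<^bsub>G\<^esub>.
        \<exists>\<gamma> :: real \<Rightarrow> 'g.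
          (\<forall>t. \<gamma> t \<in> H) \<and> (\<forall>s t. \<gamma> (s + t) = \<gamma> s \<otimes>\<^bsub>G\<^esub> \<gamma> t) \<and>
          continuous_map euclideanreal (mtop GM) \<gamma> \<and>
          (\<forall>c\<in>charts_at GM \<one>\<^bsub>G\<^esub>. ((snd c \<circ> \<gamma>) has_vector_derivative v c) (at 0))}"

definition Ad ::
  "('g, 'x) monoid_scheme \<Rightarrow> ('g, 'e::euclidean_space) mfd \<Rightarrow> 'g \<Rightarrow> ('g, 'e) tangent \<Rightarrow> ('g, 'e) tangent"
where
  "Ad G GM h = differential GM GM (\<lambda>x. h \<otimes>\<^bsub>G\<^esub> x \<otimes>\<^bsub>G\<^esub> inv\<^bsub>G\<^esub> h) \<one>\<^bsub>G\<^esub>"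

definition reductive_decomposition ::
  "('g, 'x) monoid_scheme \<Rightarrow> ('g, 'e::euclidean_space) mfd \<Rightarrow> 'g set \<Rightarrow> ('g, 'e) tangent set \<Rightarrow> bool"
where
  "reductive_decomposition G GM H \<kk> \<longleftrightarrow>
     \<kk> \<subseteq> tangent_space GM \<one>\<^bsub>G\<^esub> \<and>
     (\<forall>c\<in>charts_at GM \<one>\<^bsub>G\<^esub>. subspace ((\<lambda>v. v c) ` \<kk>)) \<and>
     (\<forall>v\<in>tangent_space GM \<one>\<^bsub>G\<^esub>.
        \<exists>!w. w \<in> subgroup_lie_algebra G GM H \<times> \<kk> \<and> v = (\<lambda>c. fst w c + snd w c)) \<and>
     (\<forall>h\<in>H. Ad G GM h ` \<kk> \<subseteq> \<kk>)"

text \<open>\<open>M = G/H\<close> with \<open>H\<close> the isotropy subgroup of \<open>p0\<close>: a manifold with a smooth transitive action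
  of the Lie group, where the coset \<open>gH\<close> corresponds to the point \<open>act g p0\<close>.\<close>

definition reductive_homogeneous_space ::
  "('g, 'x) monoid_scheme \<Rightarrow> ('g, 'e::euclidean_space) mfd \<Rightarrow> ('m, 'f::euclidean_space) mfd \<Rightarrow>
     ('g \<Rightarrow> 'm \<Rightarrow> 'm) \<Rightarrow> 'm \<Rightarrow> 'g set \<Rightarrow> ('g, 'e) tangent set \<Rightarrow> bool" where
  "reductive_homogeneous_space G GM M act p0 H \<kk> \<longleftrightarrow>
     lie_group G GM \<and> connected_space (mtop GM) \<and>
     smooth_manifold M \<and> connected_space (mtop M) \<and>
     transitive_action G (points M) act \<and>
     smooth_map (prod_mfd GM M) M (\<lambda>(g, p). act g p) \<and>
     p0 \<in> points M \<and> H = stabilizer G act p0 \<and> compactin (mtop GM) H \<and>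
     reductive_decomposition G GM H \<kk>"

section \<open>Finsler metrics and their curvatures\<close>

text \<open>The coordinate expression \<open>F(x, y)\<close> of a function on the tangent bundle.\<close>

definition local_rep ::
  "('m, real^'n) mfd \<Rightarrow> ('m \<Rightarrow> ('m, real^'n) tangent \<Rightarrow> real) \<Rightarrow> ('m, real^'n) chart \<Rightarrow>
     real^'n \<Rightarrow> real^'n \<Rightarrow> real" where
  "local_rep M F c x y = F (chart_inv c x) (tvec M (chart_inv c x) c y)"

definition dx :: "'n::finite \<Rightarrow> (real^'n \<Rightarrow> real^'n \<Rightarrow> real) \<Rightarrow> real^'n \<Rightarrow> real^'n \<Rightarrow> real" where
  "dx k f x y = frechet_derivative (\<lambda>x. f x y) (at x) (axis k 1)"

definition dy :: "'n::finite \<Rightarrow> (real^'n \<Rightarrow> real^'n \<Rightarrow> real) \<Rightarrow> real^'n \<Rightarrow> real^'n \<Rightarrow> real" where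
  "dy k f x y = frechet_derivative (\<lambda>y. f x y) (at y) (axis k 1)"

text \<open>In the following, \<open>L\<close> is the coordinate expression of a Finsler metric.\<close>

definition sq :: "(real^'n \<Rightarrow> real^'n \<Rightarrow> real) \<Rightarrow> real^'n \<Rightarrow> real^'n \<Rightarrow> real" where
  "sq L x y = (L x y)\<^sup>2"

definition fundamental_tensor ::
  "(real^'n \<Rightarrow> real^'n \<Rightarrow> real) \<Rightarrow> real^'n \<Rightarrow> real^'n \<Rightarrow> real^'n::finite^'n" where
  "fundamental_tensor L x y = (\<chi> i j. dy j (dy i (sq L)) x y / 2)"

definition spray ::
  "(real^'n \<Rightarrow> real^'n \<Rightarrow> real) \<Rightarrow> 'n::finite \<Rightarrow> real^'n \<Rightarrow> real^'n \<Rightarrow> real" where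
  "spray L i x y =
     (\<Sum>m\<in>UNIV. matrix_inv (fundamental_tensor L x y) $ i $ m *
        ((\<Sum>k\<in>UNIV. dy m (dx k (sq L)) x y * y $ k) - dx m (sq L) x y)) / 4"

definition riemann_curvature ::
  "(real^'n \<Rightarrow> real^'n \<Rightarrow> real) \<Rightarrow> 'n::finite \<Rightarrow> 'n \<Rightarrow> real^'n \<Rightarrow> real^'n \<Rightarrow> real" where
  "riemann_curvature L i k x y =
     2 * dx k (spray L i) x y
     - (\<Sum>j\<in>UNIV. dy k (dx j (spray L i)) x y * y $ j)
     + 2 * (\<Sum>j\<in>UNIV. spray L j x y * dy k (dy j (spray L i)) x y)
     - (\<Sum>j\<in>UNIV. dy j (spray L i) x y * dy k (spray L j) x y)"

definition ricci_curvature ::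
  "(real^'n \<Rightarrow> real^'n \<Rightarrow> real) \<Rightarrow> real^'n::finite \<Rightarrow> real^'n \<Rightarrow> real" where
  "ricci_curvature L x y = (\<Sum>i\<in>UNIV. riemann_curvature L i i x y)"

text \<open>Density of the Busemann--Hausdorff volume form.\<close>

definition bh_density :: "(real^'n \<Rightarrow> real^'n \<Rightarrow> real) \<Rightarrow> real^'n::finite \<Rightarrow> real" where
  "bh_density L x =
     measure lebesgue (ball (0 :: real^'n) 1) / measure lebesgue {y. L x y < 1}"

definition S_curvature ::
  "(real^'n \<Rightarrow> real^'n \<Rightarrow> real) \<Rightarrow> real^'n::finite \<Rightarrow> real^'n \<Rightarrow> real" where
  "S_curvature L x y =
     (\<Sum>i\<in>UNIV. dy i (spray L i) x y)
     - (\<Sum>i\<in>UNIV. y $ i * frechet_derivative (\<lambda>x. ln (bh_density L x)) (at x) (axis i 1))"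

definition finsler_metric ::
  "('m, real^'n::finite) mfd \<Rightarrow> ('m \<Rightarrow> ('m, real^'n) tangent \<Rightarrow> real) \<Rightarrow> bool" where
  "finsler_metric M F \<longleftrightarrow>
     (\<forall>p\<in>points M. \<forall>v\<in>tangent_space M p. v \<noteq> (\<lambda>_. 0) \<longrightarrow> F p v > 0) \<and>
     (\<forall>p\<in>points M. \<forall>v\<in>tangent_space M p. \<forall>t>0. F p (\<lambda>c. t *\<^sub>R v c) = t * F p v) \<and>
     (\<forall>c\<in>atlas M.
        smooth_on (chart_image c \<times> (- {0})) (\<lambda>(x, y). local_rep M F c x y) \<and>
        (\<forall>x\<in>chart_image c. \<forall>y. y \<noteq> 0 \<longrightarrow>
           (\<forall>u. u \<noteq> 0 \<longrightarrow> u \<bullet> (fundamental_tensor (local_rep M F c) x y *v u) > 0)))"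

definition vanishing_S_curvature ::
  "('m, real^'n::finite) mfd \<Rightarrow> ('m \<Rightarrow> ('m, real^'n) tangent \<Rightarrow> real) \<Rightarrow> bool" where
  "vanishing_S_curvature M F \<longleftrightarrow>
     (\<forall>c\<in>atlas M. \<forall>x\<in>chart_image c. \<forall>y. y \<noteq> 0 \<longrightarrow> S_curvature (local_rep M F c) x y = 0)"

definition negative_ricci_curvature ::
  "('m, real^'n::finite) mfd \<Rightarrow> ('m \<Rightarrow> ('m, real^'n) tangent \<Rightarrow> real) \<Rightarrow> bool" where
  "negative_ricci_curvature M F \<longleftrightarrow>
     (\<forall>c\<in>atlas M. \<forall>x\<in>chart_image c. \<forall>y. y \<noteq> 0 \<longrightarrow> ricci_curvature (local_rep M F c) x y < 0)"

definition is_riemannian ::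
  "('m, real^'n::finite) mfd \<Rightarrow> ('m \<Rightarrow> ('m, real^'n) tangent \<Rightarrow> real) \<Rightarrow> bool" where
  "is_riemannian M F \<longleftrightarrow>
     (\<forall>p\<in>points M. \<exists>B :: ('m, real^'n) tangent \<Rightarrow> ('m, real^'n) tangent \<Rightarrow> real.
        (\<forall>c\<in>charts_at M p. bilinear (\<lambda>u w. B (tvec M p c u) (tvec M p c w))) \<and>
        (\<forall>v\<in>tangent_space M p. (F p v)\<^sup>2 = B v v))"

definition invariant_under ::
  "('g, 'x) monoid_scheme \<Rightarrow> ('m, 'e::euclidean_space) mfd \<Rightarrow> ('g \<Rightarrow> 'm \<Rightarrow> 'm) \<Rightarrow>
     ('m \<Rightarrow> ('m, 'e) tangent \<Rightarrow> real) \<Rightarrow> bool" where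
  "invariant_under G M act F \<longleftrightarrow>
     (\<forall>g\<in>carrier G. \<forall>p\<in>points M. \<forall>v\<in>tangent_space M p.
        F (act g p) (differential M M (act g) p v) = F p v)"

definition homogeneous_finsler_space ::
  "('g, 'x) monoid_scheme \<Rightarrow> ('g, 'e::euclidean_space) mfd \<Rightarrow> ('m, real^'n::finite) mfd \<Rightarrow>
     ('g \<Rightarrow> 'm \<Rightarrow> 'm) \<Rightarrow> 'm \<Rightarrow> 'g set \<Rightarrow> ('g, 'e) tangent set \<Rightarrow>
     ('m \<Rightarrow> ('m, real^'n) tangent \<Rightarrow> real) \<Rightarrow> bool" where
  "homogeneous_finsler_space G GM M act p0 H \<kk> F \<longleftrightarrow>
     reductive_homogeneous_space G GM M act p0 H \<kk> \<and>
     finsler_metric M F \<and> invariant_under G M act F"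

section \<open>Square metrics and their Randers change\<close>

definition riemannian_metric ::
  "('m, 'e::euclidean_space) mfd \<Rightarrow> ('m \<Rightarrow> ('m, 'e) tangent \<Rightarrow> ('m, 'e) tangent \<Rightarrow> real) \<Rightarrow> bool" where
  "riemannian_metric M a \<longleftrightarrow>
     (\<forall>p\<in>points M.
        (\<forall>c\<in>charts_at M p. bilinear (\<lambda>u w. a p (tvec M p c u) (tvec M p c w))) \<and>
        (\<forall>v\<in>tangent_space M p. \<forall>w\<in>tangent_space M p. a p v w = a p w v) \<and>
        (\<forall>v\<in>tangent_space M p. v \<noteq> (\<lambda>_. 0) \<longrightarrow> a p v v > 0)) \<and>
     (\<forall>c\<in>atlas M. \<forall>u w. smooth_on (chart_image c)
        (\<lambda>x. a (chart_inv c x) (tvec M (chart_inv c x) c u) (tvec M (chart_inv c x) c w)))"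

definition one_form ::
  "('m, 'e::euclidean_space) mfd \<Rightarrow> ('m \<Rightarrow> ('m, 'e) tangent \<Rightarrow> real) \<Rightarrow> bool" where
  "one_form M \<beta> \<longleftrightarrow>
     (\<forall>p\<in>points M. \<forall>c\<in>charts_at M p. linear (\<lambda>u. \<beta> p (tvec M p c u))) \<and>
     (\<forall>c\<in>atlas M. \<forall>u. smooth_on (chart_image c)
        (\<lambda>x. \<beta> (chart_inv c x) (tvec M (chart_inv c x) c u)))"

definition invariant_metric ::
  "('g, 'x) monoid_scheme \<Rightarrow> ('m, 'e::euclidean_space) mfd \<Rightarrow> ('g \<Rightarrow> 'm \<Rightarrow> 'm) \<Rightarrow>
     ('m \<Rightarrow> ('m, 'e) tangent \<Rightarrow> ('m, 'e) tangent \<Rightarrow> real) \<Rightarrow> bool" where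
  "invariant_metric G M act a \<longleftrightarrow>
     (\<forall>g\<in>carrier G. \<forall>p\<in>points M. \<forall>v\<in>tangent_space M p. \<forall>w\<in>tangent_space M p.
        a (act g p) (differential M M (act g) p v) (differential M M (act g) p w) = a p v w)"

text \<open>\<open>\<alpha>(v) = \<surd>a(v, v)\<close>.\<close>

definition metric_norm :: "('m \<Rightarrow> 't \<Rightarrow> 't \<Rightarrow> real) \<Rightarrow> 'm \<Rightarrow> 't \<Rightarrow> real" where
  "metric_norm a p v = sqrt (a p v v)"

definition dual_norm ::
  "('m, 'e::euclidean_space) mfd \<Rightarrow> ('m \<Rightarrow> ('m, 'e) tangent \<Rightarrow> ('m, 'e) tangent \<Rightarrow> real) \<Rightarrow>
     ('m \<Rightarrow> ('m, 'e) tangent \<Rightarrow> real) \<Rightarrow> 'm \<Rightarrow> real" where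
  "dual_norm M a \<beta> p = (SUP v\<in>{v \<in> tangent_space M p. metric_norm a p v = 1}. \<bar>\<beta> p v\<bar>)"

definition square_\<phi> :: "real \<Rightarrow> real" where
  "square_\<phi> s = 1 + 2 * s + s\<^sup>2"

definition square_randers_\<phi> :: "real \<Rightarrow> real" where
  "square_randers_\<phi> s = 1 + 3 * s + s\<^sup>2"

text \<open>The condition for \<open>\<alpha> \<phi>(\<beta>/\<alpha>)\<close> to be a Finsler metric.\<close>

definition alpha_beta_regular ::
  "('m, 'e::euclidean_space) mfd \<Rightarrow> (real \<Rightarrow> real) \<Rightarrow>
     ('m \<Rightarrow> ('m, 'e) tangent \<Rightarrow> ('m, 'e) tangent \<Rightarrow> real) \<Rightarrow> ('m \<Rightarrow> ('m, 'e) tangent \<Rightarrow> real) \<Rightarrow> bool"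
where
  "alpha_beta_regular M \<phi> a \<beta> \<longleftrightarrow>
     (\<forall>p\<in>points M. \<forall>s. \<bar>s\<bar> \<le> dual_norm M a \<beta> p \<longrightarrow>
        \<phi> s > 0 \<and>
        \<phi> s - s * deriv \<phi> s + ((dual_norm M a \<beta> p)\<^sup>2 - s\<^sup>2) * deriv (deriv \<phi>) s > 0)"

text \<open>Division by zero makes both functions below vanish at the zero vector.\<close>

definition square_metric ::
  "('m \<Rightarrow> 't \<Rightarrow> 't \<Rightarrow> real) \<Rightarrow> ('m \<Rightarrow> 't \<Rightarrow> real) \<Rightarrow> 'm \<Rightarrow> 't \<Rightarrow> real" where
  "square_metric a \<beta> p v = (metric_norm a p v + \<beta> p v)\<^sup>2 / metric_norm a p v"

definition square_randers_metric ::
  "('m \<Rightarrow> 't \<Rightarrow> 't \<Rightarrow> real) \<Rightarrow> ('m \<Rightarrow> 't \<Rightarrow> real) \<Rightarrow> 'm \<Rightarrow> 't \<Rightarrow> real" where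
  "square_randers_metric a \<beta> p v =
     (metric_norm a p v + \<beta> p v)\<^sup>2 / metric_norm a p v + \<beta> p v"

lemma square_metric_eq:
  assumes "metric_norm a p v \<noteq> 0"
  shows "square_metric a \<beta> p v = metric_norm a p v * square_\<phi> (\<beta> p v / metric_norm a p v)"
  using assms by (simp add: square_metric_def square_\<phi>_def field_simps power2_eq_square)

lemma square_randers_metric_eq:
  assumes "metric_norm a p v \<noteq> 0"
  shows "square_randers_metric a \<beta> p v =
    metric_norm a p v * square_randers_\<phi> (\<beta> p v / metric_norm a p v)"
  using assms by (simp add: square_randers_metric_def square_randers_\<phi>_def field_simps power2_eq_square)

end

(*
  With X the \<alpha>-dual vector field of \<beta>, homogeneity enters only through the fact that b = |X| is
  constant. Write s = \<beta>/\<alpha> and let G be the spray. In terms of the Euclidean frame of \<alpha> one gets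
  det g = det a * D(s) with D a non-constant polynomial, while the Busemann-Hausdorff density is a
  constant multiple of sqrt(det a). The spray derivative of det g is 2 (dG^i/dy^i) det g, so S = 0
  forces D'(s) times the spray derivative of s to vanish, hence s is constant along geodesics.
  The momentum g_y(X, y) is a function of F and s, so it is conserved as well, and this says that X
  is a Killing field of F. A Killing field of constant length is geodesic, its covariant derivative W
  with reference vector X is skew for g_X, and differentiating these identities once more gives
  Ric(X) = - tr(W^2) >= 0. So negative Ricci curvature is only possible for \<beta> = 0.
*)
theory Submission
  imports Defs
begin

section \<open>Smooth functions\<close>

text \<open>S = 0 makes 2 dG^i/dy^i the spray derivative of ln det a; it is also that of ln det g,
  so the quotient D(s) is conserved. Passing from D(s) to s meets two obstacles. A root of D' is
  avoided by moving y in the direction of X, which changes s unless y and X are parallel. In the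
  parallel case the frame behind the formula for det g degenerates, but there s^2 attains its
  maximum b^2 and has derivative zero. Conservation of the momentum X^i (F^2)_{y^i} is the Killing
  equation because the spray derivative of (F^2)_{y^i} is (F^2)_{x^i}, the Euler-Lagrange equation.
  The Ricci identity comes straight from the coordinate formula: X^j dX^i/dx^j + 2 G^i(x, X) = 0 and
  tr W = 0 hold on the whole patch, so the divergence of the first and the X-derivative of the
  second vanish too, and their difference is Ric(X) + tr(W^2) = 0. The sign follows since tr(W^2) is
  minus a sum of squares in a g_X-orthonormal frame.\<close>

lemma frechet_derivative_cong_open:
  assumes "open S" "x \<in> S" "\<And>z. z \<in> S \<Longrightarrow> f z = g z"
  shows "frechet_derivative f (at x) = frechet_derivative g (at x)"
proof -
  have "(f has_derivative D) (at x) \<longleftrightarrow> (g has_derivative D) (at x)" for D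
    using has_derivative_transform_within_open[of f D x UNIV S g]
      has_derivative_transform_within_open[of g D x UNIV S f] assms by auto
  then show ?thesis
    by (simp add: frechet_derivative_def)
qed

lemma differentiable_cong_open:
  assumes "open S" "x \<in> S" "\<And>z. z \<in> S \<Longrightarrow> f z = g z" "f differentiable (at x)"
  shows "g differentiable (at x)"
  using has_derivative_transform_within_open[of f _ x UNIV S g] assms
  unfolding differentiable_def by blast

lemma Ck_on_cong:
  assumes "open S" "\<And>z. z \<in> S \<Longrightarrow> f z = g z" "Ck_on k S f"
  shows "Ck_on k S g"
  using assms(2,3)
proof (induction k arbitrary: f g)
  case 0
  then show ?case by (simp cong: continuous_on_cong)
next
  case (Suc k)
  have d: "g differentiable (at x)" if "x \<in> S" for x
    using Suc.prems that differentiable_cong_open[OF assms(1), of x f g] by auto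
  have "Ck_on k S (\<lambda>x. frechet_derivative g (at x) v)" for v
    using Suc.IH[of "\<lambda>x. frechet_derivative f (at x) v" "\<lambda>x. frechet_derivative g (at x) v"] Suc.prems
      frechet_derivative_cong_open[OF assms(1), of _ f g] by simp
  then show ?case using d by simp
qed

text \<open>The Leibniz rule leaves one factor undifferentiated, so the induction steps for
  products, inverses and roots also need the hypothesis at the lower order.\<close>

lemma Ck_on_SucD: "Ck_on (Suc k) S f \<Longrightarrow> Ck_on k S f"
proof (induction k arbitrary: f)
  case 0
  then show ?case
    by (auto intro!: continuous_at_imp_continuous_on differentiable_imp_continuous_within)
next
  case (Suc k)
  then show ?case by simp
qed

lemma Ck_on_const: "Ck_on k S (\<lambda>x. c)"
  by (induction k arbitrary: c) auto

lemma Ck_on_bounded_linear: "bounded_linear f \<Longrightarrow> Ck_on k S f"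
proof (cases k)
  case 0
  then show "bounded_linear f \<Longrightarrow> ?thesis" by (simp add: linear_continuous_on)
next
  case (Suc n)
  assume f: "bounded_linear f"
  have "frechet_derivative f (at x) = f" for x
    using frechet_derivative_at[OF bounded_linear_imp_has_derivative[OF f, of "at x"]] by simp
  then show ?thesis
    using f Suc by (simp add: Ck_on_const bounded_linear_imp_differentiable)
qed

lemma Ck_on_add:
  assumes "open S" "Ck_on k S f" "Ck_on k S g"
  shows "Ck_on k S (\<lambda>x. f x + g x)"
  using assms(2,3)
proof (induction k arbitrary: f g)
  case 0
  then show ?case by (simp add: continuous_on_add)
next
  case (Suc k)
  have *: "frechet_derivative (\<lambda>x. f x + g x) (at x) v
     = frechet_derivative f (at x) v + frechet_derivative g (at x) v" if "x \<in> S" for x v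
    using Suc.prems that fun_cong[OF frechet_derivative_at[OF has_derivative_add[of f "frechet_derivative f (at x)" "at x"
      g "frechet_derivative g (at x)"]], of v]
    by (auto simp: frechet_derivative_works[symmetric])
  have "Ck_on k S (\<lambda>x. frechet_derivative (\<lambda>x. f x + g x) (at x) v)" for v
    by (rule Ck_on_cong[OF assms(1) *[symmetric]]) (use Suc in auto)
  then show ?case using Suc.prems by auto
qed

lemma Ck_on_mult:
  fixes f g :: "'a::real_normed_vector \<Rightarrow> real"
  assumes "open S" "Ck_on k S f" "Ck_on k S g"
  shows "Ck_on k S (\<lambda>x. f x * g x)"
  using assms(2,3)
proof (induction k arbitrary: f g)
  case 0
  then show ?case by (simp add: continuous_on_mult)
next
  case (Suc k)
  have *: "frechet_derivative (\<lambda>x. f x * g x) (at x) v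
     = f x * frechet_derivative g (at x) v + frechet_derivative f (at x) v * g x" if "x \<in> S" for x v
    using Suc.prems that fun_cong[OF frechet_derivative_at[OF has_derivative_mult[of f "frechet_derivative f (at x)" x UNIV
      g "frechet_derivative g (at x)"]], of v]
    by (auto simp: frechet_derivative_works[symmetric])
  have "Ck_on k S (\<lambda>x. frechet_derivative (\<lambda>x. f x * g x) (at x) v)" for v
    by (rule Ck_on_cong[OF assms(1) *[symmetric]])
      (use Suc.IH Suc.prems Ck_on_SucD[OF Suc.prems(1)] Ck_on_SucD[OF Suc.prems(2)] in
        \<open>auto intro!: Ck_on_add assms(1)\<close>)
  then show ?case using Suc.prems by auto
qed

text \<open>The derivative of \<open>1/f\<close> is again a product with factors \<open>1/f\<close>,
  so the induction on \<open>k\<close> supplies the smoothness of these factors at the lower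
  order.\<close>

lemma Ck_on_inverse:
  fixes f :: "'a::real_normed_vector \<Rightarrow> real"
  assumes "open S" "Ck_on k S f" "\<And>x. x \<in> S \<Longrightarrow> f x \<noteq> 0"
  shows "Ck_on k S (\<lambda>x. inverse (f x))"
  using assms(2)
proof (induction k)
  case 0
  then show ?case using assms(3) by (simp add: continuous_on_inverse)
next
  case (Suc k)
  have *: "frechet_derivative (\<lambda>x. inverse (f x)) (at x) v
     = (-1) * ((inverse (f x) * frechet_derivative f (at x) v) * inverse (f x))" if "x \<in> S" for x v
    using Suc.prems that assms(3)[OF that]
      fun_cong[OF frechet_derivative_at[OF Deriv.has_derivative_inverse[of f x "frechet_derivative f (at x)" UNIV]], of v]
    by (auto simp: frechet_derivative_works[symmetric])
  have I: "Ck_on k S (\<lambda>x. inverse (f x))"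
    using Suc Ck_on_SucD by blast
  have "Ck_on k S (\<lambda>x. frechet_derivative f (at x) v)" for v
    using Suc.prems by simp
  then have "Ck_on k S (\<lambda>x. (-1) * ((inverse (f x) * frechet_derivative f (at x) v) * inverse (f x)))" for v
    by (intro Ck_on_mult Ck_on_const I assms(1))
  then have "Ck_on k S (\<lambda>x. frechet_derivative (\<lambda>x. inverse (f x)) (at x) v)" for v
    by (rule Ck_on_cong[OF assms(1) *[symmetric], rotated])
  then show ?case using Suc.prems assms(3) by auto
qed

lemma Ck_on_sqrt:
  assumes "open S" "Ck_on k S f" "\<And>x. x \<in> S \<Longrightarrow> f x > 0"
  shows "Ck_on k S (\<lambda>x. sqrt (f x))"
  using assms(2)
proof (induction k)
  case 0
  then show ?case by (simp add: continuous_on_real_sqrt)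
next
  case (Suc k)
  have *: "((\<lambda>x. sqrt (f x)) has_derivative
      (\<lambda>v. (inverse (sqrt (f x)) * (1/2)) * frechet_derivative f (at x) v)) (at x)" if "x \<in> S" for x
    using Suc.prems that assms(3)[OF that]
    by (auto intro!: derivative_eq_intros simp: frechet_derivative_works[symmetric] field_simps)
  have I: "Ck_on k S (\<lambda>x. sqrt (f x))"
    using Suc Ck_on_SucD by blast
  have "Ck_on k S (\<lambda>x. frechet_derivative f (at x) v)" for v
    using Suc.prems by simp
  then have "Ck_on k S (\<lambda>x. (inverse (sqrt (f x)) * (1/2)) * frechet_derivative f (at x) v)" for v
    by (intro Ck_on_mult Ck_on_inverse Ck_on_const I assms(1)) (use assms(3) in force)+
  then have "Ck_on k S (\<lambda>x. frechet_derivative (\<lambda>x. sqrt (f x)) (at x) v)" for v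
    by (rule Ck_on_cong[OF assms(1) fun_cong[OF frechet_derivative_at[OF *]], rotated])
  then show ?case using * by (auto simp: differentiable_def)
qed

lemma Ck_on_compose_fst:
  assumes "open S" "open T" "Ck_on k S f"
  shows "Ck_on k (S \<times> T) (\<lambda>z. f (fst z))"
  using assms(3)
proof (induction k arbitrary: f)
  case 0
  then show ?case
    by (auto intro!: continuous_on_compose2[OF _ continuous_on_fst[OF continuous_on_id]])
next
  case (Suc k)
  have *: "((\<lambda>z. f (fst z)) has_derivative (\<lambda>w. frechet_derivative f (at (fst z)) (fst w))) (at z)"
    if "z \<in> S \<times> T" for z
  proof (rule has_derivative_compose[of fst fst z UNIV f, simplified])
    show "(fst has_derivative fst) (at z)"
      by (rule has_derivative_fst) (rule has_derivative_ident)
    show "(f has_derivative frechet_derivative f (at (fst z))) (at (fst z))"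
      using Suc.prems that by (auto simp: frechet_derivative_works[symmetric])
  qed
  have "Ck_on k (S \<times> T) (\<lambda>z. frechet_derivative (\<lambda>z. f (fst z)) (at z) w)" for w
    by (rule Ck_on_cong[OF open_Times[OF assms(1,2)] fun_cong[OF frechet_derivative_at[OF *]]])
      (use Suc in auto)
  moreover have "(\<lambda>z. f (fst z)) differentiable (at z)" if "z \<in> S \<times> T" for z
    using *[OF that] unfolding differentiable_def by blast
  ultimately show ?case by simp
qed

lemma smooth_on_cong:
  "open S \<Longrightarrow> (\<And>z. z \<in> S \<Longrightarrow> f z = g z) \<Longrightarrow> smooth_on S f \<Longrightarrow> smooth_on S g"
  unfolding smooth_on_def using Ck_on_cong by blast

lemma smooth_on_const [simp]: "smooth_on S (\<lambda>x. c)"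
  by (simp add: smooth_on_def Ck_on_const)

lemma smooth_on_bounded_linear: "bounded_linear f \<Longrightarrow> smooth_on S f"
  by (simp add: smooth_on_def Ck_on_bounded_linear)

lemma smooth_on_add:
  "open S \<Longrightarrow> smooth_on S f \<Longrightarrow> smooth_on S g \<Longrightarrow> smooth_on S (\<lambda>x. f x + g x)"
  by (simp add: smooth_on_def Ck_on_add)

lemma smooth_on_mult:
  fixes f g :: "'a::real_normed_vector \<Rightarrow> real"
  shows "open S \<Longrightarrow> smooth_on S f \<Longrightarrow> smooth_on S g \<Longrightarrow> smooth_on S (\<lambda>x. f x * g x)"
  by (simp add: smooth_on_def Ck_on_mult)

lemma smooth_on_inverse:
  fixes f :: "'a::real_normed_vector \<Rightarrow> real"
  shows "open S \<Longrightarrow> smooth_on S f \<Longrightarrow> (\<And>x. x \<in> S \<Longrightarrow> f x \<noteq> 0) \<Longrightarrow> smooth_on S (\<lambda>x. inverse (f x))"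
  by (simp add: smooth_on_def Ck_on_inverse)

lemma smooth_on_sum:
  fixes f :: "'i \<Rightarrow> 'a::real_normed_vector \<Rightarrow> real"
  shows "open S \<Longrightarrow> (\<And>i. i \<in> I \<Longrightarrow> smooth_on S (f i)) \<Longrightarrow> smooth_on S (\<lambda>x. \<Sum>i\<in>I. f i x)"
  by (induction I rule: infinite_finite_induct) (auto intro: smooth_on_add)

lemma smooth_on_prod:
  fixes f :: "'i \<Rightarrow> 'a::real_normed_vector \<Rightarrow> real"
  shows "open S \<Longrightarrow> (\<And>i. i \<in> I \<Longrightarrow> smooth_on S (f i)) \<Longrightarrow> smooth_on S (\<lambda>x. \<Prod>i\<in>I. f i x)"
  by (induction I rule: infinite_finite_induct) (auto intro: smooth_on_mult)

lemma smooth_on_det: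
  fixes A :: "'a::real_normed_vector \<Rightarrow> real^'n^'n"
  assumes "open S" "\<And>i j. smooth_on S (\<lambda>x. A x $ i $ j)"
  shows "smooth_on S (\<lambda>x. det (A x))"
  unfolding det_def by (intro smooth_on_sum smooth_on_mult smooth_on_const smooth_on_prod assms)

lemma smooth_on_sqrt:
  "open S \<Longrightarrow> smooth_on S f \<Longrightarrow> (\<And>x. x \<in> S \<Longrightarrow> f x > 0) \<Longrightarrow> smooth_on S (\<lambda>x. sqrt (f x))"
  by (simp add: smooth_on_def Ck_on_sqrt)

lemma smooth_on_compose_fst:
  "open S \<Longrightarrow> open T \<Longrightarrow> smooth_on S f \<Longrightarrow> smooth_on (S \<times> T) (\<lambda>z. f (fst z))"
  by (simp add: smooth_on_def Ck_on_compose_fst)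

lemma smooth_on_differentiable: "smooth_on S f \<Longrightarrow> x \<in> S \<Longrightarrow> f differentiable (at x)"
  unfolding smooth_on_def using Ck_on.simps(2)[of 0 S f] by blast

lemma smooth_on_frechet_derivative:
  "smooth_on S f \<Longrightarrow> smooth_on S (\<lambda>x. frechet_derivative f (at x) v)"
  unfolding smooth_on_def using Ck_on.simps(2)[of _ S f] by blast

lemma smooth_on_continuous_on: "smooth_on S f \<Longrightarrow> continuous_on S f"
  unfolding smooth_on_def using Ck_on.simps(1)[of S f] by blast

text \<open>Two applications of the mean value theorem: to the difference quotient in
  \<open>v\<close> as a function of the parameter along \<open>u\<close>, then to the
  \<open>u\<close>-derivative along \<open>v\<close>. The left side is symmetric in \<open>u\<close>
  and \<open>v\<close>, the right side is not visibly so.\<close>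

lemma second_difference_mean_value:
  fixes f :: "'a::real_normed_vector \<Rightarrow> real"
  assumes f: "\<And>z. z \<in> S \<Longrightarrow> f differentiable (at z)"
    and f': "\<And>z. z \<in> S \<Longrightarrow> (\<lambda>z. frechet_derivative f (at z) u) differentiable (at z)"
    and h: "h > 0" and S: "\<And>s t. 0 \<le> s \<Longrightarrow> s \<le> h \<Longrightarrow> 0 \<le> t \<Longrightarrow> t \<le> h \<Longrightarrow> x + s *\<^sub>R u + t *\<^sub>R v \<in> S"
  shows "\<exists>s t. 0 \<le> s \<and> s \<le> h \<and> 0 \<le> t \<and> t \<le> h \<and>
     f (x + h *\<^sub>R u + h *\<^sub>R v) - f (x + h *\<^sub>R u) - f (x + h *\<^sub>R v) + f x
      = h * h * frechet_derivative (\<lambda>z. frechet_derivative f (at z) u) (at (x + s *\<^sub>R u + t *\<^sub>R v)) v"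
proof -
  define D where "D = (\<lambda>z. frechet_derivative f (at z) u)"
  have df: "((\<lambda>s. f (x + s *\<^sub>R u + t *\<^sub>R v)) has_real_derivative D (x + s *\<^sub>R u + t *\<^sub>R v)) (at s)"
    if "0 \<le> s" "s \<le> h" "0 \<le> t" "t \<le> h" for s t
  proof -
    have "((\<lambda>s. x + s *\<^sub>R u + t *\<^sub>R v) has_derivative (\<lambda>r. r *\<^sub>R u)) (at s)"
      by (auto intro!: derivative_eq_intros)
    moreover have "(f has_derivative frechet_derivative f (at (x + s *\<^sub>R u + t *\<^sub>R v))) (at (x + s *\<^sub>R u + t *\<^sub>R v))"
      using f[OF S[OF that]] by (simp add: frechet_derivative_works[symmetric])
    ultimately have "((\<lambda>s. f (x + s *\<^sub>R u + t *\<^sub>R v)) has_derivative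
        (\<lambda>r. frechet_derivative f (at (x + s *\<^sub>R u + t *\<^sub>R v)) (r *\<^sub>R u))) (at s)"
      by (rule has_derivative_compose)
    then show ?thesis
      unfolding has_field_derivative_def D_def
      using linear_frechet_derivative[OF f[OF S[OF that]]]
      by (simp add: linear_cmul mult_commute_abs)
  qed
  have dD: "((\<lambda>t. D (x + s *\<^sub>R u + t *\<^sub>R v)) has_real_derivative
      frechet_derivative D (at (x + s *\<^sub>R u + t *\<^sub>R v)) v) (at t)"
    if "0 \<le> s" "s \<le> h" "0 \<le> t" "t \<le> h" for s t
  proof -
    have "((\<lambda>t. x + s *\<^sub>R u + t *\<^sub>R v) has_derivative (\<lambda>r. r *\<^sub>R v)) (at t)"
      by (auto intro!: derivative_eq_intros)
    moreover have "(D has_derivative frechet_derivative D (at (x + s *\<^sub>R u + t *\<^sub>R v))) (at (x + s *\<^sub>R u + t *\<^sub>R v))"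
      using f'[OF S[OF that]] by (simp add: frechet_derivative_works[symmetric] D_def)
    ultimately have "((\<lambda>t. D (x + s *\<^sub>R u + t *\<^sub>R v)) has_derivative
        (\<lambda>r. frechet_derivative D (at (x + s *\<^sub>R u + t *\<^sub>R v)) (r *\<^sub>R v))) (at t)"
      by (rule has_derivative_compose)
    then show ?thesis
      unfolding has_field_derivative_def
      using linear_frechet_derivative[OF f'[OF S[OF that]]]
      by (simp add: linear_cmul mult_commute_abs D_def)
  qed
  have df0: "((\<lambda>s. f (x + s *\<^sub>R u)) has_real_derivative D (x + s *\<^sub>R u)) (at s)"
    if "0 \<le> s" "s \<le> h" for s
    using df[of s 0] that h by simp
  define g where "g = (\<lambda>s. f (x + s *\<^sub>R u + h *\<^sub>R v) - f (x + s *\<^sub>R u + 0 *\<^sub>R v))"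
  have "\<exists>s. 0 < s \<and> s < h \<and> g h - g 0 = (h - 0) * (D (x + s *\<^sub>R u + h *\<^sub>R v) - D (x + s *\<^sub>R u + 0 *\<^sub>R v))"
    unfolding g_def using h by (intro MVT2) (auto intro!: DERIV_diff df df0)
  then obtain s where s: "0 < s" "s < h"
    and gs: "g h - g 0 = h * (D (x + s *\<^sub>R u + h *\<^sub>R v) - D (x + s *\<^sub>R u + 0 *\<^sub>R v))"
    by auto
  have "\<exists>t. 0 < t \<and> t < h \<and> D (x + s *\<^sub>R u + h *\<^sub>R v) - D (x + s *\<^sub>R u + 0 *\<^sub>R v)
      = (h - 0) * frechet_derivative D (at (x + s *\<^sub>R u + t *\<^sub>R v)) v"
    using h s by (intro MVT2) (auto intro!: dD)
  then obtain t where t: "0 < t" "t < h"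
    and "D (x + s *\<^sub>R u + h *\<^sub>R v) - D (x + s *\<^sub>R u + 0 *\<^sub>R v)
      = h * frechet_derivative D (at (x + s *\<^sub>R u + t *\<^sub>R v)) v"
    by auto
  then have "f (x + h *\<^sub>R u + h *\<^sub>R v) - f (x + h *\<^sub>R u) - f (x + h *\<^sub>R v) + f x
      = h * h * frechet_derivative D (at (x + s *\<^sub>R u + t *\<^sub>R v)) v"
    using gs by (simp add: g_def)
  then show ?thesis
    using s t unfolding D_def by (metis less_imp_le)
qed

text \<open>The symmetric second difference equals \<open>h * h\<close> times either mixed
  derivative at points near \<open>x\<close>; continuity then excludes different values at
  \<open>x\<close>.\<close>

lemma smooth_on_second_derivative_commute:
  fixes f :: "'a::real_normed_vector \<Rightarrow> real"
  assumes "open S" "x \<in> S" "smooth_on S f"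
  shows "frechet_derivative (\<lambda>z. frechet_derivative f (at z) u) (at x) v
       = frechet_derivative (\<lambda>z. frechet_derivative f (at z) v) (at x) u"
proof (rule ccontr)
  define P where "P = (\<lambda>z. frechet_derivative (\<lambda>z. frechet_derivative f (at z) u) (at z) v)"
  define Q where "Q = (\<lambda>z. frechet_derivative (\<lambda>z. frechet_derivative f (at z) v) (at z) u)"
  assume "\<not> ?thesis"
  then have ne: "P x \<noteq> Q x" by (simp add: P_def Q_def)
  define e where "e = \<bar>P x - Q x\<bar> / 2"
  have e: "e > 0" using ne by (simp add: e_def)
  have "continuous (at x) P" "continuous (at x) Q"
    using assms unfolding P_def Q_def
    by (auto intro!: differentiable_imp_continuous_within smooth_on_differentiable[of S] smooth_on_frechet_derivative)
  then obtain d1 d2 where d1: "d1 > 0" "\<And>z. dist z x < d1 \<Longrightarrow> dist (P z) (P x) < e"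
    and d2: "d2 > 0" "\<And>z. dist z x < d2 \<Longrightarrow> dist (Q z) (Q x) < e"
    using e unfolding continuous_at_eps_delta by (metis dist_commute)
  obtain d3 where d3: "d3 > 0" "ball x d3 \<subseteq> S"
    using assms openE by blast
  define d where "d = min d1 (min d2 d3)"
  have d: "d > 0" using d1 d2 d3 by (simp add: d_def)
  \<comment> \<open>Small enough for the whole parallelogram with sides \<open>h u\<close> and
    \<open>h v\<close> to stay within \<open>d\<close> of \<open>x\<close>; the summand 1 covers
    \<open>u = v = 0\<close>.\<close>
  define h where "h = d / (2 * (1 + norm u + norm v))"
  have N: "1 + norm u + norm v > 0"
    using norm_ge_zero[of u] norm_ge_zero[of v] by linarith
  have h: "h > 0" using d N by (simp add: h_def)
  have near: "dist (x + s *\<^sub>R u + t *\<^sub>R v) x < d" if "0 \<le> s" "s \<le> h" "0 \<le> t" "t \<le> h" for s t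
  proof -
    have "dist (x + s *\<^sub>R u + t *\<^sub>R v) x \<le> s * norm u + t * norm v"
      using norm_triangle_ineq[of "s *\<^sub>R u" "t *\<^sub>R v"] that by (simp add: dist_norm)
    also have "\<dots> \<le> h * norm u + h * norm v"
      using that by (intro add_mono mult_right_mono) auto
    also have "\<dots> < h * (2 * (1 + norm u + norm v))"
    proof -
      have "h * norm u \<ge> 0" "h * norm v \<ge> 0" using h by auto
      then have "0 < h * norm u + (h * norm v + h * 2)" using h by linarith
      then show ?thesis by (simp add: algebra_simps)
    qed
    also have "\<dots> = d" using N by (simp add: h_def)
    finally show ?thesis .
  qed
  have inS: "x + s *\<^sub>R u + t *\<^sub>R v \<in> S" if "0 \<le> s" "s \<le> h" "0 \<le> t" "t \<le> h" for s t
    using near[OF that] d3 by (auto simp: d_def dist_commute)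
  have inS': "x + s *\<^sub>R v + t *\<^sub>R u \<in> S" if "0 \<le> s" "s \<le> h" "0 \<le> t" "t \<le> h" for s t
    using inS[OF that(3,4,1,2)] by (simp add: algebra_simps)
  have df: "f differentiable (at z)" "(\<lambda>z. frechet_derivative f (at z) w) differentiable (at z)"
    if "z \<in> S" for z w
    using assms that by (auto intro!: smooth_on_differentiable[of S] smooth_on_frechet_derivative)
  obtain s t where st: "0 \<le> s" "s \<le> h" "0 \<le> t" "t \<le> h"
    and 1: "f (x + h *\<^sub>R u + h *\<^sub>R v) - f (x + h *\<^sub>R u) - f (x + h *\<^sub>R v) + f x
      = h * h * P (x + s *\<^sub>R u + t *\<^sub>R v)"
    using second_difference_mean_value[of S f u h x v, OF df h inS] unfolding P_def by blast
  obtain s' t' where st': "0 \<le> s'" "s' \<le> h" "0 \<le> t'" "t' \<le> h"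
    and 2: "f (x + h *\<^sub>R v + h *\<^sub>R u) - f (x + h *\<^sub>R v) - f (x + h *\<^sub>R u) + f x
      = h * h * Q (x + s' *\<^sub>R v + t' *\<^sub>R u)"
    using second_difference_mean_value[of S f v h x u, OF df h inS'] unfolding Q_def by blast
  have swap: "x + h *\<^sub>R v + h *\<^sub>R u = x + h *\<^sub>R u + h *\<^sub>R v" by simp
  have "h * h * P (x + s *\<^sub>R u + t *\<^sub>R v) = h * h * Q (x + s' *\<^sub>R v + t' *\<^sub>R u)"
    using 1 2 unfolding swap by linarith
  then have "P (x + s *\<^sub>R u + t *\<^sub>R v) = Q (x + s' *\<^sub>R v + t' *\<^sub>R u)"
    using h by simp
  moreover have "x + s' *\<^sub>R v + t' *\<^sub>R u = x + t' *\<^sub>R u + s' *\<^sub>R v" by simp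
  moreover have "dist (P (x + s *\<^sub>R u + t *\<^sub>R v)) (P x) < e"
    using near[OF st] by (intro d1) (simp add: d_def)
  moreover have "dist (Q (x + t' *\<^sub>R u + s' *\<^sub>R v)) (Q x) < e"
    using near[OF st'(3,4,1,2)] by (intro d2) (simp add: d_def)
  ultimately show False
    unfolding e_def dist_real_def by (simp add: abs_if split: if_splits)
qed

section \<open>Derivations on the slit tangent bundle\<close>

text \<open>A joint derivative in \<open>(x, y)\<close> instead of separate partial ones: coordinate
  derivatives, the spray and tangents of a section become directions of one operator with one
  product rule and one commutation rule.\<close>

definition pd :: "(real^'n) \<times> (real^'n) \<Rightarrow> (real^'n \<Rightarrow> real^'n \<Rightarrow> real) \<Rightarrow> real^'n::finite \<Rightarrow> real^'n \<Rightarrow> real" where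
  "pd w f x y = frechet_derivative (\<lambda>(x, y). f x y) (at (x, y)) w"

abbreviation px :: "'n \<Rightarrow> (real^'n \<Rightarrow> real^'n \<Rightarrow> real) \<Rightarrow> real^'n::finite \<Rightarrow> real^'n \<Rightarrow> real" where
  "px k \<equiv> pd (axis k 1, 0)"

abbreviation py :: "'n \<Rightarrow> (real^'n \<Rightarrow> real^'n \<Rightarrow> real) \<Rightarrow> real^'n::finite \<Rightarrow> real^'n \<Rightarrow> real" where
  "py k \<equiv> pd (0, axis k 1)"

text \<open>Smoothness on the slit tangent bundle: \<open>F\<close> is not smooth at \<open>y = 0\<close>.\<close>

definition sm :: "(real^'n) set \<Rightarrow> (real^'n \<Rightarrow> real^'n \<Rightarrow> real) \<Rightarrow> bool" where
  "sm U f \<longleftrightarrow> open U \<and> smooth_on (U \<times> (- {0})) (\<lambda>(x, y). f x y)"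

lemma sm_open: "sm U f \<Longrightarrow> open U"
  by (simp add: sm_def)

lemma open_slit: "open U \<Longrightarrow> open (U \<times> (- {0 :: 'a::real_normed_vector}))"
  by (simp add: open_Times open_Compl)

lemma sm_has_derivative:
  assumes "sm U f" "x \<in> U" "y \<noteq> 0"
  shows "((\<lambda>(x, y). f x y) has_derivative (\<lambda>w. pd w f x y)) (at (x, y))"
  using assms smooth_on_differentiable[of "U \<times> (- {0})" "\<lambda>(x, y). f x y" "(x, y)"]
  unfolding pd_def sm_def by (simp add: frechet_derivative_works[symmetric])

lemma pd_eqI:
  assumes "((\<lambda>(x, y). f x y) has_derivative D) (at (x, y))"
  shows "pd w f x y = D w"
  using frechet_derivative_at[OF assms] by (simp add: pd_def)

lemma sm_cong:
  assumes "sm U f" "\<And>x y. x \<in> U \<Longrightarrow> y \<noteq> 0 \<Longrightarrow> f x y = g x y"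
  shows "sm U g"
  using assms unfolding sm_def by (auto intro!: smooth_on_cong[OF open_slit, of U "\<lambda>(x, y). f x y" "\<lambda>(x, y). g x y"])

lemma pd_cong:
  assumes "open U" "x \<in> U" "y \<noteq> 0" "\<And>x y. x \<in> U \<Longrightarrow> y \<noteq> 0 \<Longrightarrow> f x y = g x y"
  shows "pd w f x y = pd w g x y"
  unfolding pd_def using assms
  by (subst frechet_derivative_cong_open[OF open_slit, of U "(x, y)" _ "\<lambda>(x, y). g x y"]) auto

lemma sm_pd: "sm U f \<Longrightarrow> sm U (pd w f)"
  unfolding sm_def pd_def
  using smooth_on_frechet_derivative[of "U \<times> (- {0})" "\<lambda>(x, y). f x y" w]
  by (simp add: case_prod_beta')

lemma pd_commute:
  assumes "sm U f" "x \<in> U" "y \<noteq> 0"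
  shows "pd v (pd w f) x y = pd w (pd v f) x y"
  using smooth_on_second_derivative_commute[OF open_slit, of U "(x, y)" "\<lambda>(x, y). f x y" w v] assms
  unfolding sm_def pd_def by (simp add: case_prod_beta')

lemma sm_const: "open U \<Longrightarrow> sm U (\<lambda>x y. c)"
  by (simp add: sm_def case_prod_beta')

lemma sm_add: "sm U f \<Longrightarrow> sm U g \<Longrightarrow> sm U (\<lambda>x y. f x y + g x y)"
  unfolding sm_def using smooth_on_add[OF open_slit, of U "\<lambda>(x, y). f x y" "\<lambda>(x, y). g x y"]
  by (simp add: case_prod_beta')

lemma sm_mult: "sm U f \<Longrightarrow> sm U g \<Longrightarrow> sm U (\<lambda>x y. f x y * g x y)"
  unfolding sm_def using smooth_on_mult[OF open_slit, of U "\<lambda>(x, y). f x y" "\<lambda>(x, y). g x y"]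
  by (simp add: case_prod_beta')

lemma sm_uminus: "sm U f \<Longrightarrow> sm U (\<lambda>x y. - f x y)"
  using sm_mult[OF sm_const, of U f "-1"] by (simp add: sm_open)

lemma sm_diff: "sm U f \<Longrightarrow> sm U g \<Longrightarrow> sm U (\<lambda>x y. f x y - g x y)"
  using sm_add[OF _ sm_uminus, of U f g] by simp

lemma sm_power: "sm U f \<Longrightarrow> sm U (\<lambda>x y. f x y ^ m)"
  by (induction m) (auto intro: sm_mult sm_const sm_open)

lemma sm_inverse:
  "sm U f \<Longrightarrow> (\<And>x y. x \<in> U \<Longrightarrow> y \<noteq> 0 \<Longrightarrow> f x y \<noteq> 0) \<Longrightarrow> sm U (\<lambda>x y. inverse (f x y))"
  unfolding sm_def using smooth_on_inverse[OF open_slit, of U "\<lambda>(x, y). f x y"]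
  by (force simp: case_prod_beta')

lemma sm_divide:
  "sm U f \<Longrightarrow> sm U g \<Longrightarrow> (\<And>x y. x \<in> U \<Longrightarrow> y \<noteq> 0 \<Longrightarrow> g x y \<noteq> 0) \<Longrightarrow> sm U (\<lambda>x y. f x y / g x y)"
  using sm_mult[OF _ sm_inverse, of U f g] by (simp add: divide_inverse)

lemma sm_sqrt:
  "sm U f \<Longrightarrow> (\<And>x y. x \<in> U \<Longrightarrow> y \<noteq> 0 \<Longrightarrow> f x y > 0) \<Longrightarrow> sm U (\<lambda>x y. sqrt (f x y))"
  unfolding sm_def using smooth_on_sqrt[OF open_slit, of U "\<lambda>(x, y). f x y"]
  by (force simp: case_prod_beta')

lemma sm_sum: "open U \<Longrightarrow> (\<And>i. i \<in> I \<Longrightarrow> sm U (f i)) \<Longrightarrow> sm U (\<lambda>x y. \<Sum>i\<in>I. f i x y)"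
  by (induction I rule: infinite_finite_induct) (auto intro: sm_add sm_const)

lemma sm_prod: "open U \<Longrightarrow> (\<And>i. i \<in> I \<Longrightarrow> sm U (f i)) \<Longrightarrow> sm U (\<lambda>x y. \<Prod>i\<in>I. f i x y)"
  by (induction I rule: infinite_finite_induct) (auto intro: sm_mult sm_const)

lemma sm_base: "open U \<Longrightarrow> smooth_on U f \<Longrightarrow> sm U (\<lambda>x y. f x)"
  unfolding sm_def using smooth_on_compose_fst[of U "- {0}" f]
  by (simp add: case_prod_beta' open_Compl)

lemma sm_component: "open U \<Longrightarrow> sm U (\<lambda>x y. y $ i)"
  unfolding sm_def
  by (auto intro!: smooth_on_bounded_linear
      bounded_linear_compose[OF bounded_linear_vec_nth bounded_linear_snd] simp: case_prod_beta')

section \<open>Differentiation rules on the slit tangent bundle\<close>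

lemma pd_const: "pd w (\<lambda>x y. c) x y = 0"
  by (rule pd_eqI[where D = "\<lambda>w. 0", simplified]) (simp add: case_prod_beta')

lemma pd_add:
  assumes "sm U f" "sm U g" "x \<in> U" "y \<noteq> 0"
  shows "pd w (\<lambda>x y. f x y + g x y) x y = pd w f x y + pd w g x y"
  using has_derivative_add[OF sm_has_derivative[OF assms(1,3,4)] sm_has_derivative[OF assms(2-4)]]
  by (intro pd_eqI) (simp add: case_prod_beta')

lemma pd_mult:
  assumes "sm U f" "sm U g" "x \<in> U" "y \<noteq> 0"
  shows "pd w (\<lambda>x y. f x y * g x y) x y = f x y * pd w g x y + pd w f x y * g x y"
  using has_derivative_mult[OF sm_has_derivative[OF assms(1,3,4)] sm_has_derivative[OF assms(2-4)]]
  by (intro pd_eqI) (simp add: case_prod_beta')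

lemma pd_cmult:
  assumes "sm U f" "x \<in> U" "y \<noteq> 0"
  shows "pd w (\<lambda>x y. c * f x y) x y = c * pd w f x y"
  using pd_mult[OF sm_const[OF sm_open[OF assms(1)]] assms] by (simp add: pd_const)

lemma pd_uminus:
  assumes "sm U f" "x \<in> U" "y \<noteq> 0"
  shows "pd w (\<lambda>x y. - f x y) x y = - pd w f x y"
  using pd_cmult[OF assms, of w "-1"] by simp

lemma pd_diff:
  assumes "sm U f" "sm U g" "x \<in> U" "y \<noteq> 0"
  shows "pd w (\<lambda>x y. f x y - g x y) x y = pd w f x y - pd w g x y"
  using pd_add[OF assms(1) sm_uminus[OF assms(2)] assms(3,4)] pd_uminus[OF assms(2-4)] by simp

lemma pd_sum:
  assumes "open U" "\<And>i. i \<in> I \<Longrightarrow> sm U (f i)" "x \<in> U" "y \<noteq> 0"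
  shows "pd w (\<lambda>x y. \<Sum>i\<in>I. f i x y) x y = (\<Sum>i\<in>I. pd w (f i) x y)"
  using assms(2)
proof (induction I rule: infinite_finite_induct)
  case (insert i I)
  then show ?case
    using pd_add[of U "f i" "\<lambda>x y. \<Sum>i\<in>I. f i x y" x y w] sm_sum[OF assms(1), of I f] assms
    by simp
qed (auto simp: pd_const)

lemma pd_prod:
  assumes "open U" "finite I" "\<And>i. i \<in> I \<Longrightarrow> sm U (f i)" "x \<in> U" "y \<noteq> 0"
  shows "pd w (\<lambda>x y. \<Prod>i\<in>I. f i x y) x y = (\<Sum>i\<in>I. pd w (f i) x y * (\<Prod>j\<in>I - {i}. f j x y))"
  using assms(2,3)
proof (induction I rule: finite_induct)
  case (insert i I)
  have *: "(\<Sum>k\<in>I. pd w (f k) x y * (\<Prod>j\<in>insert i I - {k}. f j x y))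
      = f i x y * (\<Sum>k\<in>I. pd w (f k) x y * (\<Prod>j\<in>I - {k}. f j x y))"
    unfolding sum_distrib_left
  proof (rule sum.cong[OF refl])
    fix k assume "k \<in> I"
    then have "insert i I - {k} = insert i (I - {k})" using insert by auto
    then show "pd w (f k) x y * (\<Prod>j\<in>insert i I - {k}. f j x y)
        = f i x y * (pd w (f k) x y * (\<Prod>j\<in>I - {k}. f j x y))"
      using insert by simp
  qed
  have "insert i I - {i} = I" using insert by auto
  then show ?case
    using pd_mult[of U "f i" "\<lambda>x y. \<Prod>i\<in>I. f i x y" x y w] sm_prod[OF assms(1), of I f] assms insert *
    by simp
qed (simp add: pd_const)

lemma pd_power2:
  assumes "sm U f" "x \<in> U" "y \<noteq> 0"
  shows "pd w (\<lambda>x y. (f x y)\<^sup>2) x y = 2 * f x y * pd w f x y"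
  unfolding power2_eq_square using pd_mult[OF assms(1,1,2,3)] by simp

lemma pd_base:
  assumes "f differentiable (at x)"
  shows "pd w (\<lambda>x y. f x) x y = frechet_derivative f (at x) (fst w)"
proof (rule pd_eqI)
  have "(f has_derivative frechet_derivative f (at x)) (at (fst (x, y)))"
    using assms by (simp add: frechet_derivative_works[symmetric])
  from has_derivative_compose[OF has_derivative_fst[OF has_derivative_ident] this]
  show "((\<lambda>(x, y). f x) has_derivative (\<lambda>w. frechet_derivative f (at x) (fst w))) (at (x, y))"
    by (simp add: case_prod_beta')
qed

lemma pd_component: "pd w (\<lambda>x y. y $ i) x y = snd w $ i"
proof (rule pd_eqI)
  have "bounded_linear (\<lambda>z :: (real^'a) \<times> (real^'a). snd z $ i)"
    by (rule bounded_linear_compose[OF bounded_linear_vec_nth bounded_linear_snd])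
  then show "((\<lambda>(x, y). y $ i) has_derivative (\<lambda>w. snd w $ i)) (at (x, y))"
    using bounded_linear_imp_has_derivative by (simp add: case_prod_beta')
qed

lemma pd_linear:
  assumes "sm U f" "x \<in> U" "y \<noteq> 0"
  shows "linear (\<lambda>w. pd w f x y)"
  using sm_has_derivative[OF assms] has_derivative_linear by blast

lemma pd_expand:
  assumes "sm U f" "x \<in> U" "y \<noteq> 0"
  shows "pd (u, v) f x y = (\<Sum>k\<in>UNIV. u $ k * px k f x y) + (\<Sum>k\<in>UNIV. v $ k * py k f x y)"
proof -
  note L = pd_linear[OF assms]
  have "(u, v) = (\<Sum>k\<in>UNIV. u $ k *\<^sub>R (axis k 1, 0)) + (\<Sum>k\<in>UNIV. v $ k *\<^sub>R (0, axis k 1))"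
    by (simp add: prod_eq_iff fst_sum snd_sum basis_expansion[where 'a = real, unfolded scalar_mult_eq_scaleR])
  then have "pd (u, v) f x y = pd ((\<Sum>k\<in>UNIV. u $ k *\<^sub>R (axis k 1, 0)) + (\<Sum>k\<in>UNIV. v $ k *\<^sub>R (0, axis k 1))) f x y"
    by presburger
  then show ?thesis
    by (simp only: linear_add[OF L] linear_sum[OF L] linear_cmul[OF L] real_scaleR_def)
qed

text \<open>Chain rule for the inclusion of a fibre; fibre derivatives can thus be computed as
  ordinary derivatives in \<open>y\<close> at fixed \<open>x\<close>.\<close>

lemma pd_vertical:
  assumes "sm U f" "x \<in> U" "y \<noteq> 0" "(f x has_derivative D) (at y)"
  shows "pd (0, v) f x y = D v"
proof -
  have "((\<lambda>y. (x, y)) has_derivative (\<lambda>v. (0, v))) (at y)"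
    by (auto intro!: derivative_eq_intros)
  from has_derivative_compose[OF this sm_has_derivative[OF assms(1-3)]]
  have "(f x has_derivative (\<lambda>v. pd (0, v) f x y)) (at y)" by simp
  from fun_cong[OF has_derivative_unique[OF this assms(4)]] show ?thesis .
qed

lemma pd_poly:
  assumes "sm U f" "x \<in> U" "y \<noteq> 0"
  shows "pd w (\<lambda>x y. poly D (f x y)) x y = poly (pderiv D) (f x y) * pd w f x y"
proof (rule pd_eqI)
  have "(poly D has_derivative (*) (poly (pderiv D) (f x y))) (at (f x y))"
    using poly_DERIV[of D] by (simp add: has_field_derivative_def)
  then have "(poly D has_derivative (*) (poly (pderiv D) (f x y))) (at ((\<lambda>(x, y). f x y) (x, y)))"
    by simp
  from has_derivative_compose[OF sm_has_derivative[OF assms] this]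
  show "((\<lambda>(x, y). poly D (f x y)) has_derivative (\<lambda>w. poly (pderiv D) (f x y) * pd w f x y)) (at (x, y))"
    by (simp add: case_prod_beta')
qed

lemma sm_poly: "sm U f \<Longrightarrow> sm U (\<lambda>x y. poly D (f x y))"
  by (induction D) (auto intro!: sm_add sm_mult sm_const dest: sm_open)

text \<open>Bridge from the partial derivatives in the curvature definitions, which freeze the other
  variable, to the joint derivative \<open>pd\<close>.\<close>

lemma dx_eq:
  assumes "sm U f" "x \<in> U" "y \<noteq> 0"
  shows "dx k f x y = px k f x y"
proof -
  have "((\<lambda>x. (x, y)) has_derivative (\<lambda>u. (u, 0))) (at x)"
    by (auto intro!: derivative_eq_intros)
  from has_derivative_compose[OF this sm_has_derivative[OF assms]]
  show ?thesis
    unfolding dx_def by (simp add: frechet_derivative_at[symmetric])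
qed

lemma dy_eq:
  assumes "sm U f" "x \<in> U" "y \<noteq> 0"
  shows "dy k f x y = py k f x y"
proof -
  have "((\<lambda>y. (x, y)) has_derivative (\<lambda>u. (0, u))) (at y)"
    by (auto intro!: derivative_eq_intros)
  from has_derivative_compose[OF this sm_has_derivative[OF assms]]
  show ?thesis
    unfolding dy_def by (simp add: frechet_derivative_at[symmetric])
qed

lemma sm_dx: "sm U f \<Longrightarrow> sm U (dx k f)"
  using sm_cong[OF sm_pd, of U f "(axis k 1, 0)" "dx k f"] dx_eq by metis

lemma sm_dy: "sm U f \<Longrightarrow> sm U (dy k f)"
  using sm_cong[OF sm_pd, of U f "(0, axis k 1)" "dy k f"] dy_eq by metis

lemma pd_dx: "sm U f \<Longrightarrow> x \<in> U \<Longrightarrow> y \<noteq> 0 \<Longrightarrow> pd w (dx k f) x y = pd w (px k f) x y"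
  by (rule pd_cong[of U]) (auto intro: sm_open dx_eq)

lemma pd_dy: "sm U f \<Longrightarrow> x \<in> U \<Longrightarrow> y \<noteq> 0 \<Longrightarrow> pd w (dy k f) x y = pd w (py k f) x y"
  by (rule pd_cong[of U]) (auto intro: sm_open dy_eq)

lemma section_has_derivative:
  assumes "sm U f" "x \<in> U" "X x \<noteq> 0" "X differentiable (at x)"
  shows "((\<lambda>x. f x (X x)) has_derivative (\<lambda>u. pd (u, frechet_derivative X (at x) u) f x (X x))) (at x)"
proof -
  have "(X has_derivative frechet_derivative X (at x)) (at x)"
    using assms by (simp add: frechet_derivative_works[symmetric])
  then have "((\<lambda>x. (x, X x)) has_derivative (\<lambda>u. (u, frechet_derivative X (at x) u))) (at x)"
    by (auto intro!: derivative_eq_intros)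
  from has_derivative_compose[OF this sm_has_derivative[OF assms(1-3)]]
  show ?thesis by simp
qed

text \<open>Turns an identity that holds only for \<open>y = X x\<close> into a linear relation
  between the partial derivatives of \<open>f\<close>: the direction is tangent to the graph of
  \<open>X\<close>.\<close>

lemma section_const_derivative:
  assumes "sm U f" "x \<in> U" "X x \<noteq> 0" "X differentiable (at x)"
    and c: "\<And>x. x \<in> U \<Longrightarrow> f x (X x) = c"
  shows "pd (u, frechet_derivative X (at x) u) f x (X x) = 0"
proof -
  have "((\<lambda>x. f x (X x)) has_derivative (\<lambda>u. 0)) (at x)"
    by (rule has_derivative_transform_within_open[OF has_derivative_const[of c] sm_open[OF assms(1)] assms(2)])
      (use assms sm_open in auto)
  from has_derivative_unique[OF this section_has_derivative[OF assms(1-4)]]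
  show ?thesis by (simp add: fun_eq_iff)
qed

section \<open>Linear algebra\<close>

definition bil :: "real^'n^'n \<Rightarrow> real^'n \<Rightarrow> real^'n \<Rightarrow> real" where
  "bil A u v = u \<bullet> (A *v v)"

definition spd :: "real^'n^'n \<Rightarrow> bool" where
  "spd A \<longleftrightarrow> (\<forall>u v. bil A u v = bil A v u) \<and> (\<forall>u. u \<noteq> 0 \<longrightarrow> bil A u u > 0)"

lemma bil_simps:
  "bil A (u + u') v = bil A u v + bil A u' v" "bil A u (v + v') = bil A u v + bil A u v'"
  "bil A (u - u') v = bil A u v - bil A u' v" "bil A u (v - v') = bil A u v - bil A u v'"
  "bil A (c *\<^sub>R u) v = c * bil A u v" "bil A u (c *\<^sub>R v) = c * bil A u v"
  "bil A 0 v = 0" "bil A u 0 = 0"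
  by (simp_all add: bil_def inner_add_left inner_diff_left matrix_vector_right_distrib
      matrix_vector_mult_diff_distrib inner_add_right inner_diff_right matrix_vector_mult_scaleR)

lemma bil_sum_right: "bil A u (\<Sum>i\<in>I. f i) = (\<Sum>i\<in>I. bil A u (f i))"
  by (induction I rule: infinite_finite_induct) (auto simp: bil_simps)

lemma bil_expand: "bil A u v = (\<Sum>i\<in>UNIV. \<Sum>j\<in>UNIV. u $ i * A $ i $ j * v $ j)"
  by (simp add: bil_def inner_vec_def matrix_vector_mult_def sum_distrib_left mult.assoc)

lemma spdI:
  assumes "\<And>i j. A $ i $ j = A $ j $ i" "\<And>u. u \<noteq> 0 \<Longrightarrow> u \<bullet> (A *v u) > 0"
  shows "spd A"
proof -
  have "transpose A = A" using assms(1) by (simp add: transpose_def vec_eq_iff)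
  then have "bil A u v = bil A v u" for u v
    using dot_lmul_matrix[of u A v] transpose_matrix_vector[of A u] by (simp add: bil_def inner_commute)
  then show ?thesis using assms(2) by (simp add: spd_def bil_def)
qed

lemma spd_sym: "spd A \<Longrightarrow> bil A u v = bil A v u"
  by (simp add: spd_def)

lemma spd_pos: "spd A \<Longrightarrow> u \<noteq> 0 \<Longrightarrow> bil A u u > 0"
  by (simp add: spd_def)

lemma spd_nonneg: "spd A \<Longrightarrow> bil A u u \<ge> 0"
  using spd_pos[of A u] by (cases "u = 0") (auto simp: bil_simps)

lemma spd_det_nz:
  assumes "spd A" shows "det A \<noteq> 0"
proof -
  have "A *v x = 0 \<Longrightarrow> x = 0" for x
    using spd_pos[OF assms, of x] by (force simp: bil_def)
  then show ?thesis
    using matrix_left_invertible_ker[of A] invertible_left_inverse[of A] invertible_det_nz by blast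
qed

lemma matrix_inv_left_right:
  assumes "det A \<noteq> 0"
  shows "matrix_inv A ** A = mat 1" "A ** matrix_inv A = mat (1 :: real)"
proof -
  have "\<exists>B. A ** B = mat 1 \<and> B ** A = mat 1"
    using assms invertible_det_nz[of A] by (auto simp: invertible_def)
  from someI_ex[OF this] show "matrix_inv A ** A = mat 1" "A ** matrix_inv A = mat 1"
    by (simp_all add: matrix_inv_def)
qed

text \<open>Cramer's rule for a unit vector. Determinants are polynomial in the entries, so the
  inverse of a smooth matrix function is smooth.\<close>

lemma matrix_inv_nth:
  fixes A :: "real^'n^'n"
  assumes "det A \<noteq> 0"
  shows "matrix_inv A $ i $ m = det (\<chi> k j. if j = i then axis m 1 $ k else A $ k $ j) / det A"
proof -
  have "A *v (matrix_inv A *v axis m 1) = axis m 1"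
    using matrix_inv_left_right[OF assms] by (simp add: matrix_vector_mul_assoc)
  then have "matrix_inv A *v axis m 1 = (\<chi> k. det (\<chi> i j. if j = k then axis m 1 $ i else A $ i $ j) / det A)"
    by (simp add: cramer[OF assms])
  then have "(matrix_inv A *v axis m 1) $ i = det (\<chi> k j. if j = i then axis m 1 $ k else A $ k $ j) / det A"
    by simp
  then show ?thesis by (simp add: matrix_vector_mul_component inner_axis)
qed

lemma smooth_on_matrix_inv:
  fixes A :: "'a::real_normed_vector \<Rightarrow> real^'n^'n"
  assumes "open S" "\<And>i j. smooth_on S (\<lambda>x. A x $ i $ j)" "\<And>x. x \<in> S \<Longrightarrow> det (A x) \<noteq> 0"
  shows "smooth_on S (\<lambda>x. matrix_inv (A x) $ i $ m)"
proof (rule smooth_on_cong[OF assms(1)])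
  have "smooth_on S (\<lambda>x. (\<chi> k j. if j = i then axis m 1 $ k else A x $ k $ j) $ r $ s)" for r s
    by (cases "s = i") (auto intro: assms)
  then show "smooth_on S (\<lambda>x. det (\<chi> k j. if j = i then axis m 1 $ k else A x $ k $ j) * inverse (det (A x)))"
    by (intro smooth_on_mult smooth_on_inverse smooth_on_det assms) auto
qed (simp add: matrix_inv_nth assms(3) divide_inverse)

text \<open>Gram-Schmidt by induction on the number of missing indices: a vector outside the span,
  minus its projections, normalized. Prescribed members let a frame start with a multiple of
  \<open>X\<close> or with two vectors of a plane; \<open>J = {}\<close> gives mere
  existence.\<close>

lemma extend_orthonormal_frame:
  fixes A :: "real^'n^'n" and g :: "'n \<Rightarrow> real^'n"
  assumes A: "spd A"
    and g: "\<And>i j. i \<in> J \<Longrightarrow> j \<in> J \<Longrightarrow> bil A (g i) (g j) = (if i = j then 1 else 0)"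
  shows "\<exists>f. (\<forall>i j. bil A (f i) (f j) = (if i = j then 1 else 0)) \<and> (\<forall>j\<in>J. f j = g j)"
  using g
proof (induction "card (- J)" arbitrary: J g)
  case 0
  then have "J = UNIV" by (auto simp: card_eq_0_iff)
  then show ?case using 0 by blast
next
  case (Suc m)
  then have "- J \<noteq> {}" by (intro notI) simp
  then obtain k where k: "k \<notin> J" by blast
  have "card (g ` J) \<le> card J" by (rule card_image_le) simp
  also have "\<dots> < CARD('n)" using k by (intro psubset_card_mono) auto
  finally have "dim (span (g ` J)) < DIM(real^'n)"
    using dim_le_card'[of "g ` J"] by simp
  then have "span (g ` J) \<noteq> UNIV" by (intro notI) simp
  then obtain v where v: "v \<notin> span (g ` J)" by blast
  define w where "w = v - (\<Sum>j\<in>J. bil A (g j) v *\<^sub>R g j)"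
  have "w \<noteq> 0"
  proof
    assume "w = 0"
    then have "v = (\<Sum>j\<in>J. bil A (g j) v *\<^sub>R g j)" by (simp add: w_def)
    moreover have "(\<Sum>j\<in>J. bil A (g j) v *\<^sub>R g j) \<in> span (g ` J)"
      by (intro span_sum span_mul span_base imageI)
    ultimately have "v \<in> span (g ` J)" by simp
    then show False using v by blast
  qed
  then have ww: "bil A w w > 0" by (rule spd_pos[OF A])
  have gw: "bil A (g i) w = 0" if "i \<in> J" for i
  proof -
    have "(\<Sum>j\<in>J. bil A (g j) v * bil A (g i) (g j)) = (\<Sum>j\<in>J. if i = j then bil A (g j) v else 0)"
      using Suc.prems that by (intro sum.cong) auto
    then show ?thesis using that by (simp add: w_def bil_simps bil_sum_right)
  qed
  define g' where "g' = g(k := inverse (sqrt (bil A w w)) *\<^sub>R w)"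
  have "m = card (- insert k J)"
    using Suc.hyps(2) k by (simp add: Compl_insert)
  moreover have "bil A (g' i) (g' j) = (if i = j then 1 else 0)" if "i \<in> insert k J" "j \<in> insert k J" for i j
  proof -
    have "inverse (sqrt (bil A w w)) * (inverse (sqrt (bil A w w)) * bil A w w) = 1"
      using ww by (simp add: field_simps)
    moreover have "bil A w (g i) = 0" if "i \<in> J" for i
      using gw[OF that] spd_sym[OF A, of w "g i"] by simp
    ultimately show ?thesis
      using that k Suc.prems gw by (auto simp: g'_def bil_simps)
  qed
  ultimately obtain f where f: "\<forall>i j. bil A (f i) (f j) = (if i = j then 1 else 0)"
    "\<forall>j\<in>insert k J. f j = g' j"
    using Suc.hyps(1)[of "insert k J" g'] by blast
  then have "\<forall>j\<in>J. f j = g j" using k by (auto simp: g'_def)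
  then show ?case using f by blast
qed

lemma congruence_nth: "(transpose P ** A ** P) $ i $ j = bil A (column i P) (column j P)"
  unfolding matrix_mul_assoc[symmetric]
  by (simp add: bil_def inner_vec_def matrix_matrix_mult_def transpose_def column_def
      matrix_vector_mult_def)

lemma frame_congruence:
  fixes f :: "'n \<Rightarrow> real^'n"
  defines "P \<equiv> \<chi> i j. f j $ i"
  assumes f: "\<And>i j. bil A (f i) (f j) = (if i = j then 1 else 0)"
  shows "transpose P ** A ** P = mat 1" "\<And>j. column j P = f j" "(det P)\<^sup>2 * det A = 1"
proof -
  show c: "column j P = f j" for j by (simp add: P_def column_def vec_eq_iff)
  then have "(transpose P ** A ** P) $ i $ j = mat 1 $ i $ j" for i j
    using f by (simp add: congruence_nth mat_def)
  then show *: "transpose P ** A ** P = mat 1"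
    by (simp add: vec_eq_iff)
  have "det (transpose P ** A ** P) = (det P)\<^sup>2 * det A"
    by (simp add: det_mul power2_eq_square)
  then show "(det P)\<^sup>2 * det A = 1" by (simp add: * )
qed

text \<open>In an orthonormal frame \<open>W\<close> becomes a skew matrix \<open>N\<close>, and the
  trace of \<open>N ** N\<close> is minus the sum of the squares of its entries.\<close>

lemma trace_square_of_skew:
  fixes A W :: "real^'n^'n"
  assumes A: "spd A" and skew: "\<And>u v. bil A u (W *v v) = - bil A v (W *v u)"
  shows "trace W = 0" "trace (W ** W) \<le> 0"
proof -
  obtain f :: "'n \<Rightarrow> real^'n" where f: "\<And>i j. bil A (f i) (f j) = (if i = j then 1 else 0)"
    using extend_orthonormal_frame[OF A, of "{}" "\<lambda>_. 0"] by auto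
  define P :: "real^'n^'n" where "P = (\<chi> i j. f j $ i)"
  note P = frame_congruence[OF f, folded P_def]
  \<comment> \<open>By \<open>transpose P ** A ** P = mat 1\<close> this is the inverse of
    \<open>P\<close>.\<close>
  define Q where "Q = transpose P ** A"
  have QP: "Q ** P = mat 1" using P by (simp add: Q_def)
  then have PQ: "P ** Q = mat 1" by (simp add: matrix_left_right_inverse)
  define N where "N = Q ** W ** P"
  have Nij: "N $ i $ j = bil A (f i) (W *v f j)" for i j
  proof -
    have "N = transpose P ** (A ** W) ** P" by (simp add: N_def Q_def matrix_mul_assoc)
    then show ?thesis by (simp add: congruence_nth P bil_def matrix_vector_mul_assoc)
  qed
  have N: "N $ i $ j = - N $ j $ i" for i j unfolding Nij by (rule skew)
  have "trace N = trace W"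
    unfolding N_def by (subst trace_mul_sym) (simp add: matrix_mul_assoc PQ)
  moreover have "trace N = 0"
  proof -
    have "N $ i $ i = 0" for i using N[of i i] by simp
    then show ?thesis by (simp add: trace_def)
  qed
  ultimately show "trace W = 0" by simp
  have "N ** N = Q ** W ** (P ** Q) ** W ** P" by (simp add: N_def matrix_mul_assoc)
  then have NN: "N ** N = Q ** (W ** W) ** P" by (simp add: PQ matrix_mul_assoc)
  have "trace (N ** N) = trace (W ** W)"
    unfolding NN by (subst trace_mul_sym) (simp add: matrix_mul_assoc PQ)
  moreover have "trace (N ** N) \<le> 0"
  proof -
    have "N $ i $ k * N $ k $ i \<le> 0" for i k using N[of i k] by simp
    then show ?thesis by (auto simp: trace_def matrix_matrix_mult_def intro!: sum_nonpos)
  qed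
  ultimately show "trace (W ** W) \<le> 0" by simp
qed

text \<open>A permutation that moves an index outside \<open>{p, q}\<close> meets an off-diagonal
  zero, so only the identity and the transposition survive in the Leibniz formula.\<close>

lemma det_two_by_two_block:
  fixes N :: "real^'n^'n"
  assumes pq: "p \<noteq> q"
    and N: "\<And>i j. \<not> (i \<in> {p, q} \<and> j \<in> {p, q}) \<Longrightarrow> N $ i $ j = (if i = j then r else 0)"
  shows "det N = (N $ p $ p * N $ q $ q - N $ p $ q * N $ q $ p) * r ^ (CARD('n) - 2)"
proof -
  let ?t = "Transposition.transpose p q"
  let ?F = "\<lambda>\<pi>. of_int (sign \<pi>) * (\<Prod>i\<in>UNIV. N $ i $ \<pi> i)"
  have "det N = (\<Sum>\<pi>\<in>{\<pi>. \<pi> permutes UNIV}. ?F \<pi>)" by (simp add: det_def)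
  also have "\<dots> = (\<Sum>\<pi>\<in>{id, ?t}. ?F \<pi>)"
  proof (rule sum.mono_neutral_right)
    show "{id, ?t} \<subseteq> {\<pi>. \<pi> permutes UNIV}" by (auto simp: permutes_swap_id permutes_id)
    show "\<forall>\<pi>\<in>{\<pi>. \<pi> permutes UNIV} - {id, ?t}. ?F \<pi> = 0"
    proof
      fix \<pi> assume \<pi>: "\<pi> \<in> {\<pi>. \<pi> permutes UNIV} - {id, ?t}"
      then have "\<not> \<pi> permutes {p, q}" by (simp add: permutes_doubleton_iff)
      then obtain i where i: "i \<notin> {p, q}" "\<pi> i \<noteq> i"
        using \<pi> permutes_superset[of \<pi> UNIV "{p, q}"] by auto
      then have "N $ i $ \<pi> i = 0" using N[of i "\<pi> i"] by auto
      then have "(\<Prod>i\<in>UNIV. N $ i $ \<pi> i) = 0" by (intro prod_zero) auto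
      then show "?F \<pi> = 0" by simp
    qed
  qed auto
  also have "\<dots> = (\<Prod>i\<in>UNIV. N $ i $ i) - (\<Prod>i\<in>UNIV. N $ i $ ?t i)"
  proof -
    have "id p \<noteq> ?t p" using pq by simp
    then have "id \<noteq> ?t" by (intro notI) (erule notE, erule fun_cong)
    then show ?thesis using pq by (simp add: sign_swap_id sign_id)
  qed
  also have "(\<Prod>i\<in>UNIV. N $ i $ i) = N $ p $ p * N $ q $ q * (\<Prod>i\<in>- {p, q}. N $ i $ i)"
  proof -
    have "UNIV = insert p (insert q (- {p, q}))" by auto
    then have "(\<Prod>i\<in>UNIV. N $ i $ i) = (\<Prod>i\<in>insert p (insert q (- {p, q})). N $ i $ i)" by simp
    then show ?thesis using pq by simp
  qed
  also have "(\<Prod>i\<in>UNIV. N $ i $ ?t i) = N $ p $ q * N $ q $ p * (\<Prod>i\<in>- {p, q}. N $ i $ ?t i)"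
  proof -
    have "UNIV = insert p (insert q (- {p, q}))" by auto
    then have "(\<Prod>i\<in>UNIV. N $ i $ ?t i) = (\<Prod>i\<in>insert p (insert q (- {p, q})). N $ i $ ?t i)" by simp
    then show ?thesis using pq by simp
  qed
  also have "(\<Prod>i\<in>- {p, q}. N $ i $ ?t i) = (\<Prod>i\<in>- {p, q}. r)"
    using N by (intro prod.cong) (auto simp: transpose_apply_other)
  also have "(\<Prod>i\<in>- {p, q}. N $ i $ i) = (\<Prod>i\<in>- {p, q}. r)"
    using N by (intro prod.cong) auto
  also have "(\<Prod>i\<in>- {p, q}. r) = r ^ (CARD('n) - 2)"
    using pq by (simp add: card_Diff_subset Compl_eq_Diff_UNIV numeral_2_eq_2)
  finally show ?thesis by (simp add: algebra_simps)
qed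

text \<open>\<open>Gm\<close> has the shape of the fundamental tensor: \<open>\<phi>\<close> stands
  for phi(s), \<open>t\<close> for phi - s phi', \<open>e1\<close> points along \<open>y\<close> and
  \<open>e2\<close> is normal to it in the plane of \<open>y\<close> and \<open>X\<close>. In a
  frame extending \<open>e1\<close> and \<open>e2\<close> it is \<open>\<phi> * t\<close> times the
  identity outside a two by two block.\<close>

lemma det_rank_two_perturbation:
  fixes A :: "real^'n^'n" and e1 e2 :: "real^'n"
  assumes A: "spd A" and e: "bil A e1 e1 = 1" "bil A e2 e2 = 1" "bil A e1 e2 = 0"
    and Gm: "\<And>u v. bil Gm u v = \<phi> * (t * (bil A u v - bil A e1 u * bil A e1 v)
        + 2 * r\<^sup>2 * (bil A e2 u * bil A e2 v))
        + (\<phi> * bil A e1 u + \<kappa> * r * bil A e2 u) * (\<phi> * bil A e1 v + \<kappa> * r * bil A e2 v)"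
  shows "det Gm = det A * (\<phi> ^ 3 * (t + 2 * r\<^sup>2) * (\<phi> * t) ^ (CARD('n) - 2))"
proof -
  \<comment> \<open>Two orthogonal unit vectors do not fit into dimension 1.\<close>
  have "\<exists>p q :: 'n. p \<noteq> q"
  proof (rule ccontr)
    assume "\<not> ?thesis"
    moreover obtain i :: 'n where True by blast
    ultimately have "j = i" for j by blast
    then have U: "UNIV = {i}" by auto
    have "bil A u v = u $ i * A $ i $ i * v $ i" for u v unfolding bil_expand U by simp
    then show False using e by auto
  qed
  then obtain p q :: 'n where pq: "p \<noteq> q" by blast
  define g where "g = (\<lambda>i. if i = p then e1 else e2)"
  have "bil A e2 e1 = 0" using e spd_sym[OF A, of e1 e2] by simp
  then have "bil A (g i) (g j) = (if i = j then 1 else 0)" if "i \<in> {p, q}" "j \<in> {p, q}" for i j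
    using that pq e by (auto simp: g_def)
  then obtain f where f: "\<And>i j. bil A (f i) (f j) = (if i = j then 1 else 0)" "\<forall>j\<in>{p, q}. f j = g j"
    using extend_orthonormal_frame[OF A, of "{p, q}" g] by blast
  then have fpq: "f p = e1" "f q = e2" using pq by (auto simp: g_def)
  define P :: "real^'n^'n" where "P = (\<chi> i j. f j $ i)"
  note P = frame_congruence[OF f(1), folded P_def]
  have e1f: "bil A e1 (f i) = (if i = p then 1 else 0)" and e2f: "bil A e2 (f i) = (if i = q then 1 else 0)" for i
    using f(1)[of p i] f(1)[of q i] fpq by auto
  define N where "N = transpose P ** Gm ** P"
  have N: "N $ i $ j = bil Gm (f i) (f j)" for i j
    by (simp add: N_def congruence_nth P)
  have "det N = (N $ p $ p * N $ q $ q - N $ p $ q * N $ q $ p) * (\<phi> * t) ^ (CARD('n) - 2)"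
    by (rule det_two_by_two_block[OF pq]) (auto simp: N Gm e1f e2f f(1))
  \<comment> \<open>The block is the diagonal matrix with entries 0 and
    \<open>\<phi> * (t + 2 * r^2)\<close> plus the rank one matrix of the vector with components
    \<open>\<phi>\<close> and \<open>\<kappa> * r\<close>; the zero makes \<open>\<kappa>\<close>
    cancel.\<close>
  also have "N $ p $ p * N $ q $ q - N $ p $ q * N $ q $ p = \<phi> ^ 3 * (t + 2 * r\<^sup>2)"
    using pq by (simp add: N Gm e1f e2f f(1) power2_eq_square power3_eq_cube algebra_simps)
  finally have "det N = \<phi> ^ 3 * (t + 2 * r\<^sup>2) * (\<phi> * t) ^ (CARD('n) - 2)" .
  moreover have "det N = (det P)\<^sup>2 * det Gm"
    by (simp add: N_def det_mul power2_eq_square)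
  ultimately have "det A * ((det P)\<^sup>2 * det Gm) = det A * (\<phi> ^ 3 * (t + 2 * r\<^sup>2) * (\<phi> * t) ^ (CARD('n) - 2))"
    by simp
  moreover have "det A * ((det P)\<^sup>2 * det Gm) = ((det P)\<^sup>2 * det A) * det Gm" by simp
  ultimately show ?thesis unfolding P(3) by simp
qed

section \<open>Killing fields of constant length on a Finsler patch\<close>

lemma pd_commute_inner:
  assumes "sm U f" "x \<in> U" "y \<noteq> 0"
  shows "pd u (pd v (pd w f)) x y = pd u (pd w (pd v f)) x y"
  by (rule pd_cong[OF sm_open[OF assms(1)] assms(2,3)]) (rule pd_commute[OF assms(1)])

section \<open>Derivative of a determinant\<close>

lemma pd_det:
  fixes A :: "real^'n \<Rightarrow> real^'n \<Rightarrow> real^'n^'n"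
  assumes "open U" "\<And>i j. sm U (\<lambda>x y. A x y $ i $ j)" "x \<in> U" "y \<noteq> 0"
  shows "pd w (\<lambda>x y. det (A x y)) x y
     = (\<Sum>i\<in>UNIV. det (\<chi> k. if k = i then (\<chi> j. pd w (\<lambda>x y. A x y $ i $ j) x y) else A x y $ k))"
proof -
  have smp: "sm U (\<lambda>x y. \<Prod>i\<in>UNIV. A x y $ i $ p i)" for p
    by (intro sm_prod assms)
  have "pd w (\<lambda>x y. det (A x y)) x y
      = (\<Sum>p\<in>{p. p permutes UNIV}. of_int (sign p) *
          (\<Sum>i\<in>UNIV. pd w (\<lambda>x y. A x y $ i $ p i) x y * (\<Prod>j\<in>UNIV - {i}. A x y $ j $ p j)))"
    unfolding det_def
    by (subst pd_sum[OF assms(1) _ assms(3,4)])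
      (auto intro!: sm_mult sm_const sum.cong assms smp
        simp: pd_cmult[OF smp assms(3,4)] pd_prod[OF assms(1) finite assms(2-4)])
  also have "\<dots> = (\<Sum>i\<in>UNIV. \<Sum>p\<in>{p. p permutes UNIV}. of_int (sign p) *
          (pd w (\<lambda>x y. A x y $ i $ p i) x y * (\<Prod>j\<in>UNIV - {i}. A x y $ j $ p j)))"
    unfolding sum_distrib_left by (rule sum.swap)
  also have "\<dots> = (\<Sum>i\<in>UNIV. det (\<chi> k. if k = i then (\<chi> j. pd w (\<lambda>x y. A x y $ i $ j) x y) else A x y $ k))"
    unfolding det_def
  proof (intro sum.cong refl arg_cong2[where f = "(*)"])
    fix i :: 'n and p :: "'n \<Rightarrow> 'n"
    have "(\<Prod>k\<in>UNIV. (\<chi> k. if k = i then (\<chi> j. pd w (\<lambda>x y. A x y $ i $ j) x y) else A x y $ k) $ k $ p k)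
        = pd w (\<lambda>x y. A x y $ i $ p i) x y *
          (\<Prod>k\<in>UNIV - {i}. (\<chi> k. if k = i then (\<chi> j. pd w (\<lambda>x y. A x y $ i $ j) x y) else A x y $ k) $ k $ p k)"
      by (subst prod.remove[of UNIV i]) auto
    also have "(\<Prod>k\<in>UNIV - {i}. (\<chi> k. if k = i then (\<chi> j. pd w (\<lambda>x y. A x y $ i $ j) x y) else A x y $ k) $ k $ p k)
        = (\<Prod>j\<in>UNIV - {i}. A x y $ j $ p j)"
      by (intro prod.cong) auto
    finally show "pd w (\<lambda>x y. A x y $ i $ p i) x y * (\<Prod>j\<in>UNIV - {i}. A x y $ j $ p j)
      = (\<Prod>k\<in>UNIV. (\<chi> k. if k = i then (\<chi> j. pd w (\<lambda>x y. A x y $ i $ j) x y) else A x y $ k) $ k $ p k)"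
      by simp
  qed
  finally show ?thesis .
qed

text \<open>With the derivative written as \<open>B ** A\<close>, the differentiated row
  \<open>i\<close> is a combination of the rows of \<open>A\<close>, and only its share
  \<open>B $ i $ i\<close> of row \<open>i\<close> contributes to the determinant.\<close>

lemma jacobi_formula:
  fixes A :: "real^'n \<Rightarrow> real^'n \<Rightarrow> real^'n^'n"
  assumes "open U" "\<And>i j. sm U (\<lambda>x y. A x y $ i $ j)" "x \<in> U" "y \<noteq> 0"
    and B: "\<And>i j. pd w (\<lambda>x y. A x y $ i $ j) x y = (\<Sum>m\<in>UNIV. B $ i $ m * A x y $ m $ j)"
  shows "pd w (\<lambda>x y. det (A x y)) x y = trace B * det (A x y)"
proof -
  have "(\<chi> k. if k = i then (\<chi> j. pd w (\<lambda>x y. A x y $ i $ j) x y) else A x y $ k)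
      = (\<chi> k. if k = i then sum (\<lambda>m. B $ i $ m *s row m (A x y)) UNIV else row k (A x y))" for i
    by (simp add: vec_eq_iff B row_def)
  then have "det (\<chi> k. if k = i then (\<chi> j. pd w (\<lambda>x y. A x y $ i $ j) x y) else A x y $ k)
      = B $ i $ i * det (A x y)" for i
    by (simp only: cramer_lemma_transpose)
  then show ?thesis
    by (simp add: pd_det[OF assms(1-4)] trace_def sum_distrib_right)
qed

text \<open>A Finsler metric seen in one chart. All curvature computations take place here; manifold
  and group reappear when a patch is produced from a chart.\<close>

locale finsler_patch =
  fixes U :: "(real^'n::finite) set" and L :: "real^'n \<Rightarrow> real^'n \<Rightarrow> real"
  assumes smL: "sm U L"
    and homogeneous: "\<And>x y t. x \<in> U \<Longrightarrow> y \<noteq> 0 \<Longrightarrow> t > 0 \<Longrightarrow> L x (t *\<^sub>R y) = t * L x y"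
    and convex: "\<And>x y u. x \<in> U \<Longrightarrow> y \<noteq> 0 \<Longrightarrow> u \<noteq> 0 \<Longrightarrow> u \<bullet> (fundamental_tensor L x y *v u) > 0"
begin

abbreviation "K \<equiv> sq L"
abbreviation "G \<equiv> spray L"

section \<open>Spray, energy and determinant in one chart\<close>

lemma openU: "open U"
  using smL by (rule sm_open)

lemma smK: "sm U K"
  by (rule sm_cong[OF sm_mult[OF smL smL]]) (simp add: sq_def power2_eq_square)

lemma fundamental_tensor_nth:
  "x \<in> U \<Longrightarrow> y \<noteq> 0 \<Longrightarrow> fundamental_tensor L x y $ i $ j = py j (py i K) x y / 2"
  using dy_eq[OF sm_dy[OF smK]] pd_dy[OF smK] by (simp add: fundamental_tensor_def)

lemma K_commute: "x \<in> U \<Longrightarrow> y \<noteq> 0 \<Longrightarrow> pd v (pd w K) x y = pd w (pd v K) x y"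
  by (rule pd_commute[OF smK])

lemma spd_fundamental_tensor: "x \<in> U \<Longrightarrow> y \<noteq> 0 \<Longrightarrow> spd (fundamental_tensor L x y)"
  using convex by (intro spdI) (auto simp: fundamental_tensor_nth K_commute)

lemma sm_fundamental_tensor: "sm U (\<lambda>x y. fundamental_tensor L x y $ i $ j)"
  by (rule sm_cong[OF sm_divide[OF sm_pd[OF sm_pd[OF smK]] sm_const[OF openU]],
        of 2 "(0, axis j 1)" "(0, axis i 1)"]) (auto simp: fundamental_tensor_nth)

lemma sm_inverse_tensor: "sm U (\<lambda>x y. matrix_inv (fundamental_tensor L x y) $ i $ m)"
proof -
  have "smooth_on (U \<times> - {0}) (\<lambda>z. matrix_inv (fundamental_tensor L (fst z) (snd z)) $ i $ m)"
  proof (rule smooth_on_matrix_inv[OF open_slit[OF openU]])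
    show "smooth_on (U \<times> - {0}) (\<lambda>z. fundamental_tensor L (fst z) (snd z) $ i $ j)" for i j
      using sm_fundamental_tensor by (simp add: sm_def case_prod_beta')
    show "det (fundamental_tensor L (fst z) (snd z)) \<noteq> 0" if "z \<in> U \<times> - {0}" for z
      using that by (intro spd_det_nz spd_fundamental_tensor) auto
  qed
  then show ?thesis by (simp add: sm_def openU case_prod_beta')
qed

lemma smG: "sm U (G i)"
proof -
  have "sm U (\<lambda>x y. (\<Sum>m\<in>UNIV. matrix_inv (fundamental_tensor L x y) $ i $ m *
        ((\<Sum>k\<in>UNIV. dy m (dx k K) x y * y $ k) - dx m K x y)) / 4)"
    by (intro sm_divide sm_sum sm_mult sm_diff sm_const sm_inverse_tensor sm_dx sm_dy smK sm_component openU) auto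
  then show ?thesis by (rule sm_cong) (simp add: spray_def)
qed

text \<open>Multiplying the definition of the spray by \<open>g\<close> clears the inverse matrix
  and prepares for differentiation. It is the Euler-Lagrange equation: the derivative of
  \<open>py m K\<close> along the spray is \<open>px m K\<close>.\<close>

lemma spray_equation:
  assumes "x \<in> U" "y \<noteq> 0"
  shows "2 * (\<Sum>i\<in>UNIV. py i (py m K) x y * G i x y) = (\<Sum>k\<in>UNIV. y $ k * py m (px k K) x y) - px m K x y"
proof -
  define R where "R = (\<chi> m. (\<Sum>k\<in>UNIV. y $ k * py m (px k K) x y) - px m K x y)"
  let ?g = "fundamental_tensor L x y"
  have "G i x y = (matrix_inv ?g *v R) $ i / 4" for i
    using assms by (simp add: spray_def R_def matrix_vector_mult_def dx_eq[OF smK] dy_eq[OF sm_dx[OF smK]]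
        pd_dx[OF smK] mult.commute)
  then have "(\<chi> i. G i x y) = (1/4) *\<^sub>R (matrix_inv ?g *v R)"
    by (simp add: vec_eq_iff)
  then have "?g *v (\<chi> i. G i x y) = (1/4) *\<^sub>R ((?g ** matrix_inv ?g) *v R)"
    by (simp add: matrix_vector_mult_scaleR matrix_vector_mul_assoc)
  also have "?g ** matrix_inv ?g = mat 1"
    using assms by (intro matrix_inv_left_right spd_det_nz spd_fundamental_tensor)
  finally have "(?g *v (\<chi> i. G i x y)) $ m = R $ m / 4"
    by simp
  then show ?thesis
    using assms by (simp add: matrix_vector_mult_def R_def fundamental_tensor_nth sum_divide_distrib[symmetric])
qed

text \<open>\<open>K\<close> is homogeneous of degree 2 in \<open>y\<close>; differentiate
  \<open>K x (t *\<^sub>R y)\<close> at \<open>t = 1\<close> in two ways.\<close>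

lemma euler:
  assumes "x \<in> U" "y \<noteq> 0"
  shows "(\<Sum>m\<in>UNIV. y $ m * py m K x y) = 2 * K x y"
proof -
  have "((\<lambda>t :: real. (x, t *\<^sub>R y)) has_derivative (\<lambda>t. (0, t *\<^sub>R y))) (at 1)"
    by (auto intro!: derivative_eq_intros)
  moreover have "((\<lambda>(x, y). K x y) has_derivative (\<lambda>w. pd w K x y)) (at (x, 1 *\<^sub>R y))"
    using sm_has_derivative[OF smK assms] by simp
  ultimately have "((\<lambda>t :: real. (\<lambda>(x, y). K x y) (x, t *\<^sub>R y)) has_derivative (\<lambda>t. pd (0, t *\<^sub>R y) K x y)) (at 1)"
    by (rule has_derivative_compose)
  then have 1: "((\<lambda>t :: real. K x (t *\<^sub>R y)) has_derivative (\<lambda>t. pd (0, t *\<^sub>R y) K x y)) (at 1)"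
    by simp
  have "((\<lambda>t :: real. t\<^sup>2 * K x y) has_derivative (\<lambda>t. 2 * t * K x y)) (at 1)"
    by (auto intro!: derivative_eq_intros)
  then have "((\<lambda>t :: real. K x (t *\<^sub>R y)) has_derivative (\<lambda>t. 2 * t * K x y)) (at 1)"
    by (rule has_derivative_transform_within_open[of _ _ 1 UNIV "{0<..}"])
      (auto simp: sq_def homogeneous[OF assms] power_mult_distrib)
  from fun_cong[OF has_derivative_unique[OF 1 this], of 1] have "pd (0, y) K x y = 2 * K x y"
    by simp
  then show ?thesis
    using pd_expand[OF smK assms, of 0 y] by simp
qed

text \<open>Euler's relation differentiated: a horizontal derivative of \<open>K\<close> again has
  degree 2 in \<open>y\<close>, a vertical one has degree 1.\<close>

lemma euler_pd:
  assumes "x \<in> U" "y \<noteq> 0"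
  shows "(\<Sum>m\<in>UNIV. y $ m * py m (pd w K) x y) = 2 * pd w K x y - pd (0, snd w) K x y"
proof -
  have "pd w (\<lambda>x y. \<Sum>m\<in>UNIV. y $ m * py m K x y) x y = pd w (\<lambda>x y. 2 * K x y) x y"
    by (rule pd_cong[OF openU assms]) (rule euler)
  also have "pd w (\<lambda>x y. \<Sum>m\<in>UNIV. y $ m * py m K x y) x y
      = (\<Sum>m\<in>UNIV. y $ m * pd w (py m K) x y + snd w $ m * py m K x y)"
    using assms by (simp add: pd_sum[OF openU] pd_mult[OF sm_component[OF openU] sm_pd[OF smK]]
        sm_mult[OF sm_component[OF openU] sm_pd[OF smK]] pd_component)
  finally show ?thesis
    using assms pd_expand[OF smK assms, of 0 "snd w"]
    by (simp add: sum.distrib pd_cmult[OF smK] K_commute[of x y w])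
qed

text \<open>The spray \<open>y\<^sup>i \<partial>/\<partial>x\<^sup>i - 2 G\<^sup>i \<partial>/\<partial>y\<^sup>i\<close>; differentiation along it is differentiation along geodesics.\<close>

definition geo :: "real^'n \<Rightarrow> real^'n \<Rightarrow> (real^'n) \<times> (real^'n)" where
  "geo x y = (y, \<chi> i. - 2 * G i x y)"

lemma pd_geo:
  assumes "sm U f" "x \<in> U" "y \<noteq> 0"
  shows "pd (geo x y) f x y = (\<Sum>k\<in>UNIV. y $ k * px k f x y) - 2 * (\<Sum>k\<in>UNIV. G k x y * py k f x y)"
  unfolding geo_def by (subst pd_expand[OF assms]) (simp add: sum_distrib_left sum_negf mult.assoc)

text \<open>Contract the spray equation with \<open>y\<close>; Euler's relations turn both sides
  into first derivatives of \<open>K\<close>.\<close>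

lemma energy_conserved:
  assumes "x \<in> U" "y \<noteq> 0"
  shows "pd (geo x y) K x y = 0"
proof -
  have "(\<Sum>m\<in>UNIV. y $ m * (2 * (\<Sum>i\<in>UNIV. py i (py m K) x y * G i x y)))
      = (\<Sum>m\<in>UNIV. \<Sum>i\<in>UNIV. 2 * (G i x y * (y $ m * py m (py i K) x y)))"
    using assms by (simp add: sum_distrib_left K_commute mult_ac)
  also have "\<dots> = (\<Sum>i\<in>UNIV. 2 * (G i x y * (\<Sum>m\<in>UNIV. y $ m * py m (py i K) x y)))"
    by (subst sum.swap) (simp add: sum_distrib_left)
  also have "\<dots> = 2 * (\<Sum>i\<in>UNIV. G i x y * py i K x y)"
    using assms by (simp add: euler_pd sum_distrib_left)
  finally have 1: "(\<Sum>m\<in>UNIV. y $ m * (2 * (\<Sum>i\<in>UNIV. py i (py m K) x y * G i x y)))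
      = 2 * (\<Sum>i\<in>UNIV. G i x y * py i K x y)" .
  have "(\<Sum>m\<in>UNIV. y $ m * ((\<Sum>k\<in>UNIV. y $ k * py m (px k K) x y) - px m K x y))
      = (\<Sum>m\<in>UNIV. \<Sum>k\<in>UNIV. y $ k * (y $ m * py m (px k K) x y)) - (\<Sum>m\<in>UNIV. y $ m * px m K x y)"
    by (simp add: right_diff_distrib sum_subtractf sum_distrib_left mult_ac)
  also have "(\<Sum>m\<in>UNIV. \<Sum>k\<in>UNIV. y $ k * (y $ m * py m (px k K) x y))
      = (\<Sum>k\<in>UNIV. y $ k * (\<Sum>m\<in>UNIV. y $ m * py m (px k K) x y))"
    by (subst sum.swap) (simp add: sum_distrib_left)
  also have "\<dots> = 2 * (\<Sum>k\<in>UNIV. y $ k * px k K x y)"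
  proof -
    have "pd (0, 0) K x y = 0" using linear_0[OF pd_linear[OF smK assms]] by (simp add: zero_prod_def)
    then show ?thesis using assms by (simp add: euler_pd sum_distrib_left mult_ac)
  qed
  finally have "2 * (\<Sum>i\<in>UNIV. G i x y * py i K x y) = (\<Sum>k\<in>UNIV. y $ k * px k K x y)"
    using 1 by (simp add: spray_equation[OF assms])
  then show ?thesis by (simp add: pd_geo[OF smK assms])
qed

text \<open>The \<open>y\<close>-derivative of the spray equation. Its third derivatives of
  \<open>K\<close> assemble to the spray derivative of the Hessian; the rest is skew in
  \<open>l\<close> and \<open>m\<close> and so disappears from traces and symmetrizations.\<close>

lemma spray_derivative:
  assumes "x \<in> U" "y \<noteq> 0"
  shows "2 * (\<Sum>i\<in>UNIV. py i (py m K) x y * py l (G i) x y)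
    = pd (geo x y) (py l (py m K)) x y + px l (py m K) x y - px m (py l K) x y"
proof -
  have "py l (\<lambda>x y. 2 * (\<Sum>i\<in>UNIV. py i (py m K) x y * G i x y)) x y
      = py l (\<lambda>x y. (\<Sum>k\<in>UNIV. y $ k * py m (px k K) x y) - px m K x y) x y"
    by (rule pd_cong[OF openU assms]) (rule spray_equation)
  also have "py l (\<lambda>x y. 2 * (\<Sum>i\<in>UNIV. py i (py m K) x y * G i x y)) x y
     = 2 * (\<Sum>i\<in>UNIV. py i (py m K) x y * py l (G i) x y + py l (py i (py m K)) x y * G i x y)"
  proof -
    have s: "sm U (\<lambda>x y. py i (py m K) x y * G i x y)" for i
      by (intro sm_mult sm_pd smK smG)
    show ?thesis
      using assms by (simp add: pd_cmult[OF sm_sum[OF openU s]] pd_sum[OF openU s]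
          pd_mult[OF sm_pd[OF sm_pd[OF smK]] smG])
  qed
  also have "py l (\<lambda>x y. (\<Sum>k\<in>UNIV. y $ k * py m (px k K) x y) - px m K x y) x y
     = (\<Sum>k\<in>UNIV. y $ k * py l (py m (px k K)) x y + axis l 1 $ k * py m (px k K) x y) - py l (px m K) x y"
  proof -
    have s: "sm U (\<lambda>x y. y $ k * py m (px k K) x y)" for k
      by (intro sm_mult sm_pd smK sm_component openU)
    show ?thesis
      using assms by (simp add: pd_diff[OF sm_sum[OF openU s] sm_pd[OF smK]] pd_sum[OF openU s]
          pd_mult[OF sm_component[OF openU] sm_pd[OF sm_pd[OF smK]]] pd_component)
  qed
  also have "(\<Sum>k\<in>UNIV. y $ k * py l (py m (px k K)) x y + axis l 1 $ k * py m (px k K) x y)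
     = (\<Sum>k\<in>UNIV. y $ k * px k (py l (py m K)) x y) + px l (py m K) x y"
  proof -
    have "py l (py m (px k K)) x y = px k (py l (py m K)) x y" for k
      using pd_commute_inner[OF smK assms] pd_commute[OF sm_pd[OF smK] assms] by metis
    moreover have "(\<Sum>k\<in>UNIV. axis l 1 $ k * py m (px k K) x y) = py m (px l K) x y"
      by (simp add: axis_def if_distrib[of "\<lambda>z. z * _"] cong: if_cong)
    ultimately show ?thesis
      using assms by (simp add: sum.distrib K_commute[of x y "(axis l 1, 0)"])
  qed
  moreover have "py l (py i (py m K)) x y = py i (py l (py m K)) x y" for i
    by (rule pd_commute[OF sm_pd[OF smK] assms])
  ultimately show ?thesis
    using assms by (simp add: pd_geo[OF sm_pd[OF sm_pd[OF smK]]] sum.distrib mult.commute[of "G _ x y"]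
        K_commute[of x y "(0, axis l 1)" "(axis m 1, 0)"])
qed

text \<open>The spray derivative of \<open>g\<close> is \<open>2 g N\<close> plus a skew matrix,
  with \<open>N\<close> the \<open>y\<close>-derivative of the spray coefficients. A skew matrix
  times the symmetric inverse of \<open>g\<close> has trace zero, and Jacobi's formula leaves twice
  the trace of \<open>N\<close>.\<close>

lemma det_geodesic_derivative:
  assumes "x \<in> U" "y \<noteq> 0"
  shows "pd (geo x y) (\<lambda>x y. det (fundamental_tensor L x y)) x y
    = 2 * (\<Sum>i\<in>UNIV. py i (G i) x y) * det (fundamental_tensor L x y)"
proof -
  let ?g = "fundamental_tensor L x y"
  let ?h = "matrix_inv ?g"
  define D where "D = (\<chi> i j. pd (geo x y) (\<lambda>x y. fundamental_tensor L x y $ i $ j) x y)"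
  define N where "N = (\<chi> i j. py j (G i) x y)"
  define S where "S = (\<chi> m l. (px m (py l K) x y - px l (py m K) x y) / 2)"
  have h: "?h ** ?g = mat 1" "?g ** ?h = mat 1"
    using assms by (auto intro!: matrix_inv_left_right spd_det_nz spd_fundamental_tensor)
  have D: "D $ m $ l = pd (geo x y) (py l (py m K)) x y / 2" for m l
  proof -
    have "D $ m $ l = pd (geo x y) (\<lambda>x y. (1/2) * py l (py m K) x y) x y"
      unfolding D_def by simp (rule pd_cong[OF openU assms], simp add: fundamental_tensor_nth)
    also have "\<dots> = (1/2) * pd (geo x y) (py l (py m K)) x y"
      by (rule pd_cmult[OF sm_pd[OF sm_pd[OF smK]] assms])
    finally show ?thesis by simp
  qed
  have "D $ m $ l = (2 *\<^sub>R (?g ** N) + S) $ m $ l" for m l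
    using spray_derivative[OF assms, of m l] assms
    by (simp add: D matrix_matrix_mult_def fundamental_tensor_nth N_def S_def sum_divide_distrib[symmetric])
      (simp add: field_simps)
  then have DN: "D = 2 *\<^sub>R (?g ** N) + S" by (simp add: vec_eq_iff)
  have tg: "transpose ?g = ?g"
    using assms by (simp add: vec_eq_iff transpose_def fundamental_tensor_nth K_commute)
  have th: "transpose ?h = ?h"
  proof -
    have "transpose ?h ** ?g = mat 1"
      using h(2) tg by (metis matrix_transpose_mul transpose_mat)
    then show ?thesis
      by (metis h(2) matrix_mul_assoc matrix_mul_lid matrix_mul_rid)
  qed
  have ts: "transpose S = - S"
    by (simp add: vec_eq_iff transpose_def S_def field_simps)
  have "trace (S ** ?h) = 0"
  proof -
    have "trace (S ** ?h) = trace (transpose (S ** ?h))" by (simp add: trace_def transpose_def)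
    also have "\<dots> = trace (?h ** (- S))" by (simp add: matrix_transpose_mul th ts)
    also have "\<dots> = trace ((- S) ** ?h)" by (rule trace_mul_sym)
    also have "\<dots> = - trace (S ** ?h)" by (simp add: trace_def matrix_matrix_mult_def sum_negf)
    finally show ?thesis by simp
  qed
  moreover have "trace (2 *\<^sub>R (?g ** N) ** ?h) = 2 * trace N"
  proof -
    have "trace (2 *\<^sub>R (?g ** N) ** ?h) = 2 * trace (?g ** N ** ?h)"
      by (simp add: trace_def matrix_matrix_mult_def sum_distrib_left sum_distrib_right mult.assoc)
    also have "trace (?g ** N ** ?h) = trace (?h ** (?g ** N))" by (rule trace_mul_sym)
    also have "\<dots> = trace N" by (simp add: matrix_mul_assoc h)
    finally show ?thesis .
  qed
  ultimately have tr: "trace (D ** ?h) = 2 * trace N"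
    unfolding DN by (simp add: trace_def matrix_matrix_mult_def distrib_right sum.distrib)
  have "D ** ?h ** ?g = D" by (simp add: matrix_mul_assoc[symmetric] h)
  moreover have "(C ** ?g) $ i $ j = (\<Sum>m\<in>UNIV. C $ i $ m * ?g $ m $ j)" for C i j
    by (simp add: matrix_matrix_mult_def)
  ultimately have DB: "D $ i $ j = (\<Sum>m\<in>UNIV. (D ** ?h) $ i $ m * ?g $ m $ j)" for i j by metis
  have "pd (geo x y) (\<lambda>x y. fundamental_tensor L x y $ i $ j) x y = D $ i $ j" for i j
    by (simp add: D_def)
  then have "pd (geo x y) (\<lambda>x y. fundamental_tensor L x y $ i $ j) x y
      = (\<Sum>m\<in>UNIV. (D ** ?h) $ i $ m * ?g $ m $ j)" for i j
    unfolding DB .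
  from jacobi_formula[OF openU sm_fundamental_tensor assms this]
  show ?thesis unfolding tr by (simp add: trace_def N_def)
qed

text \<open>\<open>killing\<close> is the infinitesimal invariance of \<open>K\<close> under the
  flow of \<open>X\<close>: the lift of \<open>X\<close> to the tangent bundle annihilates
  \<open>K\<close>. The geodesic identity and \<open>tr W = 0\<close> are proved at every point of
  \<open>U\<close> because both are differentiated in \<open>x\<close> afterwards.\<close>

lemma killing_geodesic_ricci:
  fixes X :: "real^'n \<Rightarrow> real^'n"
  assumes smX: "\<And>i. smooth_on U (\<lambda>x. X x $ i)"
    and X0: "\<And>x. x \<in> U \<Longrightarrow> X x \<noteq> 0"
    and len: "\<And>x. x \<in> U \<Longrightarrow> K x (X x) = C"
    and killing: "\<And>x y. x \<in> U \<Longrightarrow> y \<noteq> 0 \<Longrightarrow>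
      (\<Sum>k\<in>UNIV. X x $ k * px k K x y)
      + (\<Sum>k\<in>UNIV. \<Sum>j\<in>UNIV. y $ j * frechet_derivative (\<lambda>x. X x $ k) (at x) (axis j 1) * py k K x y) = 0"
    and x0: "x0 \<in> U"
  shows "ricci_curvature L x0 (X x0) \<ge> 0"
proof -
  \<comment> \<open>The Jacobian of \<open>X\<close>, given a second argument so that the calculus
    of \<open>sm\<close> and \<open>pd\<close> applies.\<close>
  define dX where "dX = (\<lambda>k j x (y :: real^'n). frechet_derivative (\<lambda>x. X x $ k) (at x) (axis j 1))"
  have sX: "sm U (\<lambda>x y. X x $ k)" for k
    by (rule sm_base[OF openU smX])
  have sdX: "sm U (dX k j)" for k j
    unfolding dX_def by (intro sm_base openU smooth_on_frechet_derivative smX)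
  have pX: "pd w (\<lambda>x y. X x $ k) x y = frechet_derivative (\<lambda>x. X x $ k) (at x) (fst w)"
    if "x \<in> U" for w k x y
    by (rule pd_base[OF smooth_on_differentiable[OF smX that]])
  have pyX: "pd (0, v) (\<lambda>x y. X x $ k) x y = 0" if "x \<in> U" for v k x y
    using linear_0[OF linear_frechet_derivative[OF smooth_on_differentiable[OF smX that]]]
    by (simp add: pX[OF that])
  have pydX: "pd (0, v) (dX k j) x y = 0" if "x \<in> U" for v k j x y
  proof -
    have d: "(\<lambda>x. frechet_derivative (\<lambda>x. X x $ k) (at x) (axis j 1)) differentiable at x"
      by (rule smooth_on_differentiable[OF smooth_on_frechet_derivative[OF smX] that])
    show ?thesis
      unfolding dX_def using linear_0[OF linear_frechet_derivative[OF d]] by (simp add: pd_base[OF d])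
  qed
  have dX_commute: "px i (dX k j) x y = px j (dX k i) x y" if "x \<in> U" for i j k x y
  proof -
    have d: "(\<lambda>x. frechet_derivative (\<lambda>x. X x $ k) (at x) (axis j 1)) differentiable at x" for j
      by (rule smooth_on_differentiable[OF smooth_on_frechet_derivative[OF smX] that])
    show ?thesis
      unfolding dX_def pd_base[OF d]
      using smooth_on_second_derivative_commute[OF openU that smX] by simp
  qed
  have Xd: "X differentiable (at x)" if "x \<in> U" for x
    using smooth_on_differentiable[OF smX that] by (subst differentiable_componentwise_within) (auto simp: Basis_vec_def inner_axis)
  have DX: "frechet_derivative X (at x) u = (\<chi> k. \<Sum>j\<in>UNIV. u $ j * dX k j x y)" if "x \<in> U" for x u y
  proof -
    have X': "(X has_derivative frechet_derivative X (at x)) (at x)"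
      using Xd[OF that] by (simp add: frechet_derivative_works[symmetric])
    have "frechet_derivative X (at x) u $ k = (\<Sum>j\<in>UNIV. u $ j * dX k j x y)" for k
    proof -
      have "((\<lambda>x. X x $ k) has_derivative (\<lambda>u. frechet_derivative X (at x) u $ k)) (at x)"
        by (rule bounded_linear.has_derivative[OF bounded_linear_vec_nth X'])
      then have "frechet_derivative X (at x) u $ k = frechet_derivative (\<lambda>x. X x $ k) (at x) u"
        by (simp add: frechet_derivative_at[symmetric])
      \<comment> \<open>Any nonzero fibre vector does: \<open>pd_expand\<close> lives on the slit
        bundle, and the function is constant in \<open>y\<close>.\<close>
      also have "\<dots> = pd (u, 0) (\<lambda>x y. X x $ k) x (axis undefined 1)"
        by (simp add: pX[OF that])
      also have "\<dots> = (\<Sum>j\<in>UNIV. u $ j * dX k j x y)"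
        by (subst pd_expand[OF sX that]) (simp_all add: pX[OF that] dX_def)
      finally show ?thesis .
    qed
    then show ?thesis by (simp add: vec_eq_iff)
  qed
  have sec: "(\<Sum>k\<in>UNIV. u $ k * px k f x (X x))
      + (\<Sum>k\<in>UNIV. (\<Sum>j\<in>UNIV. u $ j * dX k j x (X x)) * py k f x (X x)) = 0"
    if "sm U f" "x \<in> U" "\<forall>x\<in>U. f x (X x) = c" for f c x u
  proof -
    have "pd (u, frechet_derivative X (at x) u) f x (X x) = 0"
      by (rule section_const_derivative[OF that(1,2) X0[OF that(2)] Xd[OF that(2)]]) (use that(3) in blast)
    then show ?thesis
      unfolding DX[OF that(2), of _ "X x"]
      by (subst (asm) pd_expand[OF that(1,2) X0[OF that(2)]]) simp
  qed
  have axs: "(\<Sum>j\<in>UNIV. axis i 1 $ j * f j) = f i" for i and f :: "'n \<Rightarrow> real"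
    by (simp add: axis_def if_distrib[of "\<lambda>z. z * _"] cong: if_cong)
  \<comment> \<open>The Killing equation differentiated once in \<open>y\<close>. Differentiating
    again gives \<open>kill2\<close>: the Lie derivative of the fundamental tensor vanishes.\<close>
  have kill1: "(\<Sum>k\<in>UNIV. X x $ k * py m (px k K) x y) + (\<Sum>k\<in>UNIV. dX k m x y * py k K x y)
      + (\<Sum>k\<in>UNIV. \<Sum>j\<in>UNIV. y $ j * dX k j x y * py m (py k K) x y) = 0"
    if xy: "x \<in> U" "y \<noteq> 0" for x y m
  proof -
    have s1: "sm U (\<lambda>x y. X x $ k * px k K x y)" for k
      by (intro sm_mult sX sm_pd smK)
    have s2: "sm U (\<lambda>x y. y $ j * dX k j x y)" for k j
      by (intro sm_mult sdX sm_component openU)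
    have s3: "sm U (\<lambda>x y. y $ j * dX k j x y * py k K x y)" for k j
      by (intro sm_mult s2 sm_pd smK)
    have "py m (\<lambda>x y. (\<Sum>k\<in>UNIV. X x $ k * px k K x y)
        + (\<Sum>k\<in>UNIV. \<Sum>j\<in>UNIV. y $ j * dX k j x y * py k K x y)) x y = py m (\<lambda>x y. 0) x y"
      unfolding dX_def by (rule pd_cong[OF openU xy]) (rule killing)
    also have "\<dots> = 0" by (rule pd_const)
    finally have "(\<Sum>k\<in>UNIV. X x $ k * py m (px k K) x y)
      + (\<Sum>k\<in>UNIV. \<Sum>j\<in>UNIV. y $ j * dX k j x y * py m (py k K) x y + axis m 1 $ j * dX k j x y * py k K x y) = 0"
      using xy by (simp add: pd_add[OF sm_sum[OF openU s1] sm_sum[OF openU sm_sum[OF openU s3]]]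
        pd_sum[OF openU s1] pd_sum[OF openU sm_sum[OF openU s3]] pd_sum[OF openU s3]
        pd_mult[OF sX sm_pd[OF smK]] pd_mult[OF s2 sm_pd[OF smK]] pd_mult[OF sm_component[OF openU] sdX]
        pyX pydX pd_component)
    then show ?thesis by (simp add: sum.distrib axs mult.assoc)
  qed
  have kill2: "(\<Sum>k\<in>UNIV. X x $ k * px k (py l (py m K)) x y) + (\<Sum>k\<in>UNIV. dX k m x y * py l (py k K) x y)
      + (\<Sum>k\<in>UNIV. dX k l x y * py m (py k K) x y)
      + (\<Sum>k\<in>UNIV. \<Sum>j\<in>UNIV. y $ j * dX k j x y * py k (py l (py m K)) x y) = 0"
    if xy: "x \<in> U" "y \<noteq> 0" for x y m l
  proof -
    have s1: "sm U (\<lambda>x y. X x $ k * py m (px k K) x y)" for k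
      by (intro sm_mult sX sm_pd smK)
    have s1': "sm U (\<lambda>x y. dX k m x y * py k K x y)" for k
      by (intro sm_mult sdX sm_pd smK)
    have s2: "sm U (\<lambda>x y. y $ j * dX k j x y)" for k j
      by (intro sm_mult sdX sm_component openU)
    have s3: "sm U (\<lambda>x y. y $ j * dX k j x y * py m (py k K) x y)" for k j
      by (intro sm_mult s2 sm_pd smK)
    have "py l (\<lambda>x y. (\<Sum>k\<in>UNIV. X x $ k * py m (px k K) x y) + (\<Sum>k\<in>UNIV. dX k m x y * py k K x y)
        + (\<Sum>k\<in>UNIV. \<Sum>j\<in>UNIV. y $ j * dX k j x y * py m (py k K) x y)) x y = py l (\<lambda>x y. 0) x y"
      by (rule pd_cong[OF openU xy]) (rule kill1)
    also have "\<dots> = 0" by (rule pd_const)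
    finally have "(\<Sum>k\<in>UNIV. X x $ k * py l (py m (px k K)) x y) + (\<Sum>k\<in>UNIV. dX k m x y * py l (py k K) x y)
      + (\<Sum>k\<in>UNIV. \<Sum>j\<in>UNIV. y $ j * dX k j x y * py l (py m (py k K)) x y
          + axis l 1 $ j * dX k j x y * py m (py k K) x y) = 0"
      using xy by (simp add: pd_add[OF sm_add[OF sm_sum[OF openU s1] sm_sum[OF openU s1']] sm_sum[OF openU sm_sum[OF openU s3]]]
        pd_add[OF sm_sum[OF openU s1] sm_sum[OF openU s1']]
        pd_sum[OF openU s1] pd_sum[OF openU s1'] pd_sum[OF openU sm_sum[OF openU s3]] pd_sum[OF openU s3]
        pd_mult[OF sX sm_pd[OF sm_pd[OF smK]]] pd_mult[OF sdX sm_pd[OF smK]]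
        pd_mult[OF s2 sm_pd[OF sm_pd[OF smK]]] pd_mult[OF sm_component[OF openU] sdX]
        pyX pydX pd_component)
    moreover have "py l (py m (px k K)) x y = px k (py l (py m K)) x y"
      "py l (py m (py k K)) x y = py k (py l (py m K)) x y" for k
      using pd_commute_inner[OF smK xy] pd_commute[OF sm_pd[OF smK] xy] by metis+
    ultimately show ?thesis by (simp add: sum.distrib axs mult.assoc)
  qed
  \<comment> \<open>At \<open>y = X x\<close> the constant length replaces the middle term of
    \<open>kill1\<close> by \<open>- px m K\<close>; with the spray equation the
    \<open>g\<close>-image of the acceleration \<open>z\<close> vanishes.\<close>
  have geodesic: "(\<Sum>j\<in>UNIV. X x $ j * dX i j x (X x)) + 2 * G i x (X x) = 0" if x: "x \<in> U" for x i
  proof -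
    let ?g = "fundamental_tensor L x (X x)"
    define z where "z = (\<chi> i. (\<Sum>j\<in>UNIV. X x $ j * dX i j x (X x)) + 2 * G i x (X x))"
    note xX = x X0[OF x]
    have "(?g *v z) $ m = 0" for m
    proof -
      have c: "px m K x (X x) + (\<Sum>k\<in>UNIV. dX k m x (X x) * py k K x (X x)) = 0"
        using sec[OF smK x, of C "axis m 1"] len by (simp add: axs)
      have "(\<Sum>k\<in>UNIV. py m (py k K) x (X x) * (\<Sum>j\<in>UNIV. X x $ j * dX k j x (X x)))
          + 2 * (\<Sum>k\<in>UNIV. py k (py m K) x (X x) * G k x (X x)) = 0"
      proof -
        have "(\<Sum>k\<in>UNIV. py m (py k K) x (X x) * (\<Sum>j\<in>UNIV. X x $ j * dX k j x (X x)))
            = (\<Sum>k\<in>UNIV. \<Sum>j\<in>UNIV. X x $ j * dX k j x (X x) * py m (py k K) x (X x))"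
          by (simp add: sum_distrib_right mult_ac)
        then show ?thesis
          using kill1[OF xX, of m] spray_equation[OF xX, of m] c by linarith
      qed
      then show ?thesis
        using xX by (simp add: matrix_vector_mult_def z_def fundamental_tensor_nth K_commute[of x "X x" "(0, axis m 1)"]
            sum.distrib distrib_left sum_divide_distrib[symmetric] mult_ac)
    qed
    then have "?g *v z = 0" by (simp add: vec_eq_iff)
    then have "z = 0"
      using convex[OF xX, of z] by force
    then show ?thesis by (simp add: z_def vec_eq_iff)
  qed
  \<comment> \<open>The covariant derivative of \<open>X\<close> with reference vector
    \<open>X\<close>: the \<open>py j (G i)\<close> are the coefficients of the nonlinear
    connection.\<close>
  define W where "W = (\<lambda>x. \<chi> i j. dX i j x (X x) + py j (G i) x (X x))"
  have W: "trace (W x) = 0" "trace (W x ** W x) \<le> 0" if x: "x \<in> U" for x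
  proof -
    let ?g = "fundamental_tensor L x (X x)"
    let ?y = "X x"
    note xX = x X0[OF x]
    have G2: "2 * G i x ?y = - (\<Sum>j\<in>UNIV. X x $ j * dX i j x ?y)" for i
      using geodesic[OF x, of i] by linarith
    have "(?g ** W x) $ m $ l + (?g ** W x) $ l $ m = 0" for m l
    proof -
      \<comment> \<open>Symmetrizing \<open>spray_derivative\<close> removes its skew part;
        \<open>geodesic\<close> then rewrites the spray direction at \<open>X\<close> as the tangent
        of the section, to which \<open>kill2\<close> applies.\<close>
      have "2 * (\<Sum>i\<in>UNIV. py i (py m K) x ?y * py l (G i) x ?y)
        + 2 * (\<Sum>i\<in>UNIV. py i (py l K) x ?y * py m (G i) x ?y)
        = 2 * pd (geo x ?y) (py l (py m K)) x ?y"
      proof -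
        have "pd (geo x ?y) (py m (py l K)) x ?y = pd (geo x ?y) (py l (py m K)) x ?y"
          by (rule pd_commute_inner[OF smK xX])
        then show ?thesis
          using spray_derivative[OF xX, of m l] spray_derivative[OF xX, of l m] by linarith
      qed
      also have "pd (geo x ?y) (py l (py m K)) x ?y = (\<Sum>k\<in>UNIV. X x $ k * px k (py l (py m K)) x ?y)
        - (\<Sum>k\<in>UNIV. (2 * G k x ?y) * py k (py l (py m K)) x ?y)"
        by (simp add: pd_geo[OF sm_pd[OF sm_pd[OF smK]] xX] sum_distrib_left mult.assoc)
      also have "\<dots> = (\<Sum>k\<in>UNIV. X x $ k * px k (py l (py m K)) x ?y)
        + (\<Sum>k\<in>UNIV. \<Sum>j\<in>UNIV. X x $ j * dX k j x ?y * py k (py l (py m K)) x ?y)"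
        unfolding G2 by (simp add: sum_negf sum_distrib_right)
      also have "\<dots> = - (\<Sum>k\<in>UNIV. dX k m x ?y * py l (py k K) x ?y) - (\<Sum>k\<in>UNIV. dX k l x ?y * py m (py k K) x ?y)"
        using kill2[OF xX, of l m] by linarith
      finally have "(\<Sum>i\<in>UNIV. py i (py m K) x ?y * py l (G i) x ?y)
        + (\<Sum>i\<in>UNIV. py i (py l K) x ?y * py m (G i) x ?y)
        + (\<Sum>k\<in>UNIV. py l (py k K) x ?y * dX k m x ?y) + (\<Sum>k\<in>UNIV. py m (py k K) x ?y * dX k l x ?y) = 0"
        by (simp add: mult.commute)
      then show ?thesis
        using xX by (simp add: matrix_matrix_mult_def fundamental_tensor_nth W_def distrib_left sum.distrib
          K_commute[of x ?y "(0, axis m 1)"] K_commute[of x ?y "(0, axis l 1)"]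
          sum_divide_distrib[symmetric] add_divide_distrib[symmetric])
    qed
    then have "transpose (?g ** W x) = - (?g ** W x)"
      by (simp add: vec_eq_iff transpose_def eq_neg_iff_add_eq_0)
    then have "bil ?g u (W x *v v) = - bil ?g v (W x *v u)" for u v
    proof -
      assume t: "transpose (?g ** W x) = - (?g ** W x)"
      have "bil ?g u (W x *v v) = (u v* (?g ** W x)) \<bullet> v"
        by (simp add: bil_def matrix_vector_mul_assoc dot_lmul_matrix)
      also have "u v* (?g ** W x) = transpose (?g ** W x) *v u" by simp
      also have "\<dots> \<bullet> v = - bil ?g v (W x *v u)"
      proof -
        have "(- (?g ** W x)) *v u = - ((?g ** W x) *v u)"
          by (simp add: vec_eq_iff matrix_vector_mult_def sum_negf)
        then show ?thesis
          unfolding t by (simp add: bil_def matrix_vector_mul_assoc inner_commute)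
      qed
      finally show ?thesis .
    qed
    from trace_square_of_skew[OF spd_fundamental_tensor[OF xX] this]
    show "trace (W x) = 0" "trace (W x ** W x) \<le> 0" by auto
  qed
  let ?x = x0 and ?y = "X x0"
  note xX = x0 X0[OF x0]
  have sV: "sm U (\<lambda>x y. (\<Sum>j\<in>UNIV. X x $ j * dX i j x y) + 2 * G i x y)" for i
    by (intro sm_add sm_sum sm_mult sm_const openU sX sdX smG)
  \<comment> \<open>The summands of the divergence of \<open>geodesic\<close>: its component
    \<open>i\<close>, differentiated in the \<open>i\<close>-th coordinate along the
    section.\<close>
  have V: "(\<Sum>j\<in>UNIV. X ?x $ j * px i (dX i j) ?x ?y + dX j i ?x ?y * dX i j ?x ?y)
      + 2 * px i (G i) ?x ?y + 2 * (\<Sum>k\<in>UNIV. dX k i ?x ?y * py k (G i) ?x ?y) = 0" for i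
  proof -
    have s1: "sm U (\<lambda>x y. X x $ j * dX i j x y)" for j
      by (intro sm_mult sX sdX)
    have s2: "sm U (\<lambda>x y. 2 * G i x y)"
      by (intro sm_mult sm_const openU smG)
    have p: "pd w (\<lambda>x y. (\<Sum>j\<in>UNIV. X x $ j * dX i j x y) + 2 * G i x y) ?x ?y
      = (\<Sum>j\<in>UNIV. X ?x $ j * pd w (dX i j) ?x ?y + pd w (\<lambda>x y. X x $ j) ?x ?y * dX i j ?x ?y) + 2 * pd w (G i) ?x ?y" for w
      using xX by (simp add: pd_add[OF sm_sum[OF openU s1] s2] pd_sum[OF openU s1] pd_mult[OF sX sdX] pd_cmult[OF smG])
    show ?thesis
    proof -
      have "px i (\<lambda>x y. X x $ j) ?x y = dX j i ?x y" for j y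
        by (simp add: pX[OF x0] dX_def)
      moreover have "\<forall>x\<in>U. (\<Sum>j\<in>UNIV. X x $ j * dX i j x (X x)) + 2 * G i x (X x) = 0"
        using geodesic by blast
      note sec[OF sV x0 this, of "axis i 1"]
      ultimately show ?thesis
        unfolding p by (simp add: axs pyX[OF x0] pydX[OF x0] sum_distrib_left mult_ac)
    qed
  qed
  have sT: "sm U (\<lambda>x y. \<Sum>i\<in>UNIV. dX i i x y + py i (G i) x y)"
    by (intro sm_add sm_sum openU sdX sm_pd smG)
  \<comment> \<open>The derivative of \<open>tr W = 0\<close> in the direction \<open>X\<close>;
    \<open>geodesic\<close> turns the fibre part of the tangent into \<open>- 2 G\<close>.\<close>
  have T: "(\<Sum>i\<in>UNIV. \<Sum>j\<in>UNIV. X ?x $ j * px j (dX i i) ?x ?y)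
      + (\<Sum>i\<in>UNIV. \<Sum>j\<in>UNIV. X ?x $ j * px j (py i (G i)) ?x ?y)
      - 2 * (\<Sum>i\<in>UNIV. \<Sum>k\<in>UNIV. G k ?x ?y * py k (py i (G i)) ?x ?y) = 0"
  proof -
    have "(\<Sum>i\<in>UNIV. dX i i x (X x) + py i (G i) x (X x)) = 0" if "x \<in> U" for x
      using W(1)[OF that] by (simp add: W_def trace_def)
    then have "\<forall>x\<in>U. (\<Sum>i\<in>UNIV. dX i i x (X x) + py i (G i) x (X x)) = 0" by blast
    note * = sec[OF sT x0 this, of ?y]
    have s1: "sm U (\<lambda>x y. dX i i x y + py i (G i) x y)" for i
      by (intro sm_add sdX sm_pd smG)
    have p: "pd w (\<lambda>x y. \<Sum>i\<in>UNIV. dX i i x y + py i (G i) x y) ?x ?y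
      = (\<Sum>i\<in>UNIV. pd w (dX i i) ?x ?y + pd w (py i (G i)) ?x ?y)" for w
      using xX by (simp add: pd_sum[OF openU s1] pd_add[OF sdX sm_pd[OF smG]])
    have G2: "(\<Sum>j\<in>UNIV. ?y $ j * dX i j ?x ?y) = - 2 * G i ?x ?y" for i
      using geodesic[OF x0, of i] by linarith
    have "(\<Sum>k\<in>UNIV. ?y $ k * (\<Sum>i\<in>UNIV. px k (dX i i) ?x ?y + px k (py i (G i)) ?x ?y))
      = (\<Sum>i\<in>UNIV. \<Sum>j\<in>UNIV. X ?x $ j * px j (dX i i) ?x ?y)
      + (\<Sum>i\<in>UNIV. \<Sum>j\<in>UNIV. X ?x $ j * px j (py i (G i)) ?x ?y)"
      unfolding sum_distrib_left by (subst sum.swap) (simp add: distrib_left sum.distrib)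
    moreover have "(\<Sum>k\<in>UNIV. (- 2 * G k ?x ?y) * (\<Sum>i\<in>UNIV. py k (dX i i) ?x ?y + py k (py i (G i)) ?x ?y))
      = - 2 * (\<Sum>i\<in>UNIV. \<Sum>k\<in>UNIV. G k ?x ?y * py k (py i (G i)) ?x ?y)"
      unfolding sum_distrib_left by (subst sum.swap) (simp add: pydX[OF x0] mult.assoc)
    ultimately show ?thesis
      using * unfolding p G2 by simp
  qed
  have R: "riemann_curvature L i i ?x ?y = 2 * px i (G i) ?x ?y - (\<Sum>j\<in>UNIV. ?y $ j * px j (py i (G i)) ?x ?y)
     + 2 * (\<Sum>j\<in>UNIV. G j ?x ?y * py j (py i (G i)) ?x ?y)
     - (\<Sum>j\<in>UNIV. py j (G i) ?x ?y * py i (G j) ?x ?y)" for i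
    unfolding riemann_curvature_def
    using xX by (simp add: dx_eq[OF smG] dy_eq[OF smG] dy_eq[OF sm_dx[OF smG]] dy_eq[OF sm_dy[OF smG]]
        pd_dx[OF smG] pd_dy[OF smG] mult.commute pd_commute[OF smG, of _ _ "(0, axis i 1)"])
  have "ricci_curvature L ?x ?y = - trace (W ?x ** W ?x)"
  proof -
    have tr: "trace (W ?x ** W ?x) = (\<Sum>i\<in>UNIV. \<Sum>j\<in>UNIV. dX i j ?x ?y * dX j i ?x ?y)
       + 2 * (\<Sum>i\<in>UNIV. \<Sum>j\<in>UNIV. dX j i ?x ?y * py j (G i) ?x ?y)
       + (\<Sum>i\<in>UNIV. \<Sum>j\<in>UNIV. py j (G i) ?x ?y * py i (G j) ?x ?y)"
    proof -
      have "(\<Sum>i\<in>UNIV. \<Sum>j\<in>UNIV. dX i j ?x ?y * py i (G j) ?x ?y)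
         = (\<Sum>i\<in>UNIV. \<Sum>j\<in>UNIV. dX j i ?x ?y * py j (G i) ?x ?y)"
        by (rule sum.swap)
      then show ?thesis
        by (simp add: trace_def matrix_matrix_mult_def W_def distrib_left distrib_right sum.distrib mult.commute)
    qed
    have "(\<Sum>i\<in>UNIV. (\<Sum>j\<in>UNIV. X ?x $ j * px i (dX i j) ?x ?y + dX j i ?x ?y * dX i j ?x ?y)
      + 2 * px i (G i) ?x ?y + 2 * (\<Sum>k\<in>UNIV. dX k i ?x ?y * py k (G i) ?x ?y)) = 0"
      using V by simp
    \<comment> \<open>Symmetry of the second derivatives of \<open>X\<close> makes the second order
      term equal to the one in \<open>T\<close>, so that subtracting \<open>T\<close> leaves the
      Ricci trace.\<close>
    then have V': "(\<Sum>i\<in>UNIV. \<Sum>j\<in>UNIV. X ?x $ j * px j (dX i i) ?x ?y)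
       + (\<Sum>i\<in>UNIV. \<Sum>j\<in>UNIV. dX i j ?x ?y * dX j i ?x ?y) + 2 * (\<Sum>i\<in>UNIV. px i (G i) ?x ?y)
       + 2 * (\<Sum>i\<in>UNIV. \<Sum>j\<in>UNIV. dX j i ?x ?y * py j (G i) ?x ?y) = 0"
      by (simp add: sum.distrib sum_distrib_left dX_commute[OF x0] mult.commute)
    have "ricci_curvature L ?x ?y = 2 * (\<Sum>i\<in>UNIV. px i (G i) ?x ?y)
       - (\<Sum>i\<in>UNIV. \<Sum>j\<in>UNIV. ?y $ j * px j (py i (G i)) ?x ?y)
       + 2 * (\<Sum>i\<in>UNIV. \<Sum>j\<in>UNIV. G j ?x ?y * py j (py i (G i)) ?x ?y)
       - (\<Sum>i\<in>UNIV. \<Sum>j\<in>UNIV. py j (G i) ?x ?y * py i (G j) ?x ?y)"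
      unfolding ricci_curvature_def R by (simp add: sum.distrib sum_subtractf sum_distrib_left)
    then show ?thesis using tr V' T by linarith
  qed
  then show ?thesis using W(2)[OF x0] by simp
qed

end

section \<open>Lebesgue measure of linear images\<close>

text \<open>The linear change of variables in the library needs a well-ordered index type, hence this
  well-ordered copy of a finite type.\<close>

typedef 'n reindexed = "UNIV :: 'n set" morphisms index_of reindex by simp

lemma bij_reindex: "bij reindex" and bij_index_of: "bij index_of"
  by (auto simp: reindex_inverse index_of_inverse intro!: o_bij[of index_of] o_bij[of reindex])

instance reindexed :: (finite) finite
  by standard (metis bij_reindex bij_betw_def finite finite_imageI)

text \<open>Every injection into the naturals induces a wellorder, so an arbitrary one is
  chosen.\<close>

definition index_rank :: "'n::finite reindexed \<Rightarrow> nat" where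
  "index_rank = (SOME f. inj f)"

lemma inj_index_rank: "inj index_rank"
proof -
  have "\<exists>f :: 'a reindexed \<Rightarrow> nat. inj f"
    using finite_imp_inj_to_nat_seg[of "UNIV :: 'a reindexed set"] by auto
  then show ?thesis unfolding index_rank_def by (rule someI_ex)
qed

instantiation reindexed :: (finite) wellorder
begin

definition less_eq_reindexed :: "'a reindexed \<Rightarrow> 'a reindexed \<Rightarrow> bool" where
  "less_eq_reindexed i j \<longleftrightarrow> index_rank i \<le> index_rank j"

definition less_reindexed :: "'a reindexed \<Rightarrow> 'a reindexed \<Rightarrow> bool" where
  "less_reindexed i j \<longleftrightarrow> index_rank i < index_rank j"

instance
proof
  fix i j :: "'a reindexed"
  show "i \<le> j \<Longrightarrow> j \<le> i \<Longrightarrow> i = j"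
    using inj_index_rank by (auto simp: less_eq_reindexed_def inj_def)
next
  fix P :: "'a reindexed \<Rightarrow> bool" and i :: "'a reindexed"
  assume step: "\<And>i. (\<And>j. j < i \<Longrightarrow> P j) \<Longrightarrow> P i"
  show "P i"
  proof (induction "index_rank i" arbitrary: i rule: less_induct)
    case less
    show ?case
      by (rule step, rule less) (simp add: less_reindexed_def)
  qed
qed (auto simp: less_eq_reindexed_def less_reindexed_def)

end

definition reindex_vec :: "real^'n::finite \<Rightarrow> real^'n reindexed" where
  "reindex_vec x = (\<chi> i. x $ index_of i)"

lemma reindex_vec_image:
  fixes S :: "(real^'n::finite) set"
  shows "reindex_vec ` S = {y. (\<chi> i. y $ reindex i) \<in> S}"
proof -
  have "y = reindex_vec (\<chi> i. y $ reindex i)" for y :: "real^'n reindexed"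
    by (simp add: reindex_vec_def vec_eq_iff index_of_inverse)
  moreover have "(\<chi> i. reindex_vec x $ reindex i) = x" for x :: "real^'n"
    by (simp add: reindex_vec_def vec_eq_iff reindex_inverse)
  ultimately show ?thesis by force
qed

lemma linear_unreindex: "linear (\<lambda>y :: real^'n::finite reindexed. (\<chi> i. y $ reindex i) :: real^'n)"
  by (rule linearI) (simp_all add: vec_eq_iff)

text \<open>\<open>lborel\<close> is determined by the volumes of boxes, and renaming coordinates
  maps boxes to boxes with the same side lengths.\<close>

lemma lborel_reindex:
  "lborel = distr lborel borel (\<lambda>y :: real^'n::finite reindexed. (\<chi> i. y $ reindex i) :: real^'n)"
  (is "_ = distr _ _ ?f")
proof (rule lborel_eqI)
  fix l u :: "real^'n" assume le: "\<And>b. b \<in> Basis \<Longrightarrow> l \<bullet> b \<le> u \<bullet> b"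
  then have lu: "l $ i \<le> u $ i" for i
    using le[of "axis i 1"] by (auto simp: Basis_vec_def inner_axis)
  have m: "?f \<in> borel_measurable lborel"
    by (simp add: borel_measurable_continuous_onI linear_continuous_on linear_unreindex linear_conv_bounded_linear[symmetric])
  have "?f -` box l u \<inter> space lborel = box (reindex_vec l) (reindex_vec u)"
  proof -
    have "(\<forall>i. l $ i < y $ reindex i \<and> y $ reindex i < u $ i)
      \<longleftrightarrow> (\<forall>i. l $ index_of i < y $ i \<and> y $ i < u $ index_of i)" for y :: "real^'n reindexed"
      by (metis index_of_inverse reindex_inverse UNIV_I)
    then show ?thesis by (auto simp: mem_box_cart reindex_vec_def)
  qed
  then have "emeasure (distr lborel borel ?f) (box l u) = emeasure lborel (box (reindex_vec l) (reindex_vec u))"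
    using m by (simp add: emeasure_distr)
  also have "\<dots> = ennreal (\<Prod>b\<in>Basis. (reindex_vec u - reindex_vec l) \<bullet> b)"
    using lu by (intro emeasure_lborel_box) (auto simp: Basis_vec_def inner_axis reindex_vec_def)
  also have "(\<Prod>b\<in>Basis. (reindex_vec u - reindex_vec l) \<bullet> b) = (\<Prod>i\<in>UNIV. u $ index_of i - l $ index_of i)"
    by (subst prod.reindex_bij_betw[of "\<lambda>i. axis i 1" UNIV, symmetric])
      (auto simp: bij_betw_def inj_on_def axis_eq_axis Basis_vec_def inner_axis reindex_vec_def)
  also have "\<dots> = (\<Prod>i\<in>UNIV. u $ i - l $ i)"
    by (rule prod.reindex_bij_betw[OF bij_index_of])
  also have "\<dots> = (\<Prod>b\<in>Basis. (u - l) \<bullet> b)"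
    by (subst prod.reindex_bij_betw[of "\<lambda>i. axis i 1" UNIV Basis, symmetric])
      (auto simp: bij_betw_def inj_on_def axis_eq_axis Basis_vec_def inner_axis)
  finally show "emeasure (distr lborel borel ?f) (box l u) = ennreal (\<Prod>b\<in>Basis. (u - l) \<bullet> b)" .
qed simp

lemma measure_reindex:
  fixes S :: "(real^'n::finite) set"
  assumes "S \<in> sets borel"
  shows "reindex_vec ` S \<in> sets borel" "measure lborel (reindex_vec ` S) = measure lborel S"
proof -
  let ?f = "\<lambda>y :: real^'n reindexed. (\<chi> i. y $ reindex i) :: real^'n"
  have m: "?f \<in> borel_measurable borel"
    by (simp add: borel_measurable_continuous_onI linear_continuous_on linear_unreindex linear_conv_bounded_linear[symmetric])
  have e: "reindex_vec ` S = ?f -` S \<inter> space borel"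
    by (auto simp: reindex_vec_image)
  show "reindex_vec ` S \<in> sets borel"
    unfolding e by (rule measurable_sets[OF m assms])
  have "measure lborel S = measure (distr lborel borel ?f) S"
    using lborel_reindex by metis
  also have "\<dots> = measure lborel (reindex_vec ` S)"
    using m assms by (simp add: measure_distr e)
  finally show "measure lborel (reindex_vec ` S) = measure lborel S" by simp
qed

text \<open>Conjugating a transposition by a bijection gives a transposition, so renaming indices
  keeps the parity of a permutation.\<close>

lemma swapidseq_conjugate:
  assumes "swapidseq n p"
  shows "swapidseq n (reindex \<circ> p \<circ> index_of)"
  using assms
proof (induction rule: swapidseq.induct)
  case id
  then show ?case by (simp add: comp_def index_of_inverse id_def[symmetric])
next
  case (comp_Suc n p a b)
  have "reindex \<circ> (Transposition.transpose a b \<circ> p) \<circ> index_of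
      = Transposition.transpose (reindex a) (reindex b) \<circ> (reindex \<circ> p \<circ> index_of)"
    by (auto simp: fun_eq_iff Transposition.transpose_def reindex_inject)
  then show ?case
    using comp_Suc swapidseq.comp_Suc[of n "reindex \<circ> p \<circ> index_of" "reindex a" "reindex b"]
    by (simp add: reindex_inject o_def)
qed

lemma det_reindex:
  fixes P :: "real^'n::finite^'n"
  shows "det (\<chi> i j. P $ index_of i $ index_of j) = det P"
proof -
  let ?c = "\<lambda>p. reindex \<circ> p \<circ> index_of"
  have b: "bij_betw ?c {p. p permutes UNIV} {p. p permutes UNIV}"
  proof (rule bij_betwI[where g = "\<lambda>p. index_of \<circ> p \<circ> reindex"])
    show "?c \<in> {p. p permutes UNIV} \<rightarrow> {p. p permutes UNIV}"
      using bij_comp[OF bij_index_of bij_comp[OF _ bij_reindex]]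
      by (auto simp: permutes_univ bij_iff[symmetric] o_assoc simp del: comp_apply o_apply)
    show "(\<lambda>p. index_of \<circ> p \<circ> reindex) \<in> {p. p permutes UNIV} \<rightarrow> {p. p permutes UNIV}"
      using bij_comp[OF bij_reindex bij_comp[OF _ bij_index_of]]
      by (auto simp: permutes_univ bij_iff[symmetric] o_assoc simp del: comp_apply o_apply)
  qed (auto simp: fun_eq_iff reindex_inverse index_of_inverse)
  have s: "sign (?c p) = sign p" if "p permutes UNIV" for p :: "'n \<Rightarrow> 'n"
  proof -
    have "permutation p" using that by (auto simp: permutation_permutes)
    then obtain n where n: "swapidseq n p" by (auto simp: permutation_def)
    show ?thesis
      using evenperm_unique[OF n refl] evenperm_unique[OF swapidseq_conjugate[OF n] refl] by (simp add: sign_def)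
  qed
  have "det (\<chi> i j. P $ index_of i $ index_of j)
    = (\<Sum>p | p permutes UNIV. of_int (sign (?c p)) * (\<Prod>i\<in>UNIV. P $ index_of i $ index_of (?c p i)))"
    unfolding det_def by (subst sum.reindex_bij_betw[OF b, symmetric]) simp
  also have "\<dots> = (\<Sum>p | p permutes UNIV. of_int (sign p) * (\<Prod>i\<in>UNIV. P $ i $ p i))"
  proof (rule sum.cong[OF refl])
    fix p :: "'n \<Rightarrow> 'n" assume p: "p \<in> {p. p permutes UNIV}"
    have "(\<Prod>i\<in>UNIV. P $ index_of i $ index_of (?c p i)) = (\<Prod>i\<in>UNIV. P $ index_of i $ p (index_of i))"
      by (simp add: reindex_inverse)
    also have "\<dots> = (\<Prod>i\<in>UNIV. P $ i $ p i)"
      by (rule prod.reindex_bij_betw[OF bij_index_of])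
    finally show "of_int (sign (?c p)) * (\<Prod>i\<in>UNIV. P $ index_of i $ index_of (?c p i))
      = of_int (sign p) * (\<Prod>i\<in>UNIV. P $ i $ p i)"
      using p s by simp
  qed
  finally show ?thesis by (simp add: det_def)
qed

text \<open>The image is moved to the well-ordered index type, where the formula for linear images
  applies; measure and determinant survive the renaming. Borel sets pass through
  \<open>measure_reindex\<close>, and boundedness gives finite measure.\<close>

lemma measure_linear_image_finite:
  fixes P :: "real^'n::finite^'n" and S :: "(real^'n) set"
  assumes P: "det P \<noteq> 0" and S: "S \<in> sets borel" "bounded S"
  shows "measure lebesgue ((*v) P ` S) = \<bar>det P\<bar> * measure lebesgue S"
proof -
  define P' where "P' = (\<chi> i j. P $ index_of i $ index_of j)"
  have r: "reindex_vec (P *v x) = P' *v reindex_vec x" for x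
    by (simp add: vec_eq_iff reindex_vec_def P'_def matrix_vector_mult_def
        sum.reindex_bij_betw[OF bij_index_of, of "\<lambda>j. P $ _ $ j * x $ j"])
  have bl: "bounded_linear (reindex_vec :: real^'n \<Rightarrow> _)"
    by (intro linear_conv_bounded_linear[THEN iffD1] linearI) (simp_all add: reindex_vec_def vec_eq_iff)
  have PS: "(*v) P ` S \<in> sets borel"
  proof -
    have "(*v) P ` S = (*v) (matrix_inv P) -` S \<inter> space borel"
    proof -
      have "matrix_inv P *v (P *v x) = x" "P *v (matrix_inv P *v x) = x" for x
        by (simp_all add: matrix_vector_mul_assoc matrix_inv_left_right[OF P])
      then show ?thesis by (auto simp: image_iff) metis
    qed
    moreover have "(*v) (matrix_inv P) \<in> borel_measurable borel"
      by (intro borel_measurable_continuous_onI matrix_vector_mult_linear_continuous_on)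
    ultimately show ?thesis using S measurable_sets by metis
  qed
  have "reindex_vec ` S \<in> lmeasurable"
    using measure_reindex[OF S(1)] bounded_linear_image[OF S(2) bl]
    by (intro bounded_set_imp_lmeasurable) auto
  have "measure lebesgue ((*v) P ` S) = measure lebesgue (reindex_vec ` ((*v) P ` S))"
    using measure_reindex[OF PS] PS by (simp add: measure_completion)
  also have "reindex_vec ` ((*v) P ` S) = (*v) P' ` (reindex_vec ` S)"
    by (simp add: image_image r)
  also have "measure lebesgue \<dots> = \<bar>det P'\<bar> * measure lebesgue (reindex_vec ` S)"
    using measure_linear_image[OF matrix_vector_mul_linear[of P'] \<open>reindex_vec ` S \<in> lmeasurable\<close>] by simp
  also have "measure lebesgue (reindex_vec ` S) = measure lebesgue S"
    using measure_reindex[OF S(1)] S by (simp add: measure_completion)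
  finally show ?thesis by (simp add: P'_def det_reindex)
qed

section \<open>Metrics of square type with constant length\<close>

text \<open>\<open>F = \<alpha> + c \<beta> + \<beta>\<^sup>2/\<alpha>\<close>: the square metric for \<open>c = 2\<close>, its Randers change for \<open>c = 3\<close>.\<close>

locale alpha_beta_patch = finsler_patch U L
  for U :: "(real^'n::finite) set" and L +
  fixes a :: "real^'n \<Rightarrow> real^'n^'n" and bf :: "real^'n \<Rightarrow> real^'n" and c b :: real
  assumes sma: "\<And>i j. smooth_on U (\<lambda>x. a x $ i $ j)"
    and smb: "\<And>i. smooth_on U (\<lambda>x. bf x $ i)"
    and spda: "\<And>x. x \<in> U \<Longrightarrow> spd (a x)"
    and b: "b > 0" and c: "c \<ge> 0"
    and dual_norm: "\<And>x. x \<in> U \<Longrightarrow> bf x \<bullet> (matrix_inv (a x) *v bf x) = b\<^sup>2"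
    and L_eq: "\<And>x y. x \<in> U \<Longrightarrow> L x y
      = (bil (a x) y y + c * sqrt (bil (a x) y y) * (bf x \<bullet> y) + (bf x \<bullet> y)\<^sup>2) / sqrt (bil (a x) y y)"
    and L_pos: "\<And>x y. x \<in> U \<Longrightarrow> y \<noteq> 0 \<Longrightarrow> L x y > 0"
    and S_zero: "\<And>x y. x \<in> U \<Longrightarrow> y \<noteq> 0 \<Longrightarrow> S_curvature L x y = 0"
begin

definition "X x = matrix_inv (a x) *v bf x"
definition "al x y = sqrt (bil (a x) y y)"
definition "be x y = bf x \<bullet> y"
definition "s x y = be x y / al x y"
text \<open>The fibre derivative of \<alpha> in direction \<open>v\<close>, see
  \<open>pdv_al\<close>.\<close>

definition "l v x y = bil (a x) y v / al x y"

lemma smX: "smooth_on U (\<lambda>x. X x $ i)"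
proof -
  have "smooth_on U (\<lambda>x. \<Sum>j\<in>UNIV. matrix_inv (a x) $ i $ j * bf x $ j)"
    by (intro smooth_on_sum smooth_on_mult smooth_on_matrix_inv openU sma smb spd_det_nz spda)
  then show ?thesis by (simp add: X_def matrix_vector_mult_def)
qed

lemma bil_X: assumes "x \<in> U" shows "bil (a x) v (X x) = bf x \<bullet> v" "bil (a x) (X x) v = bf x \<bullet> v"
proof -
  have "a x *v X x = bf x"
    using matrix_inv_left_right[OF spd_det_nz[OF spda[OF assms]]]
    by (simp add: X_def matrix_vector_mul_assoc)
  then show 1: "bil (a x) v (X x) = bf x \<bullet> v" by (simp add: bil_def inner_commute)
  then show "bil (a x) (X x) v = bf x \<bullet> v" using spd_sym[OF spda[OF assms]] by simp
qed

lemma beta_X: "x \<in> U \<Longrightarrow> bf x \<bullet> X x = b\<^sup>2"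
  by (simp add: X_def dual_norm)

lemma X_nz: "x \<in> U \<Longrightarrow> X x \<noteq> 0"
  using beta_X[of x] b by auto

lemma al_pos: "x \<in> U \<Longrightarrow> y \<noteq> 0 \<Longrightarrow> al x y > 0"
  by (simp add: al_def spd_pos spda)

lemma al_square: "x \<in> U \<Longrightarrow> (al x y)\<^sup>2 = bil (a x) y y"
  by (simp add: al_def spd_nonneg spda)

lemma sm_bil: "sm U (\<lambda>x y. bil (a x) y v)" "sm U (\<lambda>x y. bil (a x) y y)"
  unfolding bil_expand
  by (intro sm_sum sm_mult sm_const sm_component sm_base openU sma)+

lemma sm_al: "sm U al"
proof -
  have "sm U (\<lambda>x y. sqrt (bil (a x) y y))"
    by (rule sm_sqrt[OF sm_bil(2)]) (simp add: spd_pos spda)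
  then show ?thesis by (simp add: al_def[abs_def])
qed

lemma sm_be: "sm U be"
proof -
  have "sm U (\<lambda>x y. \<Sum>i\<in>UNIV. bf x $ i * y $ i)"
    by (intro sm_sum sm_mult sm_component sm_base openU smb)
  then show ?thesis by (simp add: be_def[abs_def] inner_vec_def)
qed

lemma sm_s: "sm U s"
  unfolding s_def[abs_def] by (intro sm_divide sm_be sm_al) (use al_pos in force)

lemma sm_l: "sm U (l v)"
  unfolding l_def[abs_def] by (intro sm_divide sm_bil sm_al) (use al_pos in force)

lemma sm_beta: "sm U (\<lambda>x y. bf x \<bullet> v)"
proof -
  have "sm U (\<lambda>x y. \<Sum>i\<in>UNIV. bf x $ i * v $ i)"
    by (intro sm_sum sm_mult sm_const sm_base openU smb)
  then show ?thesis by (simp add: inner_vec_def)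
qed

lemma L_phi:
  assumes "x \<in> U" "y \<noteq> 0"
  shows "L x y = al x y * (1 + c * s x y + (s x y)\<^sup>2)"
proof -
  have "L x y = ((al x y)\<^sup>2 + c * al x y * be x y + (be x y)\<^sup>2) / al x y"
    using assms by (simp add: L_eq al_square) (simp add: al_def be_def)
  also have "be x y = s x y * al x y"
    using al_pos[OF assms] by (simp add: s_def)
  also have "((al x y)\<^sup>2 + c * al x y * (s x y * al x y) + (s x y * al x y)\<^sup>2) / al x y
      = al x y * (1 + c * s x y + (s x y)\<^sup>2)"
    using al_pos[OF assms] by (simp add: field_simps power2_eq_square)
  finally show ?thesis .
qed

lemma l_X: "x \<in> U \<Longrightarrow> l (X x) x y = s x y"
  by (simp add: l_def s_def be_def bil_X)

text \<open>Cauchy-Schwarz for \<open>X\<close> and \<open>y\<close>: the component of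
  \<open>X\<close> orthogonal to \<open>y\<close> has squared length
  \<open>b^2 - s^2\<close>.\<close>

lemma s_square_le: "x \<in> U \<Longrightarrow> y \<noteq> 0 \<Longrightarrow> (s x y)\<^sup>2 \<le> b\<^sup>2"
proof -
  assume xy: "x \<in> U" "y \<noteq> 0"
  let ?z = "X x - (s x y / al x y) *\<^sub>R y"
  have "bil (a x) ?z ?z \<ge> 0" by (rule spd_nonneg[OF spda[OF xy(1)]])
  moreover have "bil (a x) ?z ?z = b\<^sup>2 - (s x y)\<^sup>2"
  proof -
    have "bil (a x) (X x - k *\<^sub>R y) (X x - k *\<^sub>R y) = b\<^sup>2 - 2 * k * be x y + k\<^sup>2 * (al x y)\<^sup>2" for k
      unfolding al_square[OF xy(1)]
      using xy by (simp add: bil_simps bil_X beta_X be_def algebra_simps power2_eq_square)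
    moreover have "s x y / al x y * be x y = (s x y)\<^sup>2" "(s x y / al x y)\<^sup>2 * (al x y)\<^sup>2 = (s x y)\<^sup>2"
      using al_pos[OF xy] by (simp_all add: s_def power2_eq_square)
    ultimately show ?thesis by simp
  qed
  ultimately show ?thesis by simp
qed

section \<open>Fibre derivatives of F and the determinant of its fundamental tensor\<close>

lemma pdv_al:
  assumes "x \<in> U" "y \<noteq> 0"
  shows "pd (0, v) al x y = l v x y"
proof (rule pd_vertical[OF sm_al assms])
  have "bil (a x) y y > 0" using assms by (simp add: spd_pos spda)
  moreover have "((\<lambda>y. bil (a x) y y) has_derivative (\<lambda>v. 2 * bil (a x) y v)) (at y)"
  proof -
    have "((*v) (a x) has_derivative (*v) (a x)) (at y)"
      by (intro bounded_linear_imp_has_derivative matrix_vector_mul_bounded_linear)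
    then have "((\<lambda>y. y \<bullet> (a x *v y)) has_derivative (\<lambda>v. y \<bullet> (a x *v v) + v \<bullet> (a x *v y))) (at y)"
      by (rule has_derivative_inner[OF has_derivative_ident])
    also have "(\<lambda>v. y \<bullet> (a x *v v) + v \<bullet> (a x *v y)) = (\<lambda>v. 2 * bil (a x) y v)"
    proof
      fix v show "y \<bullet> (a x *v v) + v \<bullet> (a x *v y) = 2 * bil (a x) y v"
        using spd_sym[OF spda[OF assms(1)], of v y] unfolding bil_def by linarith
    qed
    finally show ?thesis unfolding bil_def .
  qed
  ultimately show "(al x has_derivative (\<lambda>v. l v x y)) (at y)"
    unfolding al_def[abs_def] l_def
    by (auto intro!: has_derivative_eq_rhs[OF has_derivative_real_sqrt] simp: field_simps)
qed

lemma pdv_be: "x \<in> U \<Longrightarrow> y \<noteq> 0 \<Longrightarrow> pd (0, v) be x y = bf x \<bullet> v"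
  by (rule pd_vertical[OF sm_be]) (auto intro!: derivative_eq_intros simp: be_def[abs_def])

lemma pdv_bil: "x \<in> U \<Longrightarrow> y \<noteq> 0 \<Longrightarrow> pd (0, w) (\<lambda>x y. bil (a x) y v) x y = bil (a x) w v"
  by (rule pd_vertical[OF sm_bil(1)]) (auto intro!: derivative_eq_intros simp: bil_def)

lemma pdv_beta: "x \<in> U \<Longrightarrow> y \<noteq> 0 \<Longrightarrow> pd (0, w) (\<lambda>x y. bf x \<bullet> v) x y = 0"
  by (rule pd_vertical[OF sm_beta]) (auto intro!: derivative_eq_intros)

text \<open>Product rule for \<open>f / al * al = f\<close>. In this form the quotients
  \<open>s\<close> and \<open>l\<close> reappear in their own derivatives.\<close>

lemma pd_quotient:
  assumes "sm U f" "x \<in> U" "y \<noteq> 0"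
  shows "pd w (\<lambda>x y. f x y / al x y) x y = (pd w f x y - f x y / al x y * pd w al x y) / al x y"
proof -
  have q: "sm U (\<lambda>x y. f x y / al x y)"
    by (intro sm_divide assms sm_al) (use al_pos in force)
  have "pd w (\<lambda>x y. f x y / al x y * al x y) x y = pd w f x y"
    by (rule pd_cong[OF openU assms(2,3)]) (use al_pos in force)
  then have "f x y / al x y * pd w al x y + pd w (\<lambda>x y. f x y / al x y) x y * al x y = pd w f x y"
    by (simp only: pd_mult[OF q sm_al assms(2,3)])
  moreover have "al x y \<noteq> 0" using al_pos[OF assms(2,3)] by simp
  ultimately show ?thesis
    by (simp only: eq_divide_eq) simp
qed

lemma pdv_s:
  assumes "x \<in> U" "y \<noteq> 0"
  shows "pd (0, v) s x y = (bf x \<bullet> v - s x y * l v x y) / al x y"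
  using pd_quotient[OF sm_be assms, of "(0, v)"] by (simp add: s_def[abs_def] pdv_al pdv_be assms)

lemma pdv_l:
  assumes "x \<in> U" "y \<noteq> 0"
  shows "pd (0, w) (l v) x y = (bil (a x) w v - l v x y * l w x y) / al x y"
  using pd_quotient[OF sm_bil(1) assms, of "(0, w)" v] by (simp add: l_def[abs_def] pdv_al pdv_bil assms)

lemma sm_phi: "sm U (\<lambda>x y. 1 + c * s x y + (s x y)\<^sup>2)"
  by (intro sm_add sm_mult sm_const sm_power sm_s openU)

lemma pd_phi:
  assumes "x \<in> U" "y \<noteq> 0"
  shows "pd w (\<lambda>x y. 1 + c * s x y + (s x y)\<^sup>2) x y = (c + 2 * s x y) * pd w s x y"
  using pd_add[OF sm_add[OF sm_const[OF openU] sm_mult[OF sm_const[OF openU] sm_s]] sm_power[OF sm_s], of x y w 1 c 2]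
    pd_add[OF sm_const[OF openU] sm_mult[OF sm_const[OF openU] sm_s], of x y w 1 c] assms
  by (simp add: pd_const pd_cmult[OF sm_s] pd_power2[OF sm_s] algebra_simps)

text \<open>With phi(s) = 1 + c s + s^2 the coefficients are phi - s phi' = 1 - s^2 and phi' = c + 2
  s.\<close>

lemma pdv_L:
  assumes "x \<in> U" "y \<noteq> 0"
  shows "pd (0, v) L x y = (1 - (s x y)\<^sup>2) * l v x y + (c + 2 * s x y) * (bf x \<bullet> v)"
proof -
  have "pd (0, v) L x y = pd (0, v) (\<lambda>x y. al x y * (1 + c * s x y + (s x y)\<^sup>2)) x y"
    by (rule pd_cong[OF openU assms]) (rule L_phi)
  also have "\<dots> = al x y * ((c + 2 * s x y) * ((bf x \<bullet> v - s x y * l v x y) / al x y))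
      + l v x y * (1 + c * s x y + (s x y)\<^sup>2)"
    using assms by (simp add: pd_mult[OF sm_al sm_phi] pd_phi pdv_s pdv_al)
  also have "al x y * ((c + 2 * s x y) * ((bf x \<bullet> v - s x y * l v x y) / al x y))
      = (c + 2 * s x y) * (bf x \<bullet> v - s x y * l v x y)"
    using al_pos[OF assms] by simp
  finally show ?thesis
    by (simp add: algebra_simps power2_eq_square)
qed

text \<open>The summand c \<beta> of F is linear in \<open>y\<close>, hence \<open>c\<close> is
  absent from the Hessian. The factor 2 is phi''.\<close>

lemma pdv_pdv_L:
  assumes "x \<in> U" "y \<noteq> 0"
  shows "al x y * pd (0, w) (pd (0, v) L) x y = (1 - (s x y)\<^sup>2) * (bil (a x) w v - l v x y * l w x y)
     + 2 * (bf x \<bullet> w - s x y * l w x y) * (bf x \<bullet> v - s x y * l v x y)"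
proof -
  have s1: "sm U (\<lambda>x y. (1 - (s x y)\<^sup>2) * l v x y)" "sm U (\<lambda>x y. 1 - (s x y)\<^sup>2)"
    by (intro sm_mult sm_diff sm_const sm_power sm_s sm_l openU)+
  have s2: "sm U (\<lambda>x y. (c + 2 * s x y) * (bf x \<bullet> v))" "sm U (\<lambda>x y. c + 2 * s x y)" "sm U (\<lambda>x y. 2 * s x y)"
    by (intro sm_mult sm_add sm_const sm_s sm_beta openU)+
  have "pd (0, w) (pd (0, v) L) x y
      = pd (0, w) (\<lambda>x y. (1 - (s x y)\<^sup>2) * l v x y + (c + 2 * s x y) * (bf x \<bullet> v)) x y"
    by (rule pd_cong[OF openU assms]) (rule pdv_L)
  also have "\<dots> = (1 - (s x y)\<^sup>2) * ((bil (a x) w v - l v x y * l w x y) / al x y)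
      - 2 * s x y * ((bf x \<bullet> w - s x y * l w x y) / al x y) * l v x y
      + 2 * ((bf x \<bullet> w - s x y * l w x y) / al x y) * (bf x \<bullet> v)"
    using assms by (simp add: pd_add[OF s1(1) s2(1)] pd_mult[OF s1(2) sm_l] pd_mult[OF s2(2) sm_beta]
        pd_diff[OF sm_const[OF openU] sm_power[OF sm_s]] pd_power2[OF sm_s] pd_const pdv_l pdv_s pdv_beta
        pd_add[OF sm_const[OF openU] s2(3)] pd_cmult[OF sm_s])
  finally have e: "pd (0, w) (pd (0, v) L) x y = \<dots>" .
  have "al x y * pd (0, w) (pd (0, v) L) x y = (1 - (s x y)\<^sup>2) * (bil (a x) w v - l v x y * l w x y)
      - 2 * s x y * (bf x \<bullet> w - s x y * l w x y) * l v x y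
      + 2 * (bf x \<bullet> w - s x y * l w x y) * (bf x \<bullet> v)"
  proof -
    have r: "al x y * (A * (B / al x y) - C * (D / al x y) * E + F * (D / al x y) * H) = A * B - C * D * E + F * D * H"
      for A B C D E F H
      using al_pos[OF assms] by (simp add: field_simps)
    show ?thesis unfolding e by (rule r)
  qed
  then show ?thesis
    by (simp add: algebra_simps power2_eq_square)
qed

lemma bil_fundamental_tensor:
  assumes "x \<in> U" "y \<noteq> 0"
  shows "bil (fundamental_tensor L x y) u v = L x y * pd (0, v) (pd (0, u) L) x y + pd (0, u) L x y * pd (0, v) L x y"
proof -
  have z: "pd (0, u) f x y = (\<Sum>i\<in>UNIV. u $ i * py i f x y)" if "sm U f" "x \<in> U" "y \<noteq> 0" for f x y and u :: "real^'n"
    using pd_expand[OF that, of 0 u] by simp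
  have "bil (fundamental_tensor L x y) u v = (\<Sum>j\<in>UNIV. v $ j * (\<Sum>i\<in>UNIV. u $ i * py j (py i K) x y)) / 2"
    unfolding bil_expand using assms
    by (subst sum.swap) (simp add: fundamental_tensor_nth sum_distrib_left sum_divide_distrib mult_ac)
  also have "(\<Sum>j\<in>UNIV. v $ j * (\<Sum>i\<in>UNIV. u $ i * py j (py i K) x y)) = pd (0, v) (pd (0, u) K) x y"
  proof -
    have "py j (pd (0, u) K) x y = py j (\<lambda>x y. \<Sum>i\<in>UNIV. u $ i * py i K x y) x y" for j
      by (rule pd_cong[OF openU assms]) (rule z[OF smK])
    also have "py j (\<lambda>x y. \<Sum>i\<in>UNIV. u $ i * py i K x y) x y = (\<Sum>i\<in>UNIV. u $ i * py j (py i K) x y)" for j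
      using assms by (simp add: pd_sum[OF openU sm_mult[OF sm_const[OF openU] sm_pd[OF smK]]] pd_cmult[OF sm_pd[OF smK]])
    finally show ?thesis by (simp add: z[OF sm_pd[OF smK] assms, of v])
  qed
  also have "pd (0, v) (pd (0, u) K) x y = pd (0, v) (\<lambda>x y. 2 * (L x y * pd (0, u) L x y)) x y"
    by (rule pd_cong[OF openU assms]) (use pd_power2[OF smL] in \<open>simp add: sq_def[abs_def]\<close>)
  also have "\<dots> = 2 * (L x y * pd (0, v) (pd (0, u) L) x y + pd (0, u) L x y * pd (0, v) L x y)"
    using assms by (simp add: pd_cmult[OF sm_mult[OF smL sm_pd[OF smL]]] pd_mult[OF smL sm_pd[OF smL]])
  finally show ?thesis by simp
qed

text \<open>The determinant factor of an (\<alpha>, \<beta>)-metric, phi^(n+1) (phi - s phi')^(n-2)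
  (phi - s phi' + (b^2 - s^2) phi''). For n = 1 the truncated exponent is 0, but then s^2 = b^2
  throughout and \<open>det_fundamental_tensor\<close> is vacuous.\<close>

definition detp :: "real poly" where
  "detp = [:1, c, 1:] ^ 3 * [:1 + 2 * b\<^sup>2, 0, -3:] * ([:1, c, 1:] * [:1, 0, -1:]) ^ (CARD('n) - 2)"

text \<open>Every factor has a nonzero leading coefficient, so degrees add up, and the cube alone
  contributes 6.\<close>

lemma detp_degree: "degree detp > 0"
proof -
  have "degree (A * B * C) = degree A + degree B + degree C" if "A \<noteq> 0" "B \<noteq> 0" "C \<noteq> 0" for A B C :: "real poly"
    using that by (simp add: degree_mult_eq)
  then have "degree detp = degree ([:1, c, 1:] ^ 3) + degree [:1 + 2 * b\<^sup>2, 0, -3:]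
      + degree (([:1, c, 1:] * [:1, 0, -1 :: real:]) ^ (CARD('n) - 2))"
    unfolding detp_def by (metis mult_eq_0_iff pCons_eq_0_iff power_eq_0_iff zero_neq_one one_neq_neg_numeral
        neg_equal_0_iff_equal zero_neq_numeral)
  then show ?thesis by simp
qed

text \<open>Where \<open>\<bar>s\<bar> = b\<close> the vectors \<open>y\<close> and \<open>X\<close> are parallel and do not span a plane. That locus is
  harmless for the geodesic derivative of \<open>s\<close>, since \<open>s\<^sup>2\<close> is maximal there.\<close>

lemma det_fundamental_tensor:
  assumes xy: "x \<in> U" "y \<noteq> 0" and sb: "(s x y)\<^sup>2 < b\<^sup>2"
  shows "det (fundamental_tensor L x y) = det (a x) * poly detp (s x y)"
proof -
  \<comment> \<open>The length of the component of \<open>X\<close> orthogonal to \<open>y\<close>;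
    it is nonzero by \<open>sb\<close>, so that \<open>e1\<close> and \<open>e2\<close> form an
    orthonormal basis of the plane of \<open>y\<close> and \<open>X\<close>.\<close>
  define r where "r = sqrt (b\<^sup>2 - (s x y)\<^sup>2)"
  have r: "r > 0" "r\<^sup>2 = b\<^sup>2 - (s x y)\<^sup>2" using sb by (auto simp: r_def)
  define e1 where "e1 = (1 / al x y) *\<^sub>R y"
  define e2 where "e2 = (1 / r) *\<^sub>R (X x - s x y *\<^sub>R e1)"
  have al: "al x y > 0" by (rule al_pos[OF xy])
  have E1: "bil (a x) e1 u = l u x y" for u
    by (simp add: e1_def bil_simps l_def)
  have E2: "bil (a x) e2 u = (bf x \<bullet> u - s x y * l u x y) / r" for u
    using xy by (simp add: e2_def bil_simps E1 bil_X)
  have le1: "l e1 x y = 1"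
    using al xy by (simp add: l_def e1_def bil_simps al_square[symmetric] power2_eq_square)
  have be1: "bf x \<bullet> e1 = s x y" by (simp add: e1_def s_def be_def)
  have le2: "l e2 x y = 0"
    using E1[of e2] spd_sym[OF spda[OF xy(1)], of e1 e2] E2[of e1] le1 be1 by simp
  have be2: "bf x \<bullet> e2 = r"
    using r xy by (simp add: e2_def inner_diff_right be1 beta_X power2_eq_square[symmetric] divide_eq_eq)
  have "det (fundamental_tensor L x y) = det (a x) * ((1 + c * s x y + (s x y)\<^sup>2) ^ 3
      * ((1 - (s x y)\<^sup>2) + 2 * r\<^sup>2) * ((1 + c * s x y + (s x y)\<^sup>2) * (1 - (s x y)\<^sup>2)) ^ (CARD('n) - 2))"
  proof (rule det_rank_two_perturbation[OF spda[OF xy(1)], of e1 e2 _ _ _ _ "c + 2 * s x y"])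
    show "bil (a x) e1 e1 = 1" by (simp add: E1 le1)
    show "bil (a x) e2 e2 = 1" using r by (simp add: E2 le2 be2)
    show "bil (a x) e1 e2 = 0" by (simp add: E1 le2)
    fix u v
    have "L x y * pd (0, v) (pd (0, u) L) x y
        = (1 + c * s x y + (s x y)\<^sup>2) * (al x y * pd (0, v) (pd (0, u) L) x y)"
      by (simp add: L_phi[OF xy])
    also have "al x y * pd (0, v) (pd (0, u) L) x y
        = (1 - (s x y)\<^sup>2) * (bil (a x) u v - l u x y * l v x y) + 2 * r\<^sup>2 * (bil (a x) e2 u * bil (a x) e2 v)"
    proof -
      have "bf x \<bullet> u - s x y * l u x y = r * bil (a x) e2 u" for u using r by (simp add: E2)
      then show ?thesis
        using pdv_pdv_L[OF xy, of v u] spd_sym[OF spda[OF xy(1)], of u v] by (simp add: power2_eq_square)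
    qed
    moreover have "pd (0, w) L x y = (1 + c * s x y + (s x y)\<^sup>2) * l w x y + (c + 2 * s x y) * r * bil (a x) e2 w" for w
    proof -
      have "(c + 2 * s x y) * r * bil (a x) e2 w = (c + 2 * s x y) * (bf x \<bullet> w - s x y * l w x y)"
        using r by (simp add: E2)
      then show ?thesis
        by (simp add: pdv_L[OF xy] algebra_simps power2_eq_square)
    qed
    ultimately show "bil (fundamental_tensor L x y) u v = (1 + c * s x y + (s x y)\<^sup>2) * ((1 - (s x y)\<^sup>2) *
        (bil (a x) u v - bil (a x) e1 u * bil (a x) e1 v) + 2 * r\<^sup>2 * (bil (a x) e2 u * bil (a x) e2 v))
        + ((1 + c * s x y + (s x y)\<^sup>2) * bil (a x) e1 u + (c + 2 * s x y) * r * bil (a x) e2 u)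
        * ((1 + c * s x y + (s x y)\<^sup>2) * bil (a x) e1 v + (c + 2 * s x y) * r * bil (a x) e2 v)"
      by (simp add: bil_fundamental_tensor[OF xy] E1)
  qed
  also have "(1 - (s x y)\<^sup>2) + 2 * r\<^sup>2 = 1 + 2 * b\<^sup>2 - 3 * (s x y)\<^sup>2"
    using r by simp
  moreover have "poly [:1, c, 1:] t = 1 + c * t + t\<^sup>2" "poly [:1, 0, -1:] t = 1 - t\<^sup>2"
    "poly [:1 + 2 * b\<^sup>2, 0, -3:] t = 1 + 2 * b\<^sup>2 - 3 * t\<^sup>2" for t
    by (simp_all add: algebra_simps power2_eq_square)
  ultimately show ?thesis
    by (simp only: detp_def poly_power poly_mult)
qed

text \<open>A frame with \<open>X / b\<close> as its member \<open>p\<close>. In it \<alpha> is the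
  Euclidean norm and \<beta> is \<open>b\<close> times one coordinate, so F looks the same on all
  tangent spaces of the patch.\<close>

lemma orthonormal_coordinates:
  fixes p :: 'n
  assumes x: "x \<in> U"
  obtains P :: "real^'n^'n" where "(det P)\<^sup>2 * det (a x) = 1"
    "\<And>u. bil (a x) (P *v u) (P *v u) = u \<bullet> u" "\<And>u. bf x \<bullet> (P *v u) = b * u $ p"
proof -
  have "bil (a x) ((1/b) *\<^sub>R X x) ((1/b) *\<^sub>R X x) = 1"
    using x b by (simp add: bil_simps bil_X beta_X power2_eq_square)
  then obtain f :: "'n \<Rightarrow> real^'n" where f: "\<And>i j. bil (a x) (f i) (f j) = (if i = j then 1 else 0)"
    and fp: "f p = (1/b) *\<^sub>R X x"
    using extend_orthonormal_frame[OF spda[OF x], of "{p}" "\<lambda>_. (1/b) *\<^sub>R X x"] by auto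
  define P :: "real^'n^'n" where "P = (\<chi> i j. f j $ i)"
  note P = frame_congruence[OF f, folded P_def]
  have PP: "bil (a x) (P *v u) (P *v v) = u \<bullet> v" for u v
  proof -
    have "u \<bullet> (transpose P *v z) = (P *v u) \<bullet> z" for z
      using dot_lmul_matrix[of z P u] by (simp add: inner_commute)
    then have "bil (a x) (P *v u) (P *v v) = u \<bullet> ((transpose P ** a x ** P) *v v)"
      by (simp only: bil_def matrix_vector_mul_assoc[symmetric])
    then show ?thesis by (simp add: P)
  qed
  have "bf x \<bullet> (P *v u) = b * u $ p" for u
  proof -
    have "P *v axis p 1 = (1/b) *\<^sub>R X x"
      using P(2)[of p] fp by (simp add: matrix_vector_mult_basis)
    then have "bil (a x) ((1/b) *\<^sub>R X x) (P *v u) = u $ p"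
      using PP[of "axis p 1" u] by (simp add: inner_axis')
    then show ?thesis using b x by (simp add: bil_simps bil_X field_simps)
  qed
  then show thesis using that[of P] P(3) PP by blast
qed

lemma det_a_pos: "x \<in> U \<Longrightarrow> det (a x) > 0"
proof -
  assume "x \<in> U"
  then obtain P :: "real^'n^'n" where "(det P)\<^sup>2 * det (a x) = 1"
    using orthonormal_coordinates by blast
  then show ?thesis
    by (metis mult_nonneg_nonpos not_less zero_le_power2 zero_less_one not_le)
qed

text \<open>The unit ball of \<open>L x\<close> is the image of one fixed set \<open>E\<close> under
  \<open>P\<close>, where \<open>det P\<close> has absolute value
  \<open>1 / sqrt (det (a x))\<close>. Most of the proof shows that \<open>E\<close> has positive
  and finite volume, which makes the constant positive.\<close>

lemma bh_density_eq:
  assumes "x0 \<in> U"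
  obtains C where "C > 0" "\<And>x. x \<in> U \<Longrightarrow> bh_density L x = C * sqrt (det (a x))"
proof -
  define p :: 'n where "p = undefined"
  \<comment> \<open>\<open>L x\<close> in these coordinates, the same for all \<open>x\<close>. At 0
    both vanish by division by zero, so the unit balls correspond exactly.\<close>
  define f where "f = (\<lambda>u :: real^'n. (u \<bullet> u + c * sqrt (u \<bullet> u) * (b * u $ p) + (b * u $ p)\<^sup>2) / sqrt (u \<bullet> u))"
  define E where "E = {u. f u < 1}"
  have Lf: "L x (P *v u) = f u" if "x \<in> U" "\<And>u. bil (a x) (P *v u) (P *v u) = u \<bullet> u" "\<And>u. bf x \<bullet> (P *v u) = b * u $ p"
    for x P u
    by (simp add: L_eq[OF that(1)] that f_def)
  have fpos: "f u > 0" if "u \<noteq> 0" for u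
  proof -
    obtain P :: "real^'n^'n" where P: "(det P)\<^sup>2 * det (a x0) = 1"
      "\<And>u. bil (a x0) (P *v u) (P *v u) = u \<bullet> u" "\<And>u. bf x0 \<bullet> (P *v u) = b * u $ p"
      using orthonormal_coordinates[OF assms] by blast
    have "P *v u \<noteq> 0" using P(2)[of u] that by (auto simp: bil_simps)
    then show ?thesis using L_pos[OF assms, of "P *v u"] Lf[OF assms P(2,3)] by simp
  qed
  have fscale: "f (t *\<^sub>R u) = t * f u" if "t > 0" for t u
  proof (cases "u = 0")
    case False
    have "sqrt (t *\<^sub>R u \<bullet> t *\<^sub>R u) = t * norm u" "sqrt (u \<bullet> u) = norm u"
      unfolding norm_eq_sqrt_inner[symmetric] using that by simp_all
    then show ?thesis
      using that False by (simp add: f_def power2_norm_eq_inner[symmetric] power2_eq_square field_simps)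
  qed (simp add: f_def)
  have meas: "E \<in> sets borel"
  proof -
    have "f \<in> borel_measurable borel"
      unfolding f_def
      by (intro borel_measurable_divide borel_measurable_continuous_onI continuous_intros)
    then have "f -` {..<1} \<inter> space borel \<in> sets borel"
      by (rule measurable_sets) simp
    then show ?thesis by (simp add: E_def vimage_def)
  qed
  have "bounded E"
  proof -
    have "continuous_on (sphere 0 1) f"
      unfolding f_def by (intro continuous_intros) auto
    moreover have "sphere (0 :: real^'n) 1 \<noteq> {}" by simp
    \<comment> \<open>By homogeneity the minimum \<open>f v\<close> on the unit sphere bounds
      \<open>E\<close> by the radius \<open>1 / f v\<close>.\<close>
    ultimately obtain v where v: "v \<in> sphere 0 1" "\<And>u. u \<in> sphere 0 1 \<Longrightarrow> f v \<le> f u"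
      using continuous_attains_inf[OF compact_sphere, of 0 1 f] by blast
    have fv: "f v > 0" using v(1) by (intro fpos) auto
    have "norm u \<le> 1 / f v" if "u \<in> E" for u
    proof (cases "u = 0")
      case False
      have "f v * norm u \<le> f ((1 / norm u) *\<^sub>R u) * norm u"
        using False by (intro mult_right_mono v) auto
      also have "\<dots> = f u" using False by (simp add: fscale)
      also have "\<dots> < 1" using that by (simp add: E_def)
      finally show ?thesis using fv by (simp add: field_simps)
    qed (use fv in simp)
    then show ?thesis by (auto simp: bounded_iff)
  qed
  \<comment> \<open>On the unit sphere a coordinate is at most 1 in absolute value, so
    \<open>f\<close> is at most \<open>1 + c * b + b^2\<close> there.\<close>
  have "ball 0 (1 / (1 + c * b + b\<^sup>2)) \<subseteq> E"
  proof
    fix u :: "real^'n" assume u: "u \<in> ball 0 (1 / (1 + c * b + b\<^sup>2))"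
    have k: "1 + c * b + b\<^sup>2 > 0" using b c by (simp add: add_pos_nonneg)
    show "u \<in> E"
    proof (cases "u = 0")
      case False
      have up: "\<bar>u $ p\<bar> \<le> norm u" by (rule component_le_norm_cart)
      have n: "sqrt (u \<bullet> u) = norm u" "u \<bullet> u = (norm u)\<^sup>2" by (simp_all add: norm_eq_sqrt_inner)
      have "c * norm u * (b * u $ p) \<le> c * norm u * (b * norm u)"
        using up b c by (intro mult_left_mono) auto
      moreover have "(b * u $ p)\<^sup>2 \<le> (b * norm u)\<^sup>2"
        using up b by (simp add: power_mult_distrib abs_le_square_iff[symmetric])
      ultimately have "f u \<le> ((norm u)\<^sup>2 + c * norm u * (b * norm u) + (b * norm u)\<^sup>2) / norm u"
        unfolding f_def n(1) unfolding n(2) by (intro divide_right_mono) auto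
      also have "\<dots> = (1 + c * b + b\<^sup>2) * norm u"
        using False by (simp add: field_simps power2_eq_square)
      also have "\<dots> < 1" using u k by (simp add: field_simps)
      finally show ?thesis by (simp add: E_def)
    qed (simp add: E_def f_def)
  qed
  moreover have Elm: "E \<in> lmeasurable"
    using meas \<open>bounded E\<close> by (intro bounded_set_imp_lmeasurable) auto
  moreover have "1 + c * b + b\<^sup>2 > 0" using b c by (simp add: add_pos_nonneg)
  ultimately have "measure lebesgue (ball (0 :: real^'n) (1 / (1 + c * b + b\<^sup>2))) \<le> measure lebesgue E"
    by (intro measure_mono_fmeasurable) auto
  moreover have "measure lebesgue (ball (0 :: real^'n) (1 / (1 + c * b + b\<^sup>2))) > 0"
    using content_ball_pos[of "1 / (1 + c * b + b\<^sup>2)" "0 :: real^'n"] \<open>1 + c * b + b\<^sup>2 > 0\<close>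
    by (simp add: measure_completion)
  ultimately have mE: "measure lebesgue E > 0" by linarith
  define C where "C = measure lebesgue (ball (0 :: real^'n) 1) / measure lebesgue E"
  have "C > 0"
    using mE content_ball_pos[of 1 "0 :: real^'n"] by (simp add: C_def measure_completion)
  moreover have "bh_density L x = C * sqrt (det (a x))" if x: "x \<in> U" for x
  proof -
    obtain P :: "real^'n^'n" where P: "(det P)\<^sup>2 * det (a x) = 1"
      "\<And>u. bil (a x) (P *v u) (P *v u) = u \<bullet> u" "\<And>u. bf x \<bullet> (P *v u) = b * u $ p"
      using orthonormal_coordinates[OF x] by blast
    have dP: "det P \<noteq> 0" using P(1) by auto
    have "{y. L x y < 1} = (*v) P ` E"
    proof -
      have "y = P *v (matrix_inv P *v y)" for y
        by (simp add: matrix_vector_mul_assoc matrix_inv_left_right[OF dP])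
      then show ?thesis
        using Lf[OF x P(2,3)] by (auto simp: E_def image_iff) metis
    qed
    then have "bh_density L x = C / \<bar>det P\<bar>"
      using measure_linear_image_finite[OF dP meas \<open>bounded E\<close>] by (simp add: bh_density_def C_def)
    moreover have "sqrt (det (a x)) = 1 / \<bar>det P\<bar>"
    proof (rule real_sqrt_unique)
      show "(1 / \<bar>det P\<bar>)\<^sup>2 = det (a x)"
        using P(1) dP by (simp add: power_divide field_simps)
    qed simp
    ultimately show ?thesis by simp
  qed
  ultimately show thesis using that by blast
qed

section \<open>Consequences of vanishing S-curvature\<close>

lemma smdet: "smooth_on U (\<lambda>x. det (a x))"
  by (intro smooth_on_det openU sma)

text \<open>Here \<open>S_zero\<close> enters: the logarithm of the density is a constant plus half
  of \<open>ln (det (a x))\<close>, so S = 0 expresses the divergence of the spray by the derivative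
  of \<open>det a\<close> along \<open>y\<close>.\<close>

lemma geodesic_det_a:
  assumes xy: "x \<in> U" "y \<noteq> 0"
  shows "pd (geo x y) (\<lambda>x y. det (a x)) x y = 2 * (\<Sum>i\<in>UNIV. py i (G i) x y) * det (a x)"
proof -
  obtain C where C: "C > 0" "\<And>x. x \<in> U \<Longrightarrow> bh_density L x = C * sqrt (det (a x))"
    using bh_density_eq[OF xy(1)] by blast
  let ?d = "frechet_derivative (\<lambda>x. det (a x)) (at x)"
  note dd = smooth_on_differentiable[OF smdet xy(1)]
  have "((\<lambda>x. det (a x)) has_derivative ?d) (at x)"
    using dd by (simp add: frechet_derivative_works[symmetric])
  then have "((\<lambda>x. ln C + ln (det (a x)) / 2) has_derivative (\<lambda>v. ?d v / (2 * det (a x)))) (at x)"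
    using det_a_pos[OF xy(1)] by (auto intro!: derivative_eq_intros simp: field_simps)
  then have "((\<lambda>x. ln (bh_density L x)) has_derivative (\<lambda>v. ?d v / (2 * det (a x)))) (at x)"
  proof (rule has_derivative_transform_within_open[OF _ openU xy(1)])
    show "ln C + ln (det (a z)) / 2 = ln (bh_density L z)" if "z \<in> U" for z
      using C(1) C(2)[OF that] det_a_pos[OF that] ln_sqrt[of "det (a z)"] by (simp add: ln_mult_pos)
  qed
  then have "frechet_derivative (\<lambda>x. ln (bh_density L x)) (at x) = (\<lambda>v. ?d v / (2 * det (a x)))"
    using frechet_derivative_at by metis
  then have "(\<Sum>i\<in>UNIV. py i (G i) x y) = (\<Sum>i\<in>UNIV. y $ i * (?d (axis i 1) / (2 * det (a x))))"
    using S_zero[OF xy] xy by (simp add: S_curvature_def dy_eq[OF smG])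
  also have "\<dots> = (\<Sum>i\<in>UNIV. y $ i * ?d (axis i 1)) / (2 * det (a x))"
    by (simp add: sum_divide_distrib)
  also have "(\<Sum>i\<in>UNIV. y $ i * ?d (axis i 1)) = ?d y"
  proof -
    note L = linear_frechet_derivative[OF dd]
    have "?d (\<Sum>i\<in>UNIV. y $ i *\<^sub>R axis i 1) = (\<Sum>i\<in>UNIV. y $ i * ?d (axis i 1))"
      by (simp add: linear_sum[OF L] linear_cmul[OF L])
    then show ?thesis
      by (simp add: basis_expansion[where 'a = real, unfolded scalar_mult_eq_scaleR])
  qed
  finally show ?thesis
    using det_a_pos[OF xy(1)] by (simp add: pd_base[OF dd] geo_def field_simps)
qed

text \<open>By \<open>det_geodesic_derivative\<close> and \<open>geodesic_det_a\<close> the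
  determinants of \<open>g\<close> and \<open>a\<close> grow at the same rate along the spray, so
  their quotient \<open>poly detp s\<close> has derivative zero.\<close>

lemma geodesic_s_interior:
  assumes xy: "x \<in> U" "y \<noteq> 0" and sb: "(s x y)\<^sup>2 < b\<^sup>2"
  shows "poly (pderiv detp) (s x y) * pd (geo x y) s x y = 0"
proof -
  \<comment> \<open>The formula for \<open>det g\<close> is available only on this set; being open,
    it suffices for comparing derivatives.\<close>
  define W where "W = {z. (s (fst z) (snd z))\<^sup>2 < b\<^sup>2 \<and> z \<in> U \<times> - {0}}"
  have "continuous_on (U \<times> - {0}) (\<lambda>z. (s (fst z) (snd z))\<^sup>2)"
    using smooth_on_continuous_on sm_power[OF sm_s, of 2] unfolding sm_def case_prod_beta' by blast
  then have "open W"
  proof -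
    assume c: "continuous_on (U \<times> - {0}) (\<lambda>z. (s (fst z) (snd z))\<^sup>2)"
    have "W = (U \<times> - {0}) \<inter> (\<lambda>z. (s (fst z) (snd z))\<^sup>2) -` {..<b\<^sup>2}"
      by (auto simp: W_def)
    then show ?thesis
      using continuous_open_preimage[OF c open_slit[OF openU] open_lessThan] by simp
  qed
  have sd: "sm U (\<lambda>x y. det (a x))" "sm U (\<lambda>x y. poly detp (s x y))"
    by (intro sm_base openU smdet sm_poly sm_s)+
  let ?N = "\<Sum>i\<in>UNIV. py i (G i) x y"
  have "2 * ?N * det (fundamental_tensor L x y) = pd (geo x y) (\<lambda>x y. det (fundamental_tensor L x y)) x y"
    by (rule det_geodesic_derivative[OF xy, symmetric])
  also have "\<dots> = pd (geo x y) (\<lambda>x y. det (a x) * poly detp (s x y)) x y"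
    unfolding pd_def
    by (rule fun_cong[OF frechet_derivative_cong_open[OF \<open>open W\<close>]])
      (use xy sb in \<open>auto simp: W_def intro!: det_fundamental_tensor\<close>)
  also have "\<dots> = det (a x) * (poly (pderiv detp) (s x y) * pd (geo x y) s x y) + 2 * ?N * det (a x) * poly detp (s x y)"
    using xy by (simp add: pd_mult[OF sd] pd_poly[OF sm_s] geodesic_det_a)
  finally show ?thesis
    using det_fundamental_tensor[OF xy sb] det_a_pos[OF xy(1)] by simp
qed

text \<open>For \<open>s^2 < b^2\<close>: a derivative that is nonzero at \<open>y\<close> stays
  nonzero nearby, where \<open>s\<close> can then take only the finitely many roots of
  \<open>pderiv detp\<close> as values. So \<open>s\<close> would be constant near \<open>y\<close>
  in the direction \<open>X\<close>, against its slope \<open>(b^2 - s^2) / al\<close>.\<close>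

lemma geodesic_s:
  assumes xy: "x \<in> U" "y \<noteq> 0"
  shows "pd (geo x y) s x y = 0"
proof (cases "(s x y)\<^sup>2 < b\<^sup>2")
  case False
  then have sb: "(s x y)\<^sup>2 = b\<^sup>2" using s_square_le[OF xy] by simp
  \<comment> \<open>\<open>s^2\<close> attains its upper bound \<open>b^2\<close> here, so its
    derivative vanishes, and \<open>s \<noteq> 0\<close> passes this on to \<open>s\<close>.\<close>
  have "(\<lambda>w. pd w (\<lambda>x y. (s x y)\<^sup>2) x y) = (\<lambda>w. 0)"
  proof (rule differential_zero_maxmin[OF _ open_slit[OF openU] sm_has_derivative[OF sm_power[OF sm_s] xy]])
    show "(x, y) \<in> U \<times> - {0}" using xy by simp
    show "(\<forall>z\<in>U \<times> - {0}. (case z of (x, y) \<Rightarrow> (s x y)\<^sup>2) \<le> (case (x, y) of (x, y) \<Rightarrow> (s x y)\<^sup>2)) \<or>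
      (\<forall>z\<in>U \<times> - {0}. (case (x, y) of (x, y) \<Rightarrow> (s x y)\<^sup>2) \<le> (case z of (x, y) \<Rightarrow> (s x y)\<^sup>2))"
      using s_square_le sb by auto
  qed
  then have "pd (geo x y) (\<lambda>x y. (s x y)\<^sup>2) x y = 0" by (rule fun_cong)
  moreover have "s x y \<noteq> 0" using sb b by auto
  ultimately show ?thesis using xy by (simp add: pd_power2[OF sm_s])
next
  case True
  show ?thesis
  proof (rule ccontr)
    assume ne: "pd (geo x y) s x y \<noteq> 0"
    \<comment> \<open>\<open>geo\<close> varies with the point; written out with its coefficients,
      the spray derivative of \<open>s\<close> is visibly smooth in \<open>(x, y)\<close>.\<close>
    define q where "q = (\<lambda>x y. (\<Sum>k\<in>UNIV. y $ k * px k s x y) - 2 * (\<Sum>k\<in>UNIV. G k x y * py k s x y))"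
    have smq: "sm U q"
      unfolding q_def by (intro sm_diff sm_mult sm_sum sm_const sm_component sm_pd sm_s smG openU)
    have q: "pd (geo x z) s x z = q x z" if "z \<noteq> 0" for z
      using pd_geo[OF sm_s xy(1) that] by (simp add: q_def)
    define \<gamma> where "\<gamma> = (\<lambda>t :: real. y + t *\<^sub>R X x)"
    have \<gamma>': "((\<lambda>t. (x, \<gamma> t)) has_derivative (\<lambda>t. (0, t *\<^sub>R X x))) (at 0)"
      unfolding \<gamma>_def by (auto intro!: derivative_eq_intros)
    have along: "((\<lambda>t. f x (\<gamma> t)) has_derivative (\<lambda>t. pd (0, t *\<^sub>R X x) f x y)) (at 0)" if "sm U f" for f
    proof -
      have "((\<lambda>(x, y). f x y) has_derivative (\<lambda>w. pd w f x y)) (at (x, \<gamma> 0))"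
        using sm_has_derivative[OF that xy] by (simp add: \<gamma>_def)
      from has_derivative_compose[OF \<gamma>' this] show ?thesis by simp
    qed
    have cont: "((\<lambda>t. f x (\<gamma> t)) \<longlongrightarrow> f x y) (at 0)" if "sm U f" for f
      using has_derivative_continuous[OF along[OF that]] by (simp add: continuous_within \<gamma>_def)
    \<comment> \<open>\<open>s x y\<close> may itself be a root, so it is taken out: near
      \<open>t = 0\<close> the values of \<open>s\<close> avoid \<open>R\<close> and, being roots,
      can only equal \<open>s x y\<close>.\<close>
    define R where "R = {r. poly (pderiv detp) r = 0} - {s x y}"
    have "pderiv detp \<noteq> 0" using detp_degree by (simp add: pderiv_eq_0_iff)
    then have "finite R" unfolding R_def by (intro finite_Diff poly_roots_finite)
    then have "open (- R)" by (simp add: finite_imp_closed open_Compl)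
    have "\<forall>\<^sub>F t in at 0. s x (\<gamma> t) \<in> - R"
      by (rule topological_tendstoD[OF cont[OF sm_s] \<open>open (- R)\<close>]) (simp add: R_def)
    moreover have "\<forall>\<^sub>F t in at 0. q x (\<gamma> t) \<noteq> 0"
      by (rule tendsto_imp_eventually_ne[OF cont[OF smq]]) (use ne q xy in auto)
    moreover have "\<forall>\<^sub>F t in at 0. (s x (\<gamma> t))\<^sup>2 < b\<^sup>2"
      by (rule order_tendstoD(2)[OF cont[OF sm_power[OF sm_s]] True])
    moreover have "\<forall>\<^sub>F t in at 0. \<gamma> t \<noteq> 0"
    proof (rule tendsto_imp_eventually_ne)
      show "(\<gamma> \<longlongrightarrow> y) (at 0)" unfolding \<gamma>_def by (auto intro!: tendsto_eq_intros)
    qed (rule xy)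
    ultimately have "\<forall>\<^sub>F t in at 0. s x (\<gamma> t) = s x y"
    proof eventually_elim
      case (elim t)
      have "poly (pderiv detp) (s x (\<gamma> t)) * q x (\<gamma> t) = 0"
        using geodesic_s_interior[OF xy(1) elim(4,3)] q[OF elim(4)] by simp
      then show ?case using elim by (auto simp: R_def)
    qed
    then have "((\<lambda>t. s x (\<gamma> t)) has_derivative (\<lambda>t. 0)) (at 0)"
      by (intro has_derivative_transform_eventually[OF has_derivative_const[of "s x y"]])
        (auto simp: eq_commute \<gamma>_def)
    from fun_cong[OF has_derivative_unique[OF this along[OF sm_s]], of 1]
    have "pd (0, X x) s x y = 0" by simp
    then show False
      using True al_pos[OF xy] xy by (simp add: pdv_s beta_X l_X power2_eq_square)
  qed
qed

text \<open>The momentum \<open>X\<^sup>i (F\<^sup>2)\<^sub>i\<close> is a function of \<open>F\<close> and \<open>s\<close>, both constant along geodesics.\<close>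

lemma X_killing:
  assumes xy: "x \<in> U" "y \<noteq> 0"
  shows "(\<Sum>k\<in>UNIV. X x $ k * px k K x y)
      + (\<Sum>k\<in>UNIV. \<Sum>j\<in>UNIV. y $ j * frechet_derivative (\<lambda>x. X x $ k) (at x) (axis j 1) * py k K x y) = 0"
proof -
  have sX: "sm U (\<lambda>x y. X x $ k)" for k
    by (rule sm_base[OF openU smX])
  \<comment> \<open>The fibre derivative of \<open>L\<close> in direction \<open>X\<close>: by
    \<open>pdv_L\<close>, with \<open>l (X x) x y = s x y\<close> and \<beta>(X) = b^2, a function
    of \<open>s\<close> alone.\<close>
  define k where "k = (\<lambda>x y. (1 - (s x y)\<^sup>2) * s x y + (c + 2 * s x y) * b\<^sup>2)"
  have s1: "sm U (\<lambda>x y. 1 - (s x y)\<^sup>2)" "sm U (\<lambda>x y. c + 2 * s x y)" "sm U (\<lambda>x y. 2 * s x y)" "sm U (\<lambda>x y. b\<^sup>2)"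
    by (intro sm_diff sm_add sm_mult sm_const sm_power sm_s openU)+
  have smk: "sm U k"
    unfolding k_def by (intro sm_add sm_mult s1 sm_s)
  have gk: "pd (geo x y) k x y = 0"
    using xy unfolding k_def
    by (simp add: pd_add[OF sm_mult[OF s1(1) sm_s] sm_mult[OF s1(2,4)]] pd_mult[OF s1(1) sm_s] pd_mult[OF s1(2,4)]
        pd_diff[OF sm_const[OF openU] sm_power[OF sm_s]] pd_power2[OF sm_s] pd_add[OF sm_const[OF openU] s1(3)]
        pd_cmult[OF sm_s] pd_const geodesic_s)
  have gL: "pd (geo x y) L x y = 0"
    using energy_conserved[OF xy] pd_power2[OF smL xy] L_pos[OF xy] by (simp add: sq_def[abs_def])
  have mom: "(\<Sum>i\<in>UNIV. X x $ i * py i K x y) = 2 * (L x y * k x y)" if "x \<in> U" "y \<noteq> 0" for x y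
  proof -
    have "(\<Sum>i\<in>UNIV. X x $ i * py i K x y) = pd (0, X x) K x y"
      using pd_expand[OF smK that, of 0 "X x"] by simp
    also have "\<dots> = 2 * L x y * pd (0, X x) L x y"
      using pd_power2[OF smL that] by (simp add: sq_def[abs_def])
    finally show ?thesis
      using that by (simp add: pdv_L l_X beta_X k_def)
  qed
  have s2: "sm U (\<lambda>x y. X x $ i * py i K x y)" for i
    by (intro sm_mult sX sm_pd smK)
  have "pd (geo x y) (\<lambda>x y. \<Sum>i\<in>UNIV. X x $ i * py i K x y) x y = pd (geo x y) (\<lambda>x y. 2 * (L x y * k x y)) x y"
    by (rule pd_cong[OF openU xy]) (rule mom)
  also have "\<dots> = 0"
    using xy by (simp add: pd_cmult[OF sm_mult[OF smL smk]] pd_mult[OF smL smk] gL gk)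
  finally have 1: "(\<Sum>i\<in>UNIV. X x $ i * pd (geo x y) (py i K) x y)
      + (\<Sum>i\<in>UNIV. pd (geo x y) (\<lambda>x y. X x $ i) x y * py i K x y) = 0"
    using xy by (simp add: pd_sum[OF openU s2] pd_mult[OF sX sm_pd[OF smK]] sum.distrib)
  have "pd (geo x y) (\<lambda>x y. X x $ i) x y = (\<Sum>j\<in>UNIV. y $ j * frechet_derivative (\<lambda>x. X x $ i) (at x) (axis j 1))" for i
  proof -
    note d = smooth_on_differentiable[OF smX xy(1)]
    have "frechet_derivative (\<lambda>x. X x $ i) (at x) 0 = 0"
      by (rule linear_0[OF linear_frechet_derivative[OF d]])
    then show ?thesis
      by (subst pd_geo[OF sX xy]) (simp add: pd_base[OF d])
  qed
  \<comment> \<open>The Euler-Lagrange equation; it turns conservation of the momentum into the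
    Killing equation.\<close>
  moreover have "pd (geo x y) (py i K) x y = px i K x y" for i
  proof -
    have "(\<Sum>k\<in>UNIV. y $ k * px k (py i K) x y) = (\<Sum>k\<in>UNIV. y $ k * py i (px k K) x y)"
      using xy by (simp add: K_commute[of x y "(0, axis i 1)"])
    then show ?thesis
      using spray_equation[OF xy, of i] by (simp add: pd_geo[OF sm_pd[OF smK] xy] mult.commute[of "G _ x y"])
  qed
  ultimately show ?thesis using 1 by (simp add: sum_distrib_right)
qed

theorem ricci_X_nonneg:
  assumes "x \<in> U"
  shows "ricci_curvature L x (X x) \<ge> 0"
proof (rule killing_geodesic_ricci[OF smX X_nz _ X_killing assms])
  \<comment> \<open>At \<open>y = X x\<close> one has \<alpha> = b and \<beta> = b^2.\<close>
  show "K x (X x) = ((b\<^sup>2 + c * b * b\<^sup>2 + b ^ 4) / b)\<^sup>2" if "x \<in> U" for x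
    using that b by (simp add: sq_def L_eq bil_X beta_X real_sqrt_power)
qed

end

section \<open>Charts and group actions\<close>

lemma chart_facts:
  assumes "smooth_manifold M" "c \<in> atlas M"
  shows "openin (mtop M) (fst c)" "open (chart_image c)" "fst c \<subseteq> points M" "inj_on (snd c) (fst c)"
    "\<And>W. openin (mtop M) W \<Longrightarrow> W \<subseteq> fst c \<Longrightarrow> open (snd c ` W)"
proof -
  have h: "homeomorphic_map (subtopology (mtop M) (fst c)) (top_of_set (chart_image c)) (snd c)"
    using assms by (simp add: smooth_manifold_def)
  show o: "openin (mtop M) (fst c)" and oc: "open (chart_image c)"
    using assms by (simp_all add: smooth_manifold_def)
  then show s: "fst c \<subseteq> points M" by (simp add: openin_subset)
  then have t: "topspace (subtopology (mtop M) (fst c)) = fst c" by auto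
  show "inj_on (snd c) (fst c)"
    using homeomorphic_imp_injective_map[OF h] unfolding t .
  fix W assume W: "openin (mtop M) W" "W \<subseteq> fst c"
  then have "openin (subtopology (mtop M) (fst c)) W"
    using o by (simp add: openin_open_subtopology)
  then have "openin (top_of_set (chart_image c)) (snd c ` W)"
    using homeomorphic_imp_open_map[OF h] by (simp add: open_map_def)
  then show "open (snd c ` W)" using oc by (simp add: openin_open_eq)
qed

lemma chart_inv_left: "smooth_manifold M \<Longrightarrow> c \<in> atlas M \<Longrightarrow> p \<in> fst c \<Longrightarrow> chart_inv c (snd c p) = p"
  by (simp add: chart_inv_def chart_facts)

lemma chart_inv_right:
  assumes "x \<in> chart_image c"
  shows "chart_inv c x \<in> fst c" "snd c (chart_inv c x) = x"
  using assms unfolding chart_inv_def chart_image_def by (auto intro: inv_into_into f_inv_into_f)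

text \<open>Chain rule on the open set of points of \<open>c\<close> that \<open>f\<close> maps into
  \<open>d\<close>. With \<open>f\<close> the identity it gives the transformation law for
  \<open>tvec\<close>, with \<open>f\<close> the action of a group element that for
  \<open>differential\<close>.\<close>

lemma derivative_change_chart:
  assumes M: "smooth_manifold M" and N: "smooth_manifold N"
    and f: "continuous_map (mtop M) (mtop N) f"
    and c: "c \<in> charts_at M p" and d: "d \<in> charts_at N (f p)" and d': "d' \<in> charts_at N (f p)"
    and df: "(snd d \<circ> f \<circ> chart_inv c) differentiable at (snd c p)"
  shows "frechet_derivative (snd d' \<circ> f \<circ> chart_inv c) (at (snd c p)) u
    = frechet_derivative (snd d' \<circ> chart_inv d) (at (snd d (f p)))
        (frechet_derivative (snd d \<circ> f \<circ> chart_inv c) (at (snd c p)) u)"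
proof -
  have c': "c \<in> atlas M" "p \<in> fst c" and dN: "d \<in> atlas N" "f p \<in> fst d" "d' \<in> atlas N" "f p \<in> fst d'"
    using c d d' by (auto simp: charts_at_def)
  define W where "W = fst c \<inter> {q \<in> points M. f q \<in> fst d}"
  have W: "openin (mtop M) W"
    unfolding W_def using chart_facts(1)[OF M c'(1)] openin_continuous_map_preimage[OF f chart_facts(1)[OF N dN(1)]]
    by (rule openin_Int)
  have oW: "open (snd c ` W)"
    by (rule chart_facts(5)[OF M c'(1) W]) (auto simp: W_def)
  have pW: "snd c p \<in> snd c ` W"
    using c' dN chart_facts(3)[OF M c'(1)] by (auto simp: W_def)
  have base: "(snd d \<circ> f \<circ> chart_inv c) (snd c p) = snd d (f p)"
    using chart_inv_left[OF M c'] by simp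
  have "smooth_on (snd d ` (fst d \<inter> fst d')) (snd d' \<circ> chart_inv d)"
    using N dN by (simp add: smooth_manifold_def)
  then have "(snd d' \<circ> chart_inv d) differentiable at (snd d (f p))"
    by (rule smooth_on_differentiable) (use dN in auto)
  then have "(snd d' \<circ> chart_inv d has_derivative frechet_derivative (snd d' \<circ> chart_inv d) (at (snd d (f p))))
      (at ((snd d \<circ> f \<circ> chart_inv c) (snd c p)))"
    unfolding frechet_derivative_works base .
  then have "((snd d' \<circ> chart_inv d) \<circ> (snd d \<circ> f \<circ> chart_inv c) has_derivative
      frechet_derivative (snd d' \<circ> chart_inv d) (at (snd d (f p))) \<circ>
      frechet_derivative (snd d \<circ> f \<circ> chart_inv c) (at (snd c p))) (at (snd c p))"
    using df unfolding frechet_derivative_works by (intro diff_chain_at)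
  then have "(snd d' \<circ> f \<circ> chart_inv c has_derivative
      frechet_derivative (snd d' \<circ> chart_inv d) (at (snd d (f p))) \<circ>
      frechet_derivative (snd d \<circ> f \<circ> chart_inv c) (at (snd c p))) (at (snd c p))"
    by (rule has_derivative_transform_within_open[OF _ oW pW])
      (auto simp: W_def chart_inv_left[OF M c'(1)] chart_inv_left[OF N dN(1)])
  from fun_cong[OF frechet_derivative_at[OF this], of u] show ?thesis by simp
qed

lemma transition_differentiable:
  assumes "smooth_manifold M" "c \<in> charts_at M p" "d \<in> charts_at M p"
  shows "(snd d \<circ> chart_inv c) differentiable at (snd c p)"
proof -
  have "smooth_on (snd c ` (fst c \<inter> fst d)) (snd d \<circ> chart_inv c)"
    using assms by (simp add: smooth_manifold_def charts_at_def)
  then show ?thesis by (rule smooth_on_differentiable) (use assms in \<open>auto simp: charts_at_def\<close>)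
qed

lemma tvec_in_tangent_space:
  assumes M: "smooth_manifold M" and c: "c \<in> charts_at M p"
  shows "tvec M p c u \<in> tangent_space M p"
proof -
  have "tvec M p c u d' = frechet_derivative (snd d' \<circ> chart_inv d) (at (snd d p)) (tvec M p c u d)"
    if d: "d \<in> charts_at M p" and d': "d' \<in> charts_at M p" for d d'
    using derivative_change_chart[OF M M continuous_map_id[unfolded id_def], of c p d d' u]
      transition_differentiable[OF M c d] c d d'
    by (simp add: tvec_def comp_def)
  moreover have "tvec M p c u d = 0" if "d \<notin> charts_at M p" for d
    using that by (simp add: tvec_def)
  ultimately show ?thesis unfolding tangent_space_def by blast
qed

lemma tvec_self:
  assumes M: "smooth_manifold M" and c: "c \<in> charts_at M p"
  shows "tvec M p c u c = u"
proof -
  have c': "c \<in> atlas M" "p \<in> fst c" using c by (auto simp: charts_at_def)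
  have "((\<lambda>x. x) has_derivative (\<lambda>u. u)) (at (snd c p))" by (rule has_derivative_ident)
  then have "(snd c \<circ> chart_inv c has_derivative (\<lambda>u. u)) (at (snd c p))"
    by (rule has_derivative_transform_within_open[OF _ chart_facts(2)[OF M c'(1)]])
      (use c' in \<open>auto simp: chart_inv_right chart_image_def\<close>)
  from fun_cong[OF frechet_derivative_at[OF this], of u] show ?thesis using c by (simp add: tvec_def)
qed

lemma tangent_eq_tvec:
  assumes "c \<in> charts_at M p" "v \<in> tangent_space M p"
  shows "v = tvec M p c (v c)"
proof
  fix d
  have "v d = frechet_derivative (snd d \<circ> chart_inv c) (at (snd c p)) (v c)" if "d \<in> charts_at M p"
    using assms that unfolding tangent_space_def by blast
  moreover have "v d = 0" if "d \<notin> charts_at M p"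
    using assms that unfolding tangent_space_def by blast
  ultimately show "v d = tvec M p c (v c) d"
    unfolding tvec_def by presburger
qed

lemma tvec_scaleR:
  assumes "smooth_manifold M" "c \<in> charts_at M p"
  shows "tvec M p c (t *\<^sub>R u) = (\<lambda>d. t *\<^sub>R tvec M p c u d)"
  using linear_cmul[OF linear_frechet_derivative[OF transition_differentiable[OF assms]]]
  by (auto simp: tvec_def fun_eq_iff)

lemma differential_in_tangent_space:
  assumes M: "smooth_manifold M" and f: "continuous_map (mtop M) (mtop M) f"
    and df: "\<And>c d. c \<in> charts_at M p \<Longrightarrow> d \<in> charts_at M (f p) \<Longrightarrow> (snd d \<circ> f \<circ> chart_inv c) differentiable at (snd c p)"
    and p: "p \<in> points M"
  shows "differential M M f p v \<in> tangent_space M (f p)"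
proof -
  \<comment> \<open>The chart picked in the definition of \<open>differential\<close>.\<close>
  define c where "c = (SOME c. c \<in> charts_at M p)"
  have "\<exists>c. c \<in> charts_at M p"
    using M p unfolding smooth_manifold_def charts_at_def by blast
  then have c: "c \<in> charts_at M p" unfolding c_def by (rule someI_ex)
  have D: "differential M M f p v = (\<lambda>d. if d \<in> charts_at M (f p)
      then frechet_derivative (snd d \<circ> f \<circ> chart_inv c) (at (snd c p)) (v c) else 0)"
    unfolding differential_def Let_def c_def ..
  show ?thesis
    unfolding tangent_space_def
  proof (intro CollectI conjI allI impI ballI)
    fix d d' assume d: "d \<in> charts_at M (f p)" and d': "d' \<in> charts_at M (f p)"
    show "differential M M f p v d'
      = frechet_derivative (snd d' \<circ> chart_inv d) (at (snd d (f p))) (differential M M f p v d)"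
      unfolding D if_P[OF d] if_P[OF d'] by (rule derivative_change_chart[OF M M f c d d' df[OF c d]])
  qed (simp add: D)
qed

text \<open>The action is smooth jointly in group element and point; freeze \<open>g\<close> inside
  a product chart whose first factor contains \<open>g\<close>.\<close>

lemma action_slice:
  assumes G: "smooth_manifold GM" and M: "smooth_manifold M"
    and act: "smooth_map (prod_mfd GM M) M (\<lambda>(g, p). act g p)"
    and g: "g \<in> points GM"
  shows "continuous_map (mtop M) (mtop M) (act g)"
    and "c \<in> charts_at M p \<Longrightarrow> d \<in> charts_at M (act g p) \<Longrightarrow>
      (snd d \<circ> act g \<circ> chart_inv c) differentiable at (snd c p)"
proof -
  have "continuous_map (prod_topology (mtop GM) (mtop M)) (mtop M) (\<lambda>(g, p). act g p)"
    using act by (simp add: smooth_map_def prod_mfd_def)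
  moreover have "continuous_map (mtop M) (prod_topology (mtop GM) (mtop M)) (\<lambda>p. (g, p))"
    using g by (intro continuous_map_pairedI) simp_all
  ultimately have "continuous_map (mtop M) (mtop M) ((\<lambda>(g, p). act g p) \<circ> (\<lambda>p. (g, p)))"
    using continuous_map_compose by blast
  then show "continuous_map (mtop M) (mtop M) (act g)" by (simp add: comp_def)
next
  assume c: "c \<in> charts_at M p" and d: "d \<in> charts_at M (act g p)"
  then have c': "c \<in> atlas M" "p \<in> fst c" and d': "d \<in> atlas M" "act g p \<in> fst d"
    by (auto simp: charts_at_def)
  obtain e where e: "e \<in> atlas GM" "g \<in> fst e"
    using G g unfolding smooth_manifold_def by blast
  let ?ec = "(fst e \<times> fst c, map_prod (snd e) (snd c))"
  have "?ec \<in> atlas (prod_mfd GM M)"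
    unfolding prod_mfd_def using e(1) c'(1) by (auto intro!: exI[of _ e] exI[of _ c] simp del: split_paired_Ex)
  then have "smooth_on (snd ?ec ` {z \<in> fst ?ec. (\<lambda>(g, p). act g p) z \<in> fst d})
      (snd d \<circ> (\<lambda>(g, p). act g p) \<circ> chart_inv ?ec)"
    using act d' unfolding smooth_map_def by blast
  then have "(snd d \<circ> (\<lambda>(g, p). act g p) \<circ> chart_inv ?ec) differentiable at (snd e g, snd c p)"
    by (rule smooth_on_differentiable) (use e c' d' in force)
  moreover have "((\<lambda>x. (snd e g, x)) has_derivative (\<lambda>u. (0, u))) (at (snd c p))"
    by (auto intro!: derivative_eq_intros)
  ultimately have 1: "((snd d \<circ> (\<lambda>(g, p). act g p) \<circ> chart_inv ?ec) \<circ> (\<lambda>x. (snd e g, x))) differentiable at (snd c p)"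
    by (intro differentiable_chain_at) (auto simp: differentiable_def)
  have "inj_on (map_prod (snd e) (snd c)) (fst e \<times> fst c)"
    using chart_facts(4)[OF G e(1)] chart_facts(4)[OF M c'(1)] by (rule map_prod_inj_on)
  then have "chart_inv ?ec (snd e g, x) = (g, chart_inv c x)" if "x \<in> chart_image c" for x
    unfolding chart_inv_def
    by (intro inv_into_f_eq) (use e chart_inv_right[OF that] in \<open>auto simp: chart_inv_def\<close>)
  then show "(snd d \<circ> act g \<circ> chart_inv c) differentiable at (snd c p)"
    by (intro differentiable_cong_open[OF chart_facts(2)[OF M c'(1)] _ _ 1])
      (use c' in \<open>auto simp: chart_image_def\<close>)
qed

section \<open>Matrix form of the metric and the dual norm\<close>

lemma bilinear_eq_bil:
  fixes h :: "real^'n::finite \<Rightarrow> real^'n \<Rightarrow> real"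
  assumes "bilinear h"
  shows "h u w = bil (\<chi> i j. h (axis i 1) (axis j 1)) u w"
proof -
  have "h u w = h (\<Sum>i\<in>UNIV. u $ i *\<^sub>R axis i 1) (\<Sum>i\<in>UNIV. w $ i *\<^sub>R axis i 1)"
    by (simp add: basis_expansion[where 'a = real, unfolded scalar_mult_eq_scaleR])
  also have "\<dots> = (\<Sum>i\<in>UNIV. \<Sum>j\<in>UNIV. h (u $ i *\<^sub>R axis i 1) (w $ j *\<^sub>R axis j 1))"
    by (simp add: bilinear_sum[OF assms] sum.cartesian_product)
  also have "\<dots> = (\<Sum>i\<in>UNIV. \<Sum>j\<in>UNIV. u $ i * h (axis i 1) (axis j 1) * w $ j)"
    by (simp add: bilinear_lmul[OF assms] bilinear_rmul[OF assms] mult_ac)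
  finally show ?thesis by (simp add: bil_expand)
qed

lemma linear_eq_inner:
  fixes h :: "real^'n::finite \<Rightarrow> real"
  assumes "linear h"
  shows "h u = (\<chi> i. h (axis i 1)) \<bullet> u"
proof -
  have "h u = h (\<Sum>i\<in>UNIV. u $ i *\<^sub>R axis i 1)"
    by (simp add: basis_expansion[where 'a = real, unfolded scalar_mult_eq_scaleR])
  then show ?thesis
    by (simp add: linear_sum[OF assms] linear_cmul[OF assms] inner_vec_def mult.commute)
qed

text \<open>\<open>sqrt N\<close> is the dual norm of \<open>f\<close>, as a maximum over unit
  vectors, attained at a multiple of the dual vector \<open>X\<close> if \<open>f\<close> is
  nonzero. A maximum depends only on the set of values, which is what isometries preserve.\<close>

lemma dual_norm_attained:
  fixes A :: "real^'n::finite^'n" and f :: "real^'n"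
  assumes A: "spd A"
  defines "N \<equiv> f \<bullet> (matrix_inv A *v f)"
  shows "N \<ge> 0" "\<And>u. bil A u u = 1 \<Longrightarrow> \<bar>f \<bullet> u\<bar> \<le> sqrt N" "\<exists>u. bil A u u = 1 \<and> \<bar>f \<bullet> u\<bar> = sqrt N"
    "f \<noteq> 0 \<Longrightarrow> N > 0"
proof -
  define X where "X = matrix_inv A *v f"
  have AX: "A *v X = f"
    using matrix_inv_left_right[OF spd_det_nz[OF A]] by (simp add: X_def matrix_vector_mul_assoc)
  then have fX: "bil A u X = f \<bullet> u" for u by (simp add: bil_def inner_commute)
  have N: "N = bil A X X" by (subst fX) (simp add: N_def X_def)
  show N0: "N \<ge> 0" unfolding N by (rule spd_nonneg[OF A])
  show Npos: "N > 0" if "f \<noteq> 0"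
    unfolding N using AX that by (intro spd_pos[OF A]) auto
  show "\<bar>f \<bullet> u\<bar> \<le> sqrt N" if "bil A u u = 1" for u
  proof -
    let ?z = "X - (f \<bullet> u) *\<^sub>R u"
    have "0 \<le> bil A ?z ?z" by (rule spd_nonneg[OF A])
    also have "\<dots> = N - (f \<bullet> u)\<^sup>2"
      using that spd_sym[OF A, of X u] by (simp add: bil_simps N fX power2_eq_square)
    finally have "(f \<bullet> u)\<^sup>2 \<le> N" by simp
    then show ?thesis using real_le_rsqrt by (metis power2_abs)
  qed
  show "\<exists>u. bil A u u = 1 \<and> \<bar>f \<bullet> u\<bar> = sqrt N"
  proof (cases "f = 0")
    case False
    let ?u = "(1 / sqrt N) *\<^sub>R X"
    have "bil A ?u ?u = 1" using Npos[OF False] by (simp add: bil_simps N[symmetric])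
    moreover have "\<bar>f \<bullet> ?u\<bar> = sqrt N"
      using Npos[OF False] fX[of X] by (simp add: N[symmetric] real_div_sqrt)
    ultimately show ?thesis by blast
  next
    case True
    \<comment> \<open>For \<open>f = 0\<close> every unit vector attains the bound; normalizing a
      basis vector provides one.\<close>
    let ?e = "axis undefined 1 :: real^'n"
    have "bil A ?e ?e > 0" by (rule spd_pos[OF A]) simp
    then have "bil A ((1 / sqrt (bil A ?e ?e)) *\<^sub>R ?e) ((1 / sqrt (bil A ?e ?e)) *\<^sub>R ?e) = 1"
      by (simp add: bil_simps)
    then show ?thesis using True by (auto simp: N_def)
  qed
qed

theorem corollary4p5:
  fixes G :: "'g monoid"
    and GM :: "('g, 'e::euclidean_space) mfd"
    and M :: "('m, real^'n::finite) mfd"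
    and act :: "'g \<Rightarrow> 'm \<Rightarrow> 'm" and p0 :: 'm
    and H :: "'g set" and \<kk> :: "('g, 'e) tangent set"
    and a :: "'m \<Rightarrow> ('m, real^'n) tangent \<Rightarrow> ('m, real^'n) tangent \<Rightarrow> real"
    and \<beta> F :: "'m \<Rightarrow> ('m, real^'n) tangent \<Rightarrow> real"
  assumes "homogeneous_finsler_space G GM M act p0 H \<kk> F"
    and "riemannian_metric M a" and "invariant_metric G M act a"
    and "one_form M \<beta>" and "invariant_under G M act \<beta>"
    and "alpha_beta_regular M square_\<phi> a \<beta> \<and>
           (\<forall>p\<in>points M. \<forall>v\<in>tangent_space M p. F p v = square_metric a \<beta> p v) \<or>
         alpha_beta_regular M square_randers_\<phi> a \<beta> \<and>
           (\<forall>p\<in>points M. \<forall>v\<in>tangent_space M p. F p v = square_randers_metric a \<beta> p v)"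
    and "vanishing_S_curvature M F"
    and "negative_ricci_curvature M F"
  shows "is_riemannian M F"
proof -
  have GM: "smooth_manifold GM" "points GM = carrier G" and M: "smooth_manifold M"
    and ta: "transitive_action G (points M) act"
    and sact: "smooth_map (prod_mfd GM M) M (\<lambda>(g, p). act g p)" and FM: "finsler_metric M F"
    using assms(1) by (auto simp: homogeneous_finsler_space_def reductive_homogeneous_space_def lie_group_def)
  \<comment> \<open>\<open>\<kappa>\<close> is 2 for the square metric and 3 for its Randers change.
    There the extra \<beta> stands outside the fraction, so at \<alpha> = 0 the common formula
    requires \<beta> = 0.\<close>
  obtain \<kappa> :: real where \<kappa>: "\<kappa> \<ge> 0" and Fk: "\<And>p v. p \<in> points M \<Longrightarrow> v \<in> tangent_space M p \<Longrightarrow>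
      metric_norm a p v \<noteq> 0 \<or> \<beta> p v = 0 \<Longrightarrow>
      F p v = ((metric_norm a p v)\<^sup>2 + \<kappa> * metric_norm a p v * \<beta> p v + (\<beta> p v)\<^sup>2) / metric_norm a p v"
  proof -
    from assms(6) show thesis
    proof (elim disjE conjE)
      assume "\<forall>p\<in>points M. \<forall>v\<in>tangent_space M p. F p v = square_metric a \<beta> p v"
      then show thesis by (intro that[of 2]) (auto simp: square_metric_def power2_sum algebra_simps)
    next
      assume "\<forall>p\<in>points M. \<forall>v\<in>tangent_space M p. F p v = square_randers_metric a \<beta> p v"
      then show thesis
        by (intro that[of 3]) (auto simp: square_randers_metric_def power2_eq_square field_simps)
    qed
  qed
  \<comment> \<open>The set whose maximum is the norm of \<beta> at \<open>p\<close>. Group elements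
    preserve unit vectors and \<beta>, so by transitivity it is the same at all points.\<close>
  define unit_values where "unit_values p = {\<bar>\<beta> p v\<bar> |v. v \<in> tangent_space M p \<and> a p v v = 1}" for p
  have "unit_values p \<subseteq> unit_values q" if pq: "p \<in> points M" "q \<in> points M" for p q
  proof -
    obtain g where g: "g \<in> carrier G" "act g p = q"
      using transitive_action.unique_orbit[OF ta pq] by blast
    have gG: "g \<in> points GM" using g GM by simp
    have "differential M M (act g) p v \<in> tangent_space M q" for v
      using differential_in_tangent_space[OF M action_slice(1)[OF GM(1) M sact gG] action_slice(2)[OF GM(1) M sact gG] pq(1)]
      unfolding g(2) .
    moreover have "a q (differential M M (act g) p v) (differential M M (act g) p v) = a p v v"
      "\<beta> q (differential M M (act g) p v) = \<beta> p v" if "v \<in> tangent_space M p" for v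
      using assms(3,5) that pq g(1) unfolding invariant_metric_def invariant_under_def g(2)[symmetric] by blast+
    note D = calculation this
    show ?thesis
    proof
      fix r assume "r \<in> unit_values p"
      then obtain v where "r = \<bar>\<beta> p v\<bar>" and v: "v \<in> tangent_space M p" "a p v v = 1"
        unfolding unit_values_def by blast
      then show "r \<in> unit_values q"
        unfolding unit_values_def using D(1)[of v] D(2,3)[OF v(1)]
        by (intro CollectI exI[of _ "differential M M (act g) p v"]) simp
    qed
  qed
  then have units: "unit_values p = unit_values q" if "p \<in> points M" "q \<in> points M" for p q
    using that by blast
  have cp: "p \<in> points M" if "c \<in> charts_at M p" for c p
  proof -
    have "c \<in> atlas M" "p \<in> fst c" using that by (simp_all add: charts_at_def)
    then show ?thesis using chart_facts(3)[OF M, of c] by blast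
  qed
  have a_pos: "a p v v > 0" if "p \<in> points M" "v \<in> tangent_space M p" "v \<noteq> (\<lambda>_. 0)" for p v
    using assms(2) that by (simp add: riemannian_metric_def)
  have bil_a: "bilinear (\<lambda>u w. a p (tvec M p c u) (tvec M p c w))" if "c \<in> charts_at M p" for p c
    using assms(2) that cp[OF that] by (simp add: riemannian_metric_def)
  have lin_\<beta>: "linear (\<lambda>u. \<beta> p (tvec M p c u))" if "c \<in> charts_at M p" for p c
    using assms(4) that cp[OF that] by (simp add: one_form_def)
  show ?thesis
  \<comment> \<open>If \<beta> = 0 then F = \<alpha>, and \<open>a\<close> is the required bilinear
    form; otherwise one chart around a point with \<beta> nonzero yields a contradiction.\<close>
  proof (cases "\<forall>p\<in>points M. \<forall>v\<in>tangent_space M p. \<beta> p v = 0")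
    case True
    have "(F p v)\<^sup>2 = a p v v" if pv: "p \<in> points M" "v \<in> tangent_space M p" for p v
    proof -
      obtain c where c: "c \<in> charts_at M p"
        using M pv(1) unfolding smooth_manifold_def charts_at_def by blast
      have "a p v v \<ge> 0"
      proof (cases "v = (\<lambda>_. 0)")
        case True
        then show ?thesis
          using tangent_eq_tvec[OF c pv(2)] bilinear_lzero[OF bil_a[OF c], of 0] by simp
      qed (use a_pos[OF pv] in simp)
      moreover have "\<beta> p v = 0" using True pv by blast
      ultimately show ?thesis using Fk[OF pv] by (simp add: metric_norm_def power2_eq_square)
    qed
    then show ?thesis
      unfolding is_riemannian_def using bil_a by (intro ballI exI[of _ "a _"]) auto
  next
    case False
    then obtain p v where pv: "p \<in> points M" "v \<in> tangent_space M p" "\<beta> p v \<noteq> 0" by blast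
    obtain c where c: "c \<in> charts_at M p"
      using M pv(1) unfolding smooth_manifold_def charts_at_def by blast
    have cM: "c \<in> atlas M" using c by (simp add: charts_at_def)
    define U where "U = chart_image c"
    define L where "L = local_rep M F c"
    \<comment> \<open>Coordinate vectors as tangent vectors; \<open>A\<close> and \<open>f\<close>
      are then the Gram matrix of \<open>a\<close> and the components of \<beta> in the
      chart.\<close>
    define \<tau> where "\<tau> = (\<lambda>x. tvec M (chart_inv c x) c)"
    define A where "A = (\<lambda>x. \<chi> i j. a (chart_inv c x) (\<tau> x (axis i 1)) (\<tau> x (axis j 1)))"
    define f where "f = (\<lambda>x. \<chi> i. \<beta> (chart_inv c x) (\<tau> x (axis i 1)))"
    have cx: "c \<in> charts_at M (chart_inv c x)" if "x \<in> U" for x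
      using cM chart_inv_right(1)[of x c] that by (simp add: charts_at_def U_def)
    have \<tau>: "\<tau> x u \<in> tangent_space M (chart_inv c x)" "\<tau> x u c = u" if "x \<in> U" for x u
      unfolding \<tau>_def by (rule tvec_in_tangent_space[OF M cx[OF that]], rule tvec_self[OF M cx[OF that]])
    have A: "a (chart_inv c x) (\<tau> x u) (\<tau> x w) = bil (A x) u w" if "x \<in> U" for x u w
      using bilinear_eq_bil[OF bil_a[OF cx[OF that]], of u w] by (simp add: A_def \<tau>_def)
    have f: "\<beta> (chart_inv c x) (\<tau> x u) = f x \<bullet> u" if "x \<in> U" for x u
      using linear_eq_inner[OF lin_\<beta>[OF cx[OF that]], of u] by (simp add: f_def \<tau>_def)
    have spdA: "spd (A x)" if x: "x \<in> U" for x
      unfolding spd_def A[OF x, symmetric]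
    proof (intro conjI allI impI)
      show "a (chart_inv c x) (\<tau> x u) (\<tau> x w) = a (chart_inv c x) (\<tau> x w) (\<tau> x u)" for u w
        using assms(2) \<tau>[OF x] cp[OF cx[OF x]] by (simp add: riemannian_metric_def)
      show "a (chart_inv c x) (\<tau> x u) (\<tau> x u) > 0" if "u \<noteq> 0" for u
        using \<tau>[OF x, of u] that by (intro a_pos[OF cp[OF cx[OF x]]]) auto
    qed
    have uv: "unit_values (chart_inv c x) = {\<bar>f x \<bullet> u\<bar> |u. bil (A x) u u = 1}" if x: "x \<in> U" for x
    proof -
      have "v = \<tau> x (v c)" if "v \<in> tangent_space M (chart_inv c x)" for v
        unfolding \<tau>_def by (rule tangent_eq_tvec[OF cx[OF x] that])
      then show ?thesis
        unfolding unit_values_def using \<tau>[OF x] A[OF x] f[OF x] by (smt (verit) Collect_cong)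
    qed
    define N where "N = (\<lambda>x. f x \<bullet> (matrix_inv (A x) *v f x))"
    have N_const: "N x = N y" if xy: "x \<in> U" "y \<in> U" for x y
    proof -
      have le: "sqrt (N x) \<le> sqrt (N y)" if xy: "x \<in> U" "y \<in> U" for x y
      proof -
        have "sqrt (N x) \<in> unit_values (chart_inv c x)"
          using dual_norm_attained(3)[OF spdA[OF xy(1)], of "f x"] unfolding uv[OF xy(1)] N_def by force
        also have "unit_values (chart_inv c x) = unit_values (chart_inv c y)"
          by (rule units[OF cp[OF cx[OF xy(1)]] cp[OF cx[OF xy(2)]]])
        finally obtain u where u: "bil (A y) u u = 1" "sqrt (N x) = \<bar>f y \<bullet> u\<bar>"
          unfolding uv[OF xy(2)] by blast
        then show ?thesis
          using dual_norm_attained(2)[OF spdA[OF xy(2)] u(1), of "f y"] by (simp only: N_def)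
      qed
      show ?thesis using le[OF xy] le[OF xy(2,1)] by simp
    qed
    define x0 where "x0 = snd c p"
    have x0: "x0 \<in> U" "chart_inv c x0 = p"
      using c chart_inv_left[OF M cM] by (auto simp: x0_def U_def charts_at_def chart_image_def)
    have "f x0 \<noteq> 0"
      using f[OF x0(1), of "v c"] tangent_eq_tvec[OF c pv(2)] pv(3) x0(2) by (auto simp: \<tau>_def)
    then have N0: "N x0 > 0" unfolding N_def by (rule dual_norm_attained(4)[OF spdA[OF x0(1)]])
    \<comment> \<open>The constant \<open>b\<close> of the patch is the norm of \<beta> at
      \<open>x0\<close>: positive since \<beta> is nonzero there, and the same on all of
      \<open>U\<close> by \<open>N_const\<close>.\<close>
    interpret alpha_beta_patch U L A f \<kappa> "sqrt (N x0)"
    proof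
      show "sm U L"
        using FM cM chart_facts(2)[OF M cM] by (auto simp: sm_def finsler_metric_def U_def L_def)
      show "L x (t *\<^sub>R y) = t * L x y" if "x \<in> U" "t > 0" for x y t
        using FM \<tau>(1)[OF that(1), of y] cp[OF cx[OF that(1)]] that(2) tvec_scaleR[OF M cx[OF that(1)], of t y]
        by (simp add: finsler_metric_def L_def local_rep_def \<tau>_def)
      show "u \<bullet> (fundamental_tensor L x y *v u) > 0" if "x \<in> U" "y \<noteq> 0" "u \<noteq> 0" for x y u
        using FM cM that by (simp add: finsler_metric_def U_def L_def)
      show "smooth_on U (\<lambda>x. A x $ i $ j)" for i j
        using assms(2) cM by (simp add: riemannian_metric_def A_def \<tau>_def U_def)
      show "smooth_on U (\<lambda>x. f x $ i)" for i
        using assms(4) cM by (simp add: one_form_def f_def \<tau>_def U_def)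
      show "f x \<bullet> (matrix_inv (A x) *v f x) = (sqrt (N x0))\<^sup>2" if "x \<in> U" for x
        using N_const[OF that x0(1)] N0 by (simp add: N_def)
      show "L x y = (bil (A x) y y + \<kappa> * sqrt (bil (A x) y y) * (f x \<bullet> y) + (f x \<bullet> y)\<^sup>2) / sqrt (bil (A x) y y)"
        if x: "x \<in> U" for x y
      proof -
        \<comment> \<open>At \<open>y = 0\<close> the side condition of \<open>Fk\<close> holds by
          its second alternative.\<close>
        have "sqrt (bil (A x) y y) \<noteq> 0 \<or> f x \<bullet> y = 0"
          using spd_pos[OF spdA[OF x], of y] by (cases "y = 0") auto
        then show ?thesis
          using Fk[OF cp[OF cx[OF x]] \<tau>(1)[OF x, of y]] spd_nonneg[OF spdA[OF x], of y]
          by (simp add: L_def local_rep_def \<tau>_def[symmetric] metric_norm_def A[OF x] f[OF x])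
            (simp add: \<tau>_def A[OF x, unfolded \<tau>_def] f[OF x, unfolded \<tau>_def])
      qed
      show "L x y > 0" if "x \<in> U" "y \<noteq> 0" for x y
      proof -
        have "\<tau> x y \<noteq> (\<lambda>_. 0)" using \<tau>(2)[OF that(1), of y] that(2) by auto
        then show ?thesis
          using FM \<tau>(1)[OF that(1), of y] cp[OF cx[OF that(1)]]
          by (simp add: finsler_metric_def L_def local_rep_def \<tau>_def)
      qed
      show "S_curvature L x y = 0" if "x \<in> U" "y \<noteq> 0" for x y
        using assms(7) cM that by (simp add: vanishing_S_curvature_def U_def L_def)
    qed (use spdA N0 \<kappa> in auto)
    have "ricci_curvature L x0 (X x0) < 0"
      using assms(8) cM x0(1) X_nz[OF x0(1)] by (simp add: negative_ricci_curvature_def U_def L_def)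
    then show ?thesis using ricci_X_nonneg[OF x0(1)] by simp
  qed
qed

end
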